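(* Let $n\geq 2$ and let $\Bbbk$ be any (nontrivial) commutative ring. The mesh category $Q$ over $\Bbbk$ of the double quiver of $\vec{\mathbb{A}}_n$ is Hom-finite, locally bounded, has a Serre functor relative to $\Bbbk$ and has the Strong Retraction Property. More precisely, the following assertions hold. (a) Every hom $\Bbbk$-module $Q(p,q)$ is free of dimension $d(p,q)=\min\{p,\,q,\,n+1-p,\,n+1-q\}\in\mathbb{N}$. (b) The Serre functor $\mathbb{S}$ is given by $\mathbb{S}(q)=n+1-q$ on objects and its action on morphisms is determined by the formulae $\mathbb{S}(a_q)=(-1)^q a^*_{n-q}$ and $\mathbb{S}(a^*_q)=(-1)^{n-q}a_{n-q}$ for $1\leq q<n$. Moreover, the arrow ideal $\mathfrak{r}$ (which is the pseudo-radical in $Q$) is nilpotent; in fact, one has $\mathfrak{r}^n=0$.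
   Context: $\vec{\mathbb{A}}_n$ is the quiver with vertices $1,\dots,n$ and arrows $a_q\colon q\to q+1$ for $1\leq q<n$. Its double quiver has vertices $1,\dots,n$ and arrows $a_q\colon q\to q+1$ and $a_q^*\colon q+1\to q$ for $1\leq q<n$. The path category over $\Bbbk$ has the vertices as objects, and the hom module from $p$ to $q$ is the free $\Bbbk$-module on the set of paths from $p$ to $q$ (including trivial paths $\mathrm{id}_q$; paths are composed like functions, right to left). The mesh category $Q$ is the quotient of the path category by the two-sided ideal generated by the mesh relations $$\mu_1=a_1^*a_1,\qquad \mu_q=a_{q-1}a_{q-1}^*+a_q^*a_q\ (1<q<n),\qquad \mu_n=a_{n-1}a_{n-1}^*.$$ The arrow ideal $\mathfrak{r}$ is the ideal of $Q$ generated by all arrows, and $\mathfrak{r}^n$ is its $n$-th power. For a small $\Bbbk$-preadditive category $Q$ (hom sets $Q(p,q)$ are $\Bbbk$-modules and composition is bilinear): - Hom-finite: each $Q(p,q)$ is a finitely generated projective $\Bbbk$-module. - Locally bounded: for each object $q$ the sets $\{p \mid Q(p,q)\neq 0\}$ and $\{r \mid Q(q,r)\neq 0\}$ are finite. - Serre functor relative to $\Bbbk$: a $\Bbbk$-linear autoequivalence $\mathbb{S}\colon Q\to Q$ together with an isomorphism $Q(p,q)\cong \operatorname{Hom}_{\Bbbk}(Q(q,\mathbb{S}(p)),\Bbbk)$ natural in $p,q$. - Strong Retraction Property: for each $q$ the map $\Bbbk\to Q(q,q)$, $x\mapsto x\cdot\mathrm{id}_q$, has a $\Bbbk$-module retraction,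 and there is a collection $\{\mathfrak{r}_q\}_{q\in Q}$ of $\Bbbk$-submodules $\mathfrak{r}_q\subseteq Q(q,q)$ with $Q(q,q)=(\Bbbk\cdot\mathrm{id}_q)\oplus\mathfrak{r}_q$ such that $\mathfrak{r}_q\circ\mathfrak{r}_q\subseteq\mathfrak{r}_q$ for all $q$ and $Q(q,p)\circ Q(p,q)\subseteq\mathfrak{r}_p$ for all $p\neq q$. The associated pseudo-radical is the ideal with value $\mathfrak{r}_q$ at $(q,q)$ and $Q(p,q)$ at $(p,q)$ for $p\neq q$; here $\mathfrak{r}_q=\mathfrak{r}(q,q)$ for the arrow ideal $\mathfrak{r}$. *)

theory Defs
  imports "Graph_Theory.Arc_Walk" "HOL-Algebra.AbelCoset" "HOL-Algebra.Module"
begin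

section \<open>Modules over a commutative ring\<close>

text \<open>
  The record type \<^type>\<open>module\<close> extends the ring record. The fields \<open>mult\<close> and \<open>one\<close> play no
  role for modules, so they are left unspecified in the constructions below.
\<close>

definition linear_map ::
  "('k, 'z) ring_scheme \<Rightarrow> ('k, 'a) module \<Rightarrow> ('k, 'b) module \<Rightarrow> ('a \<Rightarrow> 'b) \<Rightarrow> bool" where
  "linear_map R M N f \<longleftrightarrow>
     f \<in> carrier M \<rightarrow> carrier N \<and>
     (\<forall>x\<in>carrier M. \<forall>y\<in>carrier M. f (x \<oplus>\<^bsub>M\<^esub> y) = f x \<oplus>\<^bsub>N\<^esub> f y) \<and>
     (\<forall>c\<in>carrier R. \<forall>x\<in>carrier M. f (c \<odot>\<^bsub>M\<^esub> x) = c \<odot>\<^bsub>N\<^esub> f x)"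

definition ring_module :: "('k, 'z) ring_scheme \<Rightarrow> ('k, 'k) module" where
  "ring_module R =
     \<lparr>carrier = carrier R, mult = (\<otimes>\<^bsub>R\<^esub>), one = \<one>\<^bsub>R\<^esub>, zero = \<zero>\<^bsub>R\<^esub>, add = (\<oplus>\<^bsub>R\<^esub>),
      smult = (\<otimes>\<^bsub>R\<^esub>)\<rparr>"

text \<open>Linear forms are taken extensional, so that equal forms are equal functions.\<close>

definition dual_module :: "('k, 'z) ring_scheme \<Rightarrow> ('k, 'a) module \<Rightarrow> ('k, 'a \<Rightarrow> 'k) module" where
  "dual_module R M =
     \<lparr>carrier = {\<phi> \<in> extensional (carrier M). linear_map R M (ring_module R) \<phi>},
      mult = undefined, one = undefined,
      zero = (\<lambda>x\<in>carrier M. \<zero>\<^bsub>R\<^esub>),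
      add = (\<lambda>\<phi> \<psi>. \<lambda>x\<in>carrier M. \<phi> x \<oplus>\<^bsub>R\<^esub> \<psi> x),
      smult = (\<lambda>c \<phi>. \<lambda>x\<in>carrier M. c \<otimes>\<^bsub>R\<^esub> \<phi> x)\<rparr>"

text \<open>
  The free module on the set \<open>X\<close>: finitely supported functions, extended by zero outside \<open>X\<close>.
\<close>

definition free_module :: "('k, 'z) ring_scheme \<Rightarrow> 'x set \<Rightarrow> ('k, 'x \<Rightarrow> 'k) module" where
  "free_module R X =
     \<lparr>carrier = {f. (\<forall>x. f x \<in> carrier R) \<and> (\<forall>x. x \<notin> X \<longrightarrow> f x = \<zero>\<^bsub>R\<^esub>) \<and> finite {x. f x \<noteq> \<zero>\<^bsub>R\<^esub>}},
      mult = undefined, one = undefined,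
      zero = (\<lambda>x. \<zero>\<^bsub>R\<^esub>),
      add = (\<lambda>f g x. f x \<oplus>\<^bsub>R\<^esub> g x),
      smult = (\<lambda>c f x. c \<otimes>\<^bsub>R\<^esub> f x)\<rparr>"

definition basis_vector :: "('k, 'z) ring_scheme \<Rightarrow> 'x \<Rightarrow> 'x \<Rightarrow> 'k" where
  "basis_vector R x = (\<lambda>y. if y = x then \<one>\<^bsub>R\<^esub> else \<zero>\<^bsub>R\<^esub>)"

definition quotient_module ::
  "('k, 'a) module \<Rightarrow> 'a set \<Rightarrow> ('k, 'a set) module" where
  "quotient_module M N =
     \<lparr>carrier = a_rcosets\<^bsub>M\<^esub> N, mult = undefined, one = undefined,
      zero = N, add = set_add M,
      smult = (\<lambda>c A. \<Union>a\<in>A. N +>\<^bsub>M\<^esub> (c \<odot>\<^bsub>M\<^esub> a))\<rparr>"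

definition free_of_rank :: "('k, 'z) ring_scheme \<Rightarrow> ('k, 'a) module \<Rightarrow> nat \<Rightarrow> bool" where
  "free_of_rank R M d \<longleftrightarrow>
     (\<exists>B. finite B \<and> card B = d \<and> B \<subseteq> carrier M \<and>
        (\<forall>x\<in>carrier M. \<exists>!c. c \<in> B \<rightarrow>\<^sub>E carrier R \<and> x = (\<Oplus>\<^bsub>M\<^esub>b\<in>B. c b \<odot>\<^bsub>M\<^esub> b)))"

definition finitely_generated :: "('k, 'z) ring_scheme \<Rightarrow> ('k, 'a) module \<Rightarrow> bool" where
  "finitely_generated R M \<longleftrightarrow>
     (\<exists>B. finite B \<and> B \<subseteq> carrier M \<and>
        (\<forall>x\<in>carrier M. \<exists>c \<in> B \<rightarrow> carrier R. x = (\<Oplus>\<^bsub>M\<^esub>b\<in>B. c b \<odot>\<^bsub>M\<^esub> b)))"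

text \<open>
  A projective module is a direct summand of a free module. The set \<open>X\<close> may be taken in the
  type of the elements of \<open>M\<close> without loss of generality: a projective \<open>M\<close> is a summand of the
  free module on \<open>carrier M\<close>.
\<close>

definition projective :: "('k, 'z) ring_scheme \<Rightarrow> ('k, 'a) module \<Rightarrow> bool" where
  "projective R M \<longleftrightarrow>
     (\<exists>(X :: 'a set) i \<pi>. linear_map R M (free_module R X) i \<and> linear_map R (free_module R X) M \<pi> \<and>
        (\<forall>x\<in>carrier M. \<pi> (i x) = x))"


section \<open>Linear categories\<close>

text \<open>
  \<open>Comp C p q r g f\<close> is the composite of \<open>f \<in> Hom C p q\<close> followed by \<open>g \<in> Hom C q r\<close>.
  Morphisms do not carry their source and target, and the same element may occur in several
  hom modules; this is why composition, functors and ideals are indexed by objects.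
\<close>

record ('o, 'k, 'm) linear_cat =
  Obj :: "'o set"
  Hom :: "'o \<Rightarrow> 'o \<Rightarrow> ('k, 'm) module"
  Comp :: "'o \<Rightarrow> 'o \<Rightarrow> 'o \<Rightarrow> 'm \<Rightarrow> 'm \<Rightarrow> 'm"
  Ident :: "'o \<Rightarrow> 'm"

locale linear_category = cring R
  for R :: "('k, 'z) ring_scheme" and C :: "('o, 'k, 'm) linear_cat" +
  assumes hom_module: "\<lbrakk>p \<in> Obj C; q \<in> Obj C\<rbrakk> \<Longrightarrow> Module.module R (Hom C p q)"
    and ident_closed: "q \<in> Obj C \<Longrightarrow> Ident C q \<in> carrier (Hom C q q)"
    and comp_linear_left:
      "\<lbrakk>p \<in> Obj C; q \<in> Obj C; r \<in> Obj C; f \<in> carrier (Hom C p q)\<rbrakk>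
       \<Longrightarrow> linear_map R (Hom C q r) (Hom C p r) (\<lambda>g. Comp C p q r g f)"
    and comp_linear_right:
      "\<lbrakk>p \<in> Obj C; q \<in> Obj C; r \<in> Obj C; g \<in> carrier (Hom C q r)\<rbrakk>
       \<Longrightarrow> linear_map R (Hom C p q) (Hom C p r) (\<lambda>f. Comp C p q r g f)"
    and comp_assoc:
      "\<lbrakk>p \<in> Obj C; q \<in> Obj C; r \<in> Obj C; s \<in> Obj C;
        f \<in> carrier (Hom C p q); g \<in> carrier (Hom C q r); h \<in> carrier (Hom C r s)\<rbrakk>
       \<Longrightarrow> Comp C p q s (Comp C q r s h g) f = Comp C p r s h (Comp C p q r g f)"
    and ident_left:
      "\<lbrakk>p \<in> Obj C; q \<in> Obj C; f \<in> carrier (Hom C p q)\<rbrakk> \<Longrightarrow> Comp C p q q (Ident C q) f = f"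
    and ident_right:
      "\<lbrakk>p \<in> Obj C; q \<in> Obj C; f \<in> carrier (Hom C p q)\<rbrakk> \<Longrightarrow> Comp C p p q f (Ident C p) = f"

definition hom_finite :: "('k, 'z) ring_scheme \<Rightarrow> ('o, 'k, 'm) linear_cat \<Rightarrow> bool" where
  "hom_finite R C \<longleftrightarrow>
     (\<forall>p\<in>Obj C. \<forall>q\<in>Obj C. finitely_generated R (Hom C p q) \<and> projective R (Hom C p q))"

definition locally_bounded :: "('o, 'k, 'm) linear_cat \<Rightarrow> bool" where
  "locally_bounded C \<longleftrightarrow>
     (\<forall>q\<in>Obj C. finite {p\<in>Obj C. carrier (Hom C p q) \<noteq> {\<zero>\<^bsub>Hom C p q\<^esub>}} \<and>
                finite {r\<in>Obj C. carrier (Hom C q r) \<noteq> {\<zero>\<^bsub>Hom C q r\<^esub>}})"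


subsection \<open>Functors and Serre functors\<close>

definition linear_functor ::
  "('k, 'z) ring_scheme \<Rightarrow> ('o, 'k, 'm) linear_cat \<Rightarrow> ('p, 'k, 'l) linear_cat
   \<Rightarrow> ('o \<Rightarrow> 'p) \<Rightarrow> ('o \<Rightarrow> 'o \<Rightarrow> 'm \<Rightarrow> 'l) \<Rightarrow> bool" where
  "linear_functor R C D F0 F1 \<longleftrightarrow>
     (\<forall>p\<in>Obj C. F0 p \<in> Obj D) \<and>
     (\<forall>p\<in>Obj C. \<forall>q\<in>Obj C. linear_map R (Hom C p q) (Hom D (F0 p) (F0 q)) (F1 p q)) \<and>
     (\<forall>q\<in>Obj C. F1 q q (Ident C q) = Ident D (F0 q)) \<and>
     (\<forall>p\<in>Obj C. \<forall>q\<in>Obj C. \<forall>r\<in>Obj C. \<forall>f\<in>carrier (Hom C p q). \<forall>g\<in>carrier (Hom C q r).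
        F1 p r (Comp C p q r g f) = Comp D (F0 p) (F0 q) (F0 r) (F1 q r g) (F1 p q f))"

definition is_isomorphism :: "('o, 'k, 'm) linear_cat \<Rightarrow> 'o \<Rightarrow> 'o \<Rightarrow> 'm \<Rightarrow> bool" where
  "is_isomorphism C p q f \<longleftrightarrow>
     f \<in> carrier (Hom C p q) \<and>
     (\<exists>g\<in>carrier (Hom C q p). Comp C p q p g f = Ident C p \<and> Comp C q p q f g = Ident C q)"

definition naturally_isomorphic ::
  "('o, 'k, 'm) linear_cat \<Rightarrow> ('p, 'k, 'l) linear_cat
   \<Rightarrow> ('o \<Rightarrow> 'p) \<Rightarrow> ('o \<Rightarrow> 'o \<Rightarrow> 'm \<Rightarrow> 'l) \<Rightarrow> ('o \<Rightarrow> 'p) \<Rightarrow> ('o \<Rightarrow> 'o \<Rightarrow> 'm \<Rightarrow> 'l) \<Rightarrow> bool" where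
  "naturally_isomorphic C D F0 F1 G0 G1 \<longleftrightarrow>
     (\<exists>\<alpha>. (\<forall>p\<in>Obj C. is_isomorphism D (F0 p) (G0 p) (\<alpha> p)) \<and>
          (\<forall>p\<in>Obj C. \<forall>q\<in>Obj C. \<forall>f\<in>carrier (Hom C p q).
             Comp D (F0 p) (F0 q) (G0 q) (\<alpha> q) (F1 p q f) =
             Comp D (F0 p) (G0 p) (G0 q) (G1 p q f) (\<alpha> p)))"

definition linear_autoequivalence ::
  "('k, 'z) ring_scheme \<Rightarrow> ('o, 'k, 'm) linear_cat
   \<Rightarrow> ('o \<Rightarrow> 'o) \<Rightarrow> ('o \<Rightarrow> 'o \<Rightarrow> 'm \<Rightarrow> 'm) \<Rightarrow> bool" where
  "linear_autoequivalence R C S0 S1 \<longleftrightarrow>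
     linear_functor R C C S0 S1 \<and>
     (\<exists>T0 T1. linear_functor R C C T0 T1 \<and>
        naturally_isomorphic C C
          (\<lambda>p. T0 (S0 p)) (\<lambda>p q f. T1 (S0 p) (S0 q) (S1 p q f)) (\<lambda>p. p) (\<lambda>p q f. f) \<and>
        naturally_isomorphic C C
          (\<lambda>p. S0 (T0 p)) (\<lambda>p q f. S1 (T0 p) (T0 q) (T1 p q f)) (\<lambda>p. p) (\<lambda>p q f. f))"

text \<open>
  The last clause is naturality of \<open>\<eta> p q : Q(p,q) \<longrightarrow> Hom(Q(q, S p), k)\<close> in both variables, tested
  on \<open>f : p' \<rightarrow> p\<close>, \<open>h : p \<rightarrow> q\<close>, \<open>g : q \<rightarrow> q'\<close> and \<open>u : q' \<rightarrow> S p'\<close>.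
\<close>

definition serre_functor ::
  "('k, 'z) ring_scheme \<Rightarrow> ('o, 'k, 'm) linear_cat
   \<Rightarrow> ('o \<Rightarrow> 'o) \<Rightarrow> ('o \<Rightarrow> 'o \<Rightarrow> 'm \<Rightarrow> 'm) \<Rightarrow> bool" where
  "serre_functor R C S0 S1 \<longleftrightarrow>
     linear_autoequivalence R C S0 S1 \<and>
     (\<exists>\<eta>. (\<forall>p\<in>Obj C. \<forall>q\<in>Obj C.
            linear_map R (Hom C p q) (dual_module R (Hom C q (S0 p))) (\<eta> p q) \<and>
            bij_betw (\<eta> p q) (carrier (Hom C p q)) (carrier (dual_module R (Hom C q (S0 p))))) \<and>
          (\<forall>p\<in>Obj C. \<forall>p'\<in>Obj C. \<forall>q\<in>Obj C. \<forall>q'\<in>Obj C.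
           \<forall>f\<in>carrier (Hom C p' p). \<forall>h\<in>carrier (Hom C p q). \<forall>g\<in>carrier (Hom C q q').
           \<forall>u\<in>carrier (Hom C q' (S0 p')).
             \<eta> p' q' (Comp C p' p q' (Comp C p q q' g h) f) u =
             \<eta> p q h (Comp C q (S0 p') (S0 p) (S1 p' p f) (Comp C q q' (S0 p') u g))))"

definition has_serre_functor :: "('k, 'z) ring_scheme \<Rightarrow> ('o, 'k, 'm) linear_cat \<Rightarrow> bool" where
  "has_serre_functor R C \<longleftrightarrow> (\<exists>S0 S1. serre_functor R C S0 S1)"


subsection \<open>The Strong Retraction Property\<close>

definition retraction_family ::
  "('k, 'z) ring_scheme \<Rightarrow> ('o, 'k, 'm) linear_cat \<Rightarrow> ('o \<Rightarrow> 'm set) \<Rightarrow> bool" where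
  "retraction_family R C \<rr> \<longleftrightarrow>
     (\<forall>q\<in>Obj C.
        submodule (\<rr> q) R (Hom C q q) \<and>
        {x \<odot>\<^bsub>Hom C q q\<^esub> Ident C q | x. x \<in> carrier R} <+>\<^bsub>Hom C q q\<^esub> \<rr> q = carrier (Hom C q q) \<and>
        {x \<odot>\<^bsub>Hom C q q\<^esub> Ident C q | x. x \<in> carrier R} \<inter> \<rr> q = {\<zero>\<^bsub>Hom C q q\<^esub>} \<and>
        (\<forall>g\<in>\<rr> q. \<forall>f\<in>\<rr> q. Comp C q q q g f \<in> \<rr> q)) \<and>
     (\<forall>p\<in>Obj C. \<forall>q\<in>Obj C. p \<noteq> q \<longrightarrow>
        (\<forall>f\<in>carrier (Hom C p q). \<forall>g\<in>carrier (Hom C q p). Comp C p q p g f \<in> \<rr> p))"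

definition strong_retraction_property ::
  "('k, 'z) ring_scheme \<Rightarrow> ('o, 'k, 'm) linear_cat \<Rightarrow> bool" where
  "strong_retraction_property R C \<longleftrightarrow>
     (\<forall>q\<in>Obj C. \<exists>\<rho>. linear_map R (Hom C q q) (ring_module R) \<rho> \<and>
        (\<forall>x\<in>carrier R. \<rho> (x \<odot>\<^bsub>Hom C q q\<^esub> Ident C q) = x)) \<and>
     (\<exists>\<rr>. retraction_family R C \<rr>)"

definition pseudo_radical ::
  "('o, 'k, 'm) linear_cat \<Rightarrow> ('o \<Rightarrow> 'm set) \<Rightarrow> 'o \<Rightarrow> 'o \<Rightarrow> 'm set" where
  "pseudo_radical C \<rr> p q = (if p = q then \<rr> q else carrier (Hom C p q))"


subsection \<open>Two-sided ideals and quotients\<close>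

definition two_sided_ideal ::
  "('k, 'z) ring_scheme \<Rightarrow> ('o, 'k, 'm) linear_cat \<Rightarrow> ('o \<Rightarrow> 'o \<Rightarrow> 'm set) \<Rightarrow> bool" where
  "two_sided_ideal R C I \<longleftrightarrow>
     (\<forall>p\<in>Obj C. \<forall>q\<in>Obj C. submodule (I p q) R (Hom C p q)) \<and>
     (\<forall>p\<in>Obj C. \<forall>q\<in>Obj C. \<forall>r\<in>Obj C.
        (\<forall>f\<in>I p q. \<forall>g\<in>carrier (Hom C q r). Comp C p q r g f \<in> I p r) \<and>
        (\<forall>f\<in>carrier (Hom C p q). \<forall>g\<in>I q r. Comp C p q r g f \<in> I p r))"

definition generated_ideal ::
  "('k, 'z) ring_scheme \<Rightarrow> ('o, 'k, 'm) linear_cat \<Rightarrow> ('o \<Rightarrow> 'o \<Rightarrow> 'm set) \<Rightarrow> 'o \<Rightarrow> 'o \<Rightarrow> 'm set" where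
  "generated_ideal R C S p q =
     \<Inter>{J p q | J. two_sided_ideal R C J \<and> (\<forall>p\<in>Obj C. \<forall>q\<in>Obj C. S p q \<subseteq> J p q)}"

definition ideal_product ::
  "('k, 'z) ring_scheme \<Rightarrow> ('o, 'k, 'm) linear_cat
   \<Rightarrow> ('o \<Rightarrow> 'o \<Rightarrow> 'm set) \<Rightarrow> ('o \<Rightarrow> 'o \<Rightarrow> 'm set) \<Rightarrow> 'o \<Rightarrow> 'o \<Rightarrow> 'm set" where
  "ideal_product R C I J =
     generated_ideal R C (\<lambda>p r. {Comp C p q r g f | q f g. q \<in> Obj C \<and> f \<in> J p q \<and> g \<in> I q r})"

primrec ideal_power ::
  "('k, 'z) ring_scheme \<Rightarrow> ('o, 'k, 'm) linear_cat
   \<Rightarrow> ('o \<Rightarrow> 'o \<Rightarrow> 'm set) \<Rightarrow> nat \<Rightarrow> 'o \<Rightarrow> 'o \<Rightarrow> 'm set" where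
  "ideal_power R C I 0 = (\<lambda>p q. carrier (Hom C p q))"
| "ideal_power R C I (Suc m) = ideal_product R C I (ideal_power R C I m)"

definition zero_ideal :: "('o, 'k, 'm) linear_cat \<Rightarrow> ('o \<Rightarrow> 'o \<Rightarrow> 'm set) \<Rightarrow> bool" where
  "zero_ideal C I \<longleftrightarrow> (\<forall>p\<in>Obj C. \<forall>q\<in>Obj C. I p q = {\<zero>\<^bsub>Hom C p q\<^esub>})"

definition nilpotent_ideal ::
  "('k, 'z) ring_scheme \<Rightarrow> ('o, 'k, 'm) linear_cat \<Rightarrow> ('o \<Rightarrow> 'o \<Rightarrow> 'm set) \<Rightarrow> bool" where
  "nilpotent_ideal R C I \<longleftrightarrow> (\<exists>m. zero_ideal C (ideal_power R C I m))"

definition ideal_class ::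
  "('o, 'k, 'm) linear_cat \<Rightarrow> ('o \<Rightarrow> 'o \<Rightarrow> 'm set) \<Rightarrow> 'o \<Rightarrow> 'o \<Rightarrow> 'm \<Rightarrow> 'm set" where
  "ideal_class C I p q f = I p q +>\<^bsub>Hom C p q\<^esub> f"

definition quotient_category ::
  "('o, 'k, 'm) linear_cat \<Rightarrow> ('o \<Rightarrow> 'o \<Rightarrow> 'm set) \<Rightarrow> ('o, 'k, 'm set) linear_cat" where
  "quotient_category C I =
     \<lparr>Obj = Obj C,
      Hom = (\<lambda>p q. quotient_module (Hom C p q) (I p q)),
      Comp = (\<lambda>p q r G F. \<Union>g\<in>G. \<Union>f\<in>F. ideal_class C I p r (Comp C p q r g f)),
      Ident = (\<lambda>q. ideal_class C I q q (Ident C q))\<rparr>"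


section \<open>Path categories and the mesh category of the double quiver of type A\<close>

text \<open>
  Arc walks list the arrows in the order in which they are traversed, whereas paths are composed
  like functions: the product of the basis vectors of \<open>v\<close> and \<open>u\<close> (first \<open>u\<close>, then \<open>v\<close>) is the
  basis vector of \<open>u @ v\<close>. Elements of a hom module vanish outside the set of paths, so the
  convolution need not restrict \<open>u\<close> and \<open>v\<close>.
\<close>

definition path_category ::
  "('k, 'z) ring_scheme \<Rightarrow> ('v, 'e) pre_digraph \<Rightarrow> ('v, 'k, 'e list \<Rightarrow> 'k) linear_cat" where
  "path_category R G =
     \<lparr>Obj = verts G,
      Hom = (\<lambda>p q. free_module R {w. pre_digraph.awalk G p w q}),
      Comp = (\<lambda>p q r g f w. finsum R (\<lambda>(u, v). g v \<otimes>\<^bsub>R\<^esub> f u) {(u, v). u @ v = w}),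
      Ident = (\<lambda>q. basis_vector R [])\<rparr>"

text \<open>\<open>Arr q\<close> is the arrow \<open>a\<^sub>q : q \<rightarrow> q+1\<close>, and \<open>Star q\<close> its formal reverse \<open>q+1 \<rightarrow> q\<close>.\<close>

datatype double_arrow = Arr nat | Star nat

primrec arrow_source :: "double_arrow \<Rightarrow> nat" where
  "arrow_source (Arr q) = q"
| "arrow_source (Star q) = q + 1"

primrec arrow_target :: "double_arrow \<Rightarrow> nat" where
  "arrow_target (Arr q) = q + 1"
| "arrow_target (Star q) = q"

definition double_A :: "nat \<Rightarrow> (nat, double_arrow) pre_digraph" where
  "double_A n =
     \<lparr>verts = {1..n}, arcs = Arr ` {1..<n} \<union> Star ` {1..<n},
      tail = arrow_source, head = arrow_target\<rparr>"

definition mesh_relation ::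
  "('k, 'z) ring_scheme \<Rightarrow> nat \<Rightarrow> nat \<Rightarrow> double_arrow list \<Rightarrow> 'k" where
  "mesh_relation R n q =
     (let P = path_category R (double_A n);
          a = (\<lambda>i. basis_vector R [Arr i]);
          a' = (\<lambda>i. basis_vector R [Star i]);
          lower = Comp P q (q - 1) q (a (q - 1)) (a' (q - 1));
          upper = Comp P q (q + 1) q (a' q) (a q)
      in if q = 1 then upper else if q = n then lower else lower \<oplus>\<^bsub>Hom P q q\<^esub> upper)"

definition mesh_ideal ::
  "('k, 'z) ring_scheme \<Rightarrow> nat \<Rightarrow> nat \<Rightarrow> nat \<Rightarrow> (double_arrow list \<Rightarrow> 'k) set" where
  "mesh_ideal R n =
     generated_ideal R (path_category R (double_A n))
       (\<lambda>p q. if p = q then {mesh_relation R n q} else {})"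

definition mesh_category ::
  "('k, 'z) ring_scheme \<Rightarrow> nat \<Rightarrow> (nat, 'k, (double_arrow list \<Rightarrow> 'k) set) linear_cat" where
  "mesh_category R n = quotient_category (path_category R (double_A n)) (mesh_ideal R n)"

definition mesh_arrow ::
  "('k, 'z) ring_scheme \<Rightarrow> nat \<Rightarrow> double_arrow \<Rightarrow> (double_arrow list \<Rightarrow> 'k) set" where
  "mesh_arrow R n e =
     ideal_class (path_category R (double_A n)) (mesh_ideal R n)
       (arrow_source e) (arrow_target e) (basis_vector R [e])"

definition arrow_ideal ::
  "('k, 'z) ring_scheme \<Rightarrow> nat \<Rightarrow> nat \<Rightarrow> nat \<Rightarrow> (double_arrow list \<Rightarrow> 'k) set set" where
  "arrow_ideal R n =
     generated_ideal R (mesh_category R n)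
       (\<lambda>p q. {mesh_arrow R n e | e. e \<in> arcs (double_A n) \<and> arrow_source e = p \<and> arrow_target e = q})"

definition serre_formulae ::
  "('k, 'z) ring_scheme \<Rightarrow> nat \<Rightarrow> (nat \<Rightarrow> nat)
   \<Rightarrow> (nat \<Rightarrow> nat \<Rightarrow> (double_arrow list \<Rightarrow> 'k) set \<Rightarrow> (double_arrow list \<Rightarrow> 'k) set) \<Rightarrow> bool" where
  "serre_formulae R n S0 S1 \<longleftrightarrow>
     (\<forall>q\<in>{1..n}. S0 q = n + 1 - q) \<and>
     (\<forall>q\<in>{1..<n}.
        S1 q (q + 1) (mesh_arrow R n (Arr q)) =
          ((\<ominus>\<^bsub>R\<^esub> \<one>\<^bsub>R\<^esub>) [^]\<^bsub>R\<^esub> q)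
            \<odot>\<^bsub>Hom (mesh_category R n) (n + 1 - q) (n - q)\<^esub> mesh_arrow R n (Star (n - q)) \<and>
        S1 (q + 1) q (mesh_arrow R n (Star q)) =
          ((\<ominus>\<^bsub>R\<^esub> \<one>\<^bsub>R\<^esub>) [^]\<^bsub>R\<^esub> (n - q))
            \<odot>\<^bsub>Hom (mesh_category R n) (n - q) (n + 1 - q)\<^esub> mesh_arrow R n (Arr (n - q)))"

end

theory Submission
  imports Defs
begin

text \<open>
  Rescale \<open>a\<^sub>q\<^sup>*\<close> by \<open>(-1)\<^sup>q\<close>. Modulo the mesh relations a walk from \<open>p\<close> to \<open>q\<close> is then determined by its
  number \<open>s\<close> of downward arrows, and it vanishes unless \<open>s < p\<close> and \<open>s + q \<le> n\<close>: otherwise one of its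
  rearrangements leaves \<open>{1..n}\<close>. Hence \<open>Q(p,q)\<close> has a basis \<open>e\<^sub>s\<close> indexed by the admissible \<open>s\<close>, with
  \<open>e\<^sub>t \<circ> e\<^sub>s = e\<^sub>s\<^sub>+\<^sub>t\<close>, read as zero when \<open>s + t\<close> is not admissible. In this model the Serre functor sends
  \<open>e\<^sub>s\<close> to \<open>(-1)\<^bsup>n(p+q)\<^esup> e\<^sub>u\<close> with \<open>u = q + s - p\<close> the number of upward arrows; it is an involution, and
  duality is the perfect pairing given by the coefficient of the socle element \<open>e\<^bsub>p-1\<^esub>\<close> of \<open>Q(p, n+1-p)\<close>.
  Everything in \<open>\<rr>\<^sup>m\<close> has length at least \<open>m\<close>, while admissible walks have length less than \<open>n\<close>.
\<close>

section \<open>Linear maps and free modules\<close>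

text \<open>The obstacle is independence: rearranging walks only shows that the classes e_s span,
  and over an arbitrary ring a dimension count cannot finish the argument. So the model is built as
  a linear category in its own right, the path category is mapped onto it by a functor that kills
  the mesh relations, and the kernel of this functor is shown to lie in every ideal containing them,
  by means of a linear section that sends e_s to a signed normal form. Freeness, duality and the
  radical are computed in the model and carried over by an isomorphism, which also supplies the
  category laws of the quotient. The sign of the Serre functor is forced. In the model
  \<open>Arr q\<close> is e_0 and \<open>Star q\<close> is (-1)^q e_1, so the prescribed formulae
  become e_0 |-> (-1)^n e_1 and e_1 |-> (-1)^n e_0: each arrow contributes (-1)^n, and a walk from p
  to q has length congruent to p + q modulo 2. The trace must change by the same factor when a
  morphism is moved around it, whence its own sign (-1)^(np).\<close>

lemma linear_mapI:
  assumes "\<And>x. x \<in> carrier M \<Longrightarrow> f x \<in> carrier N"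
    and "\<And>x y. x \<in> carrier M \<Longrightarrow> y \<in> carrier M \<Longrightarrow> f (x \<oplus>\<^bsub>M\<^esub> y) = f x \<oplus>\<^bsub>N\<^esub> f y"
    and "\<And>c x. c \<in> carrier R \<Longrightarrow> x \<in> carrier M \<Longrightarrow> f (c \<odot>\<^bsub>M\<^esub> x) = c \<odot>\<^bsub>N\<^esub> f x"
  shows "linear_map R M N f"
  using assms by (auto simp: linear_map_def)

lemma linear_mapD:
  assumes "linear_map R M N f"
  shows linear_map_closed: "x \<in> carrier M \<Longrightarrow> f x \<in> carrier N"
    and linear_map_add: "x \<in> carrier M \<Longrightarrow> y \<in> carrier M \<Longrightarrow> f (x \<oplus>\<^bsub>M\<^esub> y) = f x \<oplus>\<^bsub>N\<^esub> f y"
    and linear_map_smult: "c \<in> carrier R \<Longrightarrow> x \<in> carrier M \<Longrightarrow> f (c \<odot>\<^bsub>M\<^esub> x) = c \<odot>\<^bsub>N\<^esub> f x"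
  using assms by (auto simp: linear_map_def)

lemma linear_map_compose:
  assumes "linear_map R M N f" and "linear_map R N L g"
  shows "linear_map R M L (\<lambda>x. g (f x))"
  using assms by (auto simp: linear_map_def Pi_iff)

lemma linear_map_id: "linear_map R M M (\<lambda>x. x)"
  by (auto simp: linear_map_def)

lemma linear_map_zero:
  assumes "module R M" "module R N" "linear_map R M N f"
  shows "f \<zero>\<^bsub>M\<^esub> = \<zero>\<^bsub>N\<^esub>"
proof -
  interpret M: Module.module R M by fact
  interpret N: Module.module R N by fact
  have "f \<zero>\<^bsub>M\<^esub> = f (\<zero>\<^bsub>R\<^esub> \<odot>\<^bsub>M\<^esub> \<zero>\<^bsub>M\<^esub>)" by simp
  also have "\<dots> = \<zero>\<^bsub>R\<^esub> \<odot>\<^bsub>N\<^esub> f \<zero>\<^bsub>M\<^esub>"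
    by (rule linear_map_smult[OF assms(3)]) auto
  also have "\<dots> = \<zero>\<^bsub>N\<^esub>"
    using linear_map_closed[OF assms(3)] by simp
  finally show ?thesis .
qed

lemma linear_map_minus:
  assumes "module R M" "module R N" "linear_map R M N f"
    and "x \<in> carrier M" "y \<in> carrier M"
  shows "f (x \<ominus>\<^bsub>M\<^esub> y) = f x \<ominus>\<^bsub>N\<^esub> f y"
proof -
  interpret M: Module.module R M by fact
  interpret N: Module.module R N by fact
  note cl = linear_map_closed[OF assms(3)]
  have "f (x \<ominus>\<^bsub>M\<^esub> y) \<oplus>\<^bsub>N\<^esub> f y = f x"
    using assms cl
    by (simp add: linear_map_add[OF assms(3), symmetric] M.minus_eq M.a_assoc M.l_neg)
  moreover have "f (x \<ominus>\<^bsub>M\<^esub> y) \<in> carrier N" using assms cl by simp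
  ultimately show ?thesis
    using assms cl by (simp add: N.minus_eq N.add.inv_solve_right)
qed

lemma linear_map_finsum:
  assumes "module R M" "module R N" "linear_map R M N f"
    and "finite A" "g \<in> A \<rightarrow> carrier M"
  shows "f (\<Oplus>\<^bsub>M\<^esub>a\<in>A. g a) = (\<Oplus>\<^bsub>N\<^esub>a\<in>A. f (g a))"
proof -
  interpret M: Module.module R M by fact
  interpret N: Module.module R N by fact
  note cl = linear_map_closed[OF assms(3)]
  from assms(4,5) show ?thesis
  proof (induction A rule: finite_induct)
    case empty
    then show ?case by (simp add: linear_map_zero[OF assms(1-3)])
  next
    case (insert a A)
    have "(\<lambda>a. f (g a)) \<in> A \<rightarrow> carrier N" "f (g a) \<in> carrier N"
      using insert.prems cl by auto
    moreover have "g \<in> A \<rightarrow> carrier M" "g a \<in> carrier M" using insert.prems by auto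
    ultimately show ?case
      using insert.hyps insert.IH by (simp add: linear_map_add[OF assms(3)])
  qed
qed

text \<open>The target is a bare record, such as a quotient, whose axioms are still to be proved;
  each of them is the image of the same identity in \<open>M\<close>. Preservation of zero is a
  separate assumption because its derivation from linearity in \<open>linear_map_zero\<close>
  already uses the axioms of \<open>N\<close>.\<close>

lemma module_transport:
  assumes "module R M"
    and bij: "bij_betw f (carrier M) (carrier N)"
    and zero: "f \<zero>\<^bsub>M\<^esub> = \<zero>\<^bsub>N\<^esub>"
    and f: "linear_map R M N f"
  shows "module R N"
proof -
  interpret M: Module.module R M by fact
  have surj: "\<exists>x\<in>carrier M. y = f x" if "y \<in> carrier N" for y
    using bij that by (auto simp: bij_betw_def)
  note cl = linear_map_closed[OF f]
  note add = linear_map_add[OF f, symmetric] and smult = linear_map_smult[OF f, symmetric]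
  show ?thesis
  proof (rule moduleI[OF M.is_cring])
    show "abelian_group N"
    proof (rule abelian_groupI)
      fix x y assume "x \<in> carrier N" "y \<in> carrier N"
      then obtain a b where ab: "a \<in> carrier M" "b \<in> carrier M" "x = f a" "y = f b" using surj by blast
      then show "x \<oplus>\<^bsub>N\<^esub> y \<in> carrier N" "x \<oplus>\<^bsub>N\<^esub> y = y \<oplus>\<^bsub>N\<^esub> x"
        by (simp_all add: add cl M.a_comm)
    next
      show "\<zero>\<^bsub>N\<^esub> \<in> carrier N" using cl[OF M.zero_closed] zero by simp
    next
      fix x y z assume "x \<in> carrier N" "y \<in> carrier N" "z \<in> carrier N"
      then obtain a b c where "a \<in> carrier M" "x = f a" "b \<in> carrier M" "y = f b"
        "c \<in> carrier M" "z = f c"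
        using surj by metis
      then show "x \<oplus>\<^bsub>N\<^esub> y \<oplus>\<^bsub>N\<^esub> z = x \<oplus>\<^bsub>N\<^esub> (y \<oplus>\<^bsub>N\<^esub> z)" by (simp add: add M.a_assoc)
    next
      fix x assume "x \<in> carrier N"
      then obtain a where a: "a \<in> carrier M" "x = f a" using surj by blast
      then show "\<zero>\<^bsub>N\<^esub> \<oplus>\<^bsub>N\<^esub> x = x" by (simp add: zero[symmetric] add)
      have "f (\<ominus>\<^bsub>M\<^esub> a) \<oplus>\<^bsub>N\<^esub> x = \<zero>\<^bsub>N\<^esub>" using a by (simp add: zero[symmetric] add M.l_neg)
      then show "\<exists>y\<in>carrier N. y \<oplus>\<^bsub>N\<^esub> x = \<zero>\<^bsub>N\<^esub>" using a cl by blast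
    qed
  next
    fix a x assume "a \<in> carrier R" "x \<in> carrier N"
    then show "a \<odot>\<^bsub>N\<^esub> x \<in> carrier N" using surj cl smult by fastforce
  next
    fix a b x assume ab: "a \<in> carrier R" "b \<in> carrier R" "x \<in> carrier N"
    then obtain u where u: "u \<in> carrier M" "x = f u" using surj by blast
    with ab show "(a \<oplus>\<^bsub>R\<^esub> b) \<odot>\<^bsub>N\<^esub> x = a \<odot>\<^bsub>N\<^esub> x \<oplus>\<^bsub>N\<^esub> b \<odot>\<^bsub>N\<^esub> x"
      by (simp add: smult add M.smult_l_distr)
    from ab u show "(a \<otimes>\<^bsub>R\<^esub> b) \<odot>\<^bsub>N\<^esub> x = a \<odot>\<^bsub>N\<^esub> (b \<odot>\<^bsub>N\<^esub> x)"
      by (simp add: smult add M.smult_assoc1)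
  next
    fix a x y assume a: "a \<in> carrier R" "x \<in> carrier N" "y \<in> carrier N"
    then obtain u v where u: "u \<in> carrier M" "v \<in> carrier M" "x = f u" "y = f v" using surj by blast
    with a show "a \<odot>\<^bsub>N\<^esub> (x \<oplus>\<^bsub>N\<^esub> y) = a \<odot>\<^bsub>N\<^esub> x \<oplus>\<^bsub>N\<^esub> a \<odot>\<^bsub>N\<^esub> y"
      by (simp add: smult add M.smult_r_distr)
  next
    fix x assume "x \<in> carrier N"
    then obtain u where "u \<in> carrier M" "x = f u" using surj by blast
    then show "\<one>\<^bsub>R\<^esub> \<odot>\<^bsub>N\<^esub> x = x" by (simp add: smult)
  qed
qed

lemma linear_map_inverse:
  assumes "linear_map R M N f" and "bij_betw f (carrier M) (carrier N)" and "module R M"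
  shows "linear_map R N M (the_inv_into (carrier M) f)"
proof -
  interpret M: Module.module R M by fact
  have inj: "inj_on f (carrier M)" using assms(2) by (rule bij_betw_imp_inj_on)
  have surj: "\<exists>x\<in>carrier M. y = f x" if "y \<in> carrier N" for y
    using assms(2) that by (auto simp: bij_betw_def)
  note g = the_inv_into_f_f[OF inj]
  show ?thesis
  proof (rule linear_mapI)
    fix x assume "x \<in> carrier N"
    then show "the_inv_into (carrier M) f x \<in> carrier M" using surj g by fastforce
  next
    fix x y assume "x \<in> carrier N" "y \<in> carrier N"
    then obtain a b where "a \<in> carrier M" "b \<in> carrier M" "x = f a" "y = f b" using surj by blast
    then show "the_inv_into (carrier M) f (x \<oplus>\<^bsub>N\<^esub> y) =
        the_inv_into (carrier M) f x \<oplus>\<^bsub>M\<^esub> the_inv_into (carrier M) f y"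
      by (simp add: linear_map_add[OF assms(1), symmetric] g)
  next
    fix c x assume "c \<in> carrier R" "x \<in> carrier N"
    moreover then obtain a where "a \<in> carrier M" "x = f a" using surj by blast
    ultimately show "the_inv_into (carrier M) f (c \<odot>\<^bsub>N\<^esub> x) = c \<odot>\<^bsub>M\<^esub> the_inv_into (carrier M) f x"
      by (simp add: linear_map_smult[OF assms(1), symmetric] g)
  qed
qed

section \<open>Modules of finite rank, handled through coordinate maps\<close>

lemma free_of_rankI:
  fixes M (structure)
  assumes "module R M" and "finite B" and "card B = d" and "B \<subseteq> carrier M"
    and k: "\<And>x. x \<in> carrier M \<Longrightarrow> k x \<in> B \<rightarrow> carrier R"
    and k_sum: "\<And>x. x \<in> carrier M \<Longrightarrow> x = (\<Oplus>b\<in>B. k x b \<odot> b)"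
    and k_eq: "\<And>c b. c \<in> B \<rightarrow> carrier R \<Longrightarrow> b \<in> B \<Longrightarrow> k (\<Oplus>b\<in>B. c b \<odot> b) b = c b"
  shows "free_of_rank R M d"
proof -
  interpret M: Module.module R M by fact
  have "\<exists>!c. c \<in> B \<rightarrow>\<^sub>E carrier R \<and> x = (\<Oplus>b\<in>B. c b \<odot> b)" if x: "x \<in> carrier M" for x
  \<comment> \<open>\<open>free_of_rank\<close> quantifies over extensional families, hence the
    restriction of \<open>k x\<close> to \<open>B\<close>.\<close>
  proof (rule ex1I[of _ "restrict (k x) B"], rule conjI)
    show "restrict (k x) B \<in> B \<rightarrow>\<^sub>E carrier R" using k[OF x] by auto
    have "(\<Oplus>b\<in>B. restrict (k x) B b \<odot> b) = (\<Oplus>b\<in>B. k x b \<odot> b)"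
      using k[OF x] assms(4) by (intro M.finsum_cong' refl) auto
    then show "x = (\<Oplus>b\<in>B. restrict (k x) B b \<odot> b)" using k_sum[OF x] by simp
  next
    fix c assume c: "c \<in> B \<rightarrow>\<^sub>E carrier R \<and> x = (\<Oplus>b\<in>B. c b \<odot> b)"
    then have cB: "c \<in> B \<rightarrow> carrier R" by (simp add: PiE_def)
    show "c = restrict (k x) B"
    proof
      fix b
      show "c b = restrict (k x) B b"
        using c k_eq[OF cB] by (cases "b \<in> B") (simp_all add: PiE_def extensional_def)
    qed
  qed
  then show ?thesis unfolding free_of_rank_def
    by (intro exI[of _ B] conjI ballI assms)
qed

text \<open>Choosing the unique coefficient family once for every \<open>x\<close> gives a
  coordinate map; uniqueness turns into the law that \<open>k\<close> reads the coefficients back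
  off a linear combination.\<close>

lemma free_of_rankE:
  fixes M (structure)
  assumes "module R M" and "free_of_rank R M d"
  obtains B k where "finite B" and "card B = d" and "B \<subseteq> carrier M"
    and "\<And>x. x \<in> carrier M \<Longrightarrow> k x \<in> B \<rightarrow> carrier R"
    and "\<And>x. x \<in> carrier M \<Longrightarrow> x = (\<Oplus>b\<in>B. k x b \<odot> b)"
    and "\<And>c b. c \<in> B \<rightarrow> carrier R \<Longrightarrow> b \<in> B \<Longrightarrow> k (\<Oplus>b\<in>B. c b \<odot> b) b = c b"
proof -
  interpret M: Module.module R M by fact
  obtain B where B: "finite B \<and> card B = d \<and> B \<subseteq> carrier M \<and>
     (\<forall>x\<in>carrier M. \<exists>!c. c \<in> B \<rightarrow>\<^sub>E carrier R \<and> x = (\<Oplus>b\<in>B. c b \<odot> b))"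
    using assms(2) unfolding free_of_rank_def by (elim exE)
  then have fin: "finite B" and card: "card B = d" and sub: "B \<subseteq> carrier M" by auto
  define k where "k = (\<lambda>x. THE c. c \<in> B \<rightarrow>\<^sub>E carrier R \<and> x = (\<Oplus>b\<in>B. c b \<odot> b))"
  have ex1: "\<exists>!c. c \<in> B \<rightarrow>\<^sub>E carrier R \<and> x = (\<Oplus>b\<in>B. c b \<odot> b)" if "x \<in> carrier M" for x
    using B that by (elim conjE) (erule bspec)
  have k: "k x \<in> B \<rightarrow>\<^sub>E carrier R \<and> x = (\<Oplus>b\<in>B. k x b \<odot> b)" if "x \<in> carrier M" for x
    unfolding k_def by (rule theI'[OF ex1[OF that]])
  show thesis
  proof (rule that[OF fin card sub])
    fix x assume "x \<in> carrier M"
    from k[OF this] show "k x \<in> B \<rightarrow> carrier R" and "x = (\<Oplus>b\<in>B. k x b \<odot> b)"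
      by (auto simp: PiE_def)
  next
    fix c b assume c: "c \<in> B \<rightarrow> carrier R" and b: "b \<in> B"
    let ?x = "\<Oplus>b\<in>B. c b \<odot> b"
    have x: "?x \<in> carrier M" using c sub by (intro M.finsum_closed) auto
    have "?x = (\<Oplus>b\<in>B. restrict c B b \<odot> b)"
      using c sub by (intro M.finsum_cong' refl) (auto intro!: M.smult_closed)
    then have "k ?x = restrict c B"
      unfolding k_def using c by (intro the1_equality ex1 x) auto
    then show "k ?x b = c b" using b by simp
  qed
qed

text \<open>The basis moves along \<open>f\<close>. Injectivity preserves its cardinality and lets
  the coordinates be pulled back through the inverse of \<open>f\<close>.\<close>

lemma free_of_rank_transport:
  assumes "module R M" "module R N" "linear_map R M N f"
    and bij: "bij_betw f (carrier M) (carrier N)" and "free_of_rank R M d"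
  shows "free_of_rank R N d"
proof -
  interpret M: Module.module R M by fact
  interpret N: Module.module R N by fact
  have inj: "inj_on f (carrier M)" using bij by (rule bij_betw_imp_inj_on)
  obtain B k where B: "finite B" "card B = d" "B \<subseteq> carrier M"
    and k: "\<And>x. x \<in> carrier M \<Longrightarrow> k x \<in> B \<rightarrow> carrier R"
    and k_sum: "\<And>x. x \<in> carrier M \<Longrightarrow> x = (\<Oplus>\<^bsub>M\<^esub>b\<in>B. k x b \<odot>\<^bsub>M\<^esub> b)"
    and k_eq: "\<And>c b. c \<in> B \<rightarrow> carrier R \<Longrightarrow> b \<in> B \<Longrightarrow> k (\<Oplus>\<^bsub>M\<^esub>b\<in>B. c b \<odot>\<^bsub>M\<^esub> b) b = c b"
    by (rule free_of_rankE[OF assms(1,5)]) (rule that)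
  have injB: "inj_on f B" using inj B(3) by (rule inj_on_subset)
  have sub: "f ` B \<subseteq> carrier N" using B(3) linear_map_closed[OF assms(3)] by auto
  have sum: "(\<Oplus>\<^bsub>N\<^esub>b\<in>f ` B. c b \<odot>\<^bsub>N\<^esub> b) = f (\<Oplus>\<^bsub>M\<^esub>b\<in>B. c (f b) \<odot>\<^bsub>M\<^esub> b)"
    if c: "c \<in> f ` B \<rightarrow> carrier R" for c
  proof -
    have "(\<Oplus>\<^bsub>N\<^esub>b\<in>f ` B. c b \<odot>\<^bsub>N\<^esub> b) = (\<Oplus>\<^bsub>N\<^esub>b\<in>B. c (f b) \<odot>\<^bsub>N\<^esub> f b)"
      using c sub by (intro N.add.finprod_reindex injB) auto
    also have "\<dots> = (\<Oplus>\<^bsub>N\<^esub>b\<in>B. f (c (f b) \<odot>\<^bsub>M\<^esub> b))"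
      using c B(3) sub by (intro N.finsum_cong' refl) (auto simp: linear_map_smult[OF assms(3)] Pi_iff subset_iff)
    also have "\<dots> = f (\<Oplus>\<^bsub>M\<^esub>b\<in>B. c (f b) \<odot>\<^bsub>M\<^esub> b)"
      using c B by (intro linear_map_finsum[OF assms(1-3), symmetric]) auto
    finally show ?thesis .
  qed
  let ?g = "the_inv_into (carrier M) f" and ?h = "the_inv_into B f"
  have g: "?g (f x) = x" if "x \<in> carrier M" for x using that by (rule the_inv_into_f_f[OF inj])
  have h: "?h (f b) = b" if "b \<in> B" for b using that by (rule the_inv_into_f_f[OF injB])
  have surj: "\<exists>x\<in>carrier M. y = f x" if "y \<in> carrier N" for y
    using bij that by (auto simp: bij_betw_def)
  show ?thesis
  proof (rule free_of_rankI[OF assms(2), where B = "f ` B" and k = "\<lambda>y b. k (?g y) (?h b)"])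
    show "card (f ` B) = d" using injB B(2) by (simp add: card_image)
  next
    fix y assume "y \<in> carrier N"
    then obtain x where x: "x \<in> carrier M" "y = f x" using surj by blast
    then show 1: "(\<lambda>b. k (?g y) (?h b)) \<in> f ` B \<rightarrow> carrier R"
      using k[OF x(1)] by (auto simp: g h)
    have "(\<Oplus>\<^bsub>M\<^esub>b\<in>B. k (?g y) (?h (f b)) \<odot>\<^bsub>M\<^esub> b) = (\<Oplus>\<^bsub>M\<^esub>b\<in>B. k x b \<odot>\<^bsub>M\<^esub> b)"
      using x k[OF x(1)] B(3) by (intro M.finsum_cong' refl) (auto simp: g h)
    then show "y = (\<Oplus>\<^bsub>N\<^esub>b\<in>f ` B. k (?g y) (?h b) \<odot>\<^bsub>N\<^esub> b)"
      using sum[OF 1] k_sum[OF x(1)] x(2) by simp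
  next
    fix c b assume c: "c \<in> f ` B \<rightarrow> carrier R" and b: "b \<in> f ` B"
    have "(\<Oplus>\<^bsub>M\<^esub>b\<in>B. c (f b) \<odot>\<^bsub>M\<^esub> b) \<in> carrier M"
      using c B(3) by (intro M.finsum_closed) auto
    then have "k (?g (\<Oplus>\<^bsub>N\<^esub>b\<in>f ` B. c b \<odot>\<^bsub>N\<^esub> b)) (?h b) = k (\<Oplus>\<^bsub>M\<^esub>b\<in>B. c (f b) \<odot>\<^bsub>M\<^esub> b) (?h b)"
      by (simp add: sum[OF c] g)
    also have "\<dots> = c b" using k_eq[of "\<lambda>b. c (f b)" "?h b"] b c by (auto simp: h Pi_iff)
    finally show "k (?g (\<Oplus>\<^bsub>N\<^esub>b\<in>f ` B. c b \<odot>\<^bsub>N\<^esub> b)) (?h b) = c b" .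
  qed (use B(1) sub in auto)
qed

lemma free_of_rank_imp_finitely_generated:
  assumes "module R M" and "free_of_rank R M d" shows "finitely_generated R M"
proof (rule free_of_rankE[OF assms])
  fix B k assume "finite B" "B \<subseteq> carrier M"
    and k: "\<And>x. x \<in> carrier M \<Longrightarrow> k x \<in> B \<rightarrow> carrier R"
      "\<And>x. x \<in> carrier M \<Longrightarrow> x = (\<Oplus>\<^bsub>M\<^esub>b\<in>B. k x b \<odot>\<^bsub>M\<^esub> b)"
  moreover have "\<exists>c\<in>B \<rightarrow> carrier R. x = (\<Oplus>\<^bsub>M\<^esub>b\<in>B. c b \<odot>\<^bsub>M\<^esub> b)" if "x \<in> carrier M" for x
    using k[OF that] by (rule_tac bexI[of _ "k x"])
  ultimately show ?thesis unfolding finitely_generated_def by (intro exI[of _ B] conjI ballI)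
qed

text \<open>Taking coordinates and evaluating linear combinations exhibit \<open>M\<close> as a
  retract of the free module on its own basis. Linearity of the coordinate map is the uniqueness of
  coefficients.\<close>

lemma free_of_rank_imp_projective:
  assumes "module R M" and "free_of_rank R M d" shows "projective R M"
proof -
  interpret M: Module.module R M by fact
  obtain B k where B: "finite B" "card B = d" "B \<subseteq> carrier M"
    and k: "\<And>x. x \<in> carrier M \<Longrightarrow> k x \<in> B \<rightarrow> carrier R"
    and k_sum: "\<And>x. x \<in> carrier M \<Longrightarrow> x = (\<Oplus>\<^bsub>M\<^esub>b\<in>B. k x b \<odot>\<^bsub>M\<^esub> b)"
    and k_eq: "\<And>c b. c \<in> B \<rightarrow> carrier R \<Longrightarrow> b \<in> B \<Longrightarrow> k (\<Oplus>\<^bsub>M\<^esub>b\<in>B. c b \<odot>\<^bsub>M\<^esub> b) b = c b"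
    by (rule free_of_rankE[OF assms]) (rule that)
  define i where "i = (\<lambda>x b. if b \<in> B then k x b else \<zero>\<^bsub>R\<^esub>)"
  define \<pi> where "\<pi> = (\<lambda>f. \<Oplus>\<^bsub>M\<^esub>b\<in>B. f b \<odot>\<^bsub>M\<^esub> b)"
  have kR: "k x b \<in> carrier R" if "x \<in> carrier M" "b \<in> B" for x b
    using k[OF that(1)] that(2) by auto
  have bM: "b \<in> carrier M" if "b \<in> B" for b using that B(3) by auto
  have "linear_map R M (free_module R B) i"
  proof (rule linear_mapI)
    fix x assume x: "x \<in> carrier M"
    have "{b. i x b \<noteq> \<zero>\<^bsub>R\<^esub>} \<subseteq> B" by (auto simp: i_def)
    then have "finite {b. i x b \<noteq> \<zero>\<^bsub>R\<^esub>}" using B(1) finite_subset by blast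
    then show "i x \<in> carrier (free_module R B)" using kR[OF x] by (auto simp: free_module_def i_def)
  next
    fix x y assume xy: "x \<in> carrier M" "y \<in> carrier M"
    have "x \<oplus>\<^bsub>M\<^esub> y = (\<Oplus>\<^bsub>M\<^esub>b\<in>B. k x b \<odot>\<^bsub>M\<^esub> b) \<oplus>\<^bsub>M\<^esub> (\<Oplus>\<^bsub>M\<^esub>b\<in>B. k y b \<odot>\<^bsub>M\<^esub> b)"
      using k_sum xy by simp
    also have "\<dots> = (\<Oplus>\<^bsub>M\<^esub>b\<in>B. k x b \<odot>\<^bsub>M\<^esub> b \<oplus>\<^bsub>M\<^esub> k y b \<odot>\<^bsub>M\<^esub> b)"
      using kR xy bM by (intro M.finsum_addf[symmetric]) auto
    also have "\<dots> = (\<Oplus>\<^bsub>M\<^esub>b\<in>B. (k x b \<oplus>\<^bsub>R\<^esub> k y b) \<odot>\<^bsub>M\<^esub> b)"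
      using kR xy bM by (intro M.finsum_cong' refl) (auto simp: M.smult_l_distr)
    finally have "k (x \<oplus>\<^bsub>M\<^esub> y) b = k x b \<oplus>\<^bsub>R\<^esub> k y b" if "b \<in> B" for b
      using k_eq[of "\<lambda>b. k x b \<oplus>\<^bsub>R\<^esub> k y b" b] kR xy that by auto
    then show "i (x \<oplus>\<^bsub>M\<^esub> y) = i x \<oplus>\<^bsub>free_module R B\<^esub> i y" by (auto simp: i_def free_module_def)
  next
    fix a x assume ax: "a \<in> carrier R" "x \<in> carrier M"
    have "a \<odot>\<^bsub>M\<^esub> x = a \<odot>\<^bsub>M\<^esub> (\<Oplus>\<^bsub>M\<^esub>b\<in>B. k x b \<odot>\<^bsub>M\<^esub> b)" using k_sum ax by simp
    also have "\<dots> = (\<Oplus>\<^bsub>M\<^esub>b\<in>B. a \<odot>\<^bsub>M\<^esub> (k x b \<odot>\<^bsub>M\<^esub> b))"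
      using kR ax bM B(1)
      by (intro linear_map_finsum[OF assms(1) assms(1), of "\<lambda>x. a \<odot>\<^bsub>M\<^esub> x"] linear_mapI)
         (auto simp: M.smult_r_distr M.smult_assoc1[symmetric] M.m_comm)
    also have "\<dots> = (\<Oplus>\<^bsub>M\<^esub>b\<in>B. (a \<otimes>\<^bsub>R\<^esub> k x b) \<odot>\<^bsub>M\<^esub> b)"
      using kR ax bM by (intro M.finsum_cong' refl) (auto simp: M.smult_assoc1)
    finally have "k (a \<odot>\<^bsub>M\<^esub> x) b = a \<otimes>\<^bsub>R\<^esub> k x b" if "b \<in> B" for b
      using k_eq[of "\<lambda>b. a \<otimes>\<^bsub>R\<^esub> k x b" b] kR ax that by auto
    then show "i (a \<odot>\<^bsub>M\<^esub> x) = a \<odot>\<^bsub>free_module R B\<^esub> i x" using ax by (auto simp: i_def free_module_def)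
  qed
  moreover have "linear_map R (free_module R B) M \<pi>"
  proof (rule linear_mapI)
    fix f assume "f \<in> carrier (free_module R B)"
    then show "\<pi> f \<in> carrier M" using bM by (auto simp: \<pi>_def free_module_def intro!: M.finsum_closed)
  next
    fix f g assume fg: "f \<in> carrier (free_module R B)" "g \<in> carrier (free_module R B)"
    have "\<pi> (f \<oplus>\<^bsub>free_module R B\<^esub> g) = (\<Oplus>\<^bsub>M\<^esub>b\<in>B. f b \<odot>\<^bsub>M\<^esub> b \<oplus>\<^bsub>M\<^esub> g b \<odot>\<^bsub>M\<^esub> b)"
      unfolding \<pi>_def using fg bM
      by (intro M.finsum_cong' refl) (auto simp: free_module_def M.smult_l_distr)
    also have "\<dots> = \<pi> f \<oplus>\<^bsub>M\<^esub> \<pi> g"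
      unfolding \<pi>_def using fg bM by (intro M.finsum_addf) (auto simp: free_module_def)
    finally show "\<pi> (f \<oplus>\<^bsub>free_module R B\<^esub> g) = \<pi> f \<oplus>\<^bsub>M\<^esub> \<pi> g" .
  next
    fix a f assume af: "a \<in> carrier R" "f \<in> carrier (free_module R B)"
    have "\<pi> (a \<odot>\<^bsub>free_module R B\<^esub> f) = (\<Oplus>\<^bsub>M\<^esub>b\<in>B. a \<odot>\<^bsub>M\<^esub> (f b \<odot>\<^bsub>M\<^esub> b))"
      unfolding \<pi>_def using af bM
      by (intro M.finsum_cong' refl) (auto simp: free_module_def M.smult_assoc1)
    also have "\<dots> = a \<odot>\<^bsub>M\<^esub> \<pi> f"
      unfolding \<pi>_def using af bM B(1)
      by (intro linear_map_finsum[OF assms(1) assms(1), of "\<lambda>x. a \<odot>\<^bsub>M\<^esub> x", symmetric] linear_mapI)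
         (auto simp: M.smult_r_distr M.smult_assoc1[symmetric] M.m_comm free_module_def)
    finally show "\<pi> (a \<odot>\<^bsub>free_module R B\<^esub> f) = a \<odot>\<^bsub>M\<^esub> \<pi> f" .
  qed
  moreover have "\<pi> (i x) = x" if "x \<in> carrier M" for x
  proof -
    have "\<pi> (i x) = (\<Oplus>\<^bsub>M\<^esub>b\<in>B. k x b \<odot>\<^bsub>M\<^esub> b)"
      unfolding \<pi>_def using kR that bM by (intro M.finsum_cong' refl) (auto simp: i_def)
    then show ?thesis using k_sum[OF that] by simp
  qed
  ultimately show ?thesis unfolding projective_def by blast
qed

section \<open>Finitely supported functions as free modules\<close>

lemma free_module_simps [simp]:
  "\<zero>\<^bsub>free_module R X\<^esub> = (\<lambda>x. \<zero>\<^bsub>R\<^esub>)"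
  "f \<oplus>\<^bsub>free_module R X\<^esub> g = (\<lambda>x. f x \<oplus>\<^bsub>R\<^esub> g x)"
  "c \<odot>\<^bsub>free_module R X\<^esub> f = (\<lambda>x. c \<otimes>\<^bsub>R\<^esub> f x)"
  by (simp_all add: free_module_def)

lemma carrier_free_module_iff:
  "f \<in> carrier (free_module R X) \<longleftrightarrow>
    (\<forall>x. f x \<in> carrier R) \<and> (\<forall>x. x \<notin> X \<longrightarrow> f x = \<zero>\<^bsub>R\<^esub>) \<and> finite {x. f x \<noteq> \<zero>\<^bsub>R\<^esub>}"
  by (simp add: free_module_def)

lemma carrier_free_module_finite_iff:
  assumes "finite X"
  shows "f \<in> carrier (free_module R X) \<longleftrightarrow>
    (\<forall>x. f x \<in> carrier R) \<and> (\<forall>x. x \<notin> X \<longrightarrow> f x = \<zero>\<^bsub>R\<^esub>)"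
proof -
  have "finite {x. f x \<noteq> \<zero>\<^bsub>R\<^esub>}" if "\<forall>x. x \<notin> X \<longrightarrow> f x = \<zero>\<^bsub>R\<^esub>"
    by (rule finite_subset[OF _ assms]) (use that in auto)
  then show ?thesis by (auto simp: carrier_free_module_iff)
qed

lemma free_module_apply_closed: "f \<in> carrier (free_module R X) \<Longrightarrow> f x \<in> carrier R"
  by (simp add: carrier_free_module_iff)

lemma free_module_apply_outside: "f \<in> carrier (free_module R X) \<Longrightarrow> x \<notin> X \<Longrightarrow> f x = \<zero>\<^bsub>R\<^esub>"
  by (simp add: carrier_free_module_iff)

context cring
begin

lemma basis_vector_closed [simp]: "basis_vector R x y \<in> carrier R"
  by (simp add: basis_vector_def)

lemma basis_vector_in_free_module:
  assumes "x \<in> X" shows "basis_vector R x \<in> carrier (free_module R X)"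
proof -
  have "{y. basis_vector R x y \<noteq> \<zero>} \<subseteq> {x}" by (auto simp: basis_vector_def)
  then show ?thesis
    using assms finite_subset by (fastforce simp: carrier_free_module_iff basis_vector_def)
qed

lemma free_module_add_closed:
  assumes "f \<in> carrier (free_module R X)" "g \<in> carrier (free_module R X)"
  shows "(\<lambda>x. f x \<oplus> g x) \<in> carrier (free_module R X)"
proof -
  have "{x. f x \<oplus> g x \<noteq> \<zero>} \<subseteq> {x. f x \<noteq> \<zero>} \<union> {x. g x \<noteq> \<zero>}"
    using assms by (auto simp: carrier_free_module_iff)
  then show ?thesis
    using assms finite_subset[of "{x. f x \<oplus> g x \<noteq> \<zero>}"] by (auto simp: carrier_free_module_iff)
qed

lemma free_module_smult_closed:
  assumes "c \<in> carrier R" "f \<in> carrier (free_module R X)"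
  shows "(\<lambda>x. c \<otimes> f x) \<in> carrier (free_module R X)"
proof -
  have "{x. c \<otimes> f x \<noteq> \<zero>} \<subseteq> {x. f x \<noteq> \<zero>}" using assms(1) by auto
  then show ?thesis
    using assms finite_subset[of "{x. c \<otimes> f x \<noteq> \<zero>}"] by (auto simp: carrier_free_module_iff)
qed

lemma module_free_module: "module R (free_module R X)"
proof (rule moduleI[OF is_cring])
  show "abelian_group (free_module R X)"
  proof (rule abelian_groupI)
    fix f assume f: "f \<in> carrier (free_module R X)"
    then have "(\<lambda>x. \<ominus> \<one> \<otimes> f x) \<in> carrier (free_module R X)" by (intro free_module_smult_closed) auto
    moreover have "(\<lambda>x. \<ominus> \<one> \<otimes> f x \<oplus> f x) = (\<lambda>x. \<zero>)"
      using f by (auto simp: carrier_free_module_iff l_minus l_neg)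
    ultimately show "\<exists>g\<in>carrier (free_module R X). g \<oplus>\<^bsub>free_module R X\<^esub> f = \<zero>\<^bsub>free_module R X\<^esub>"
      by (intro bexI) auto
  qed (auto simp: carrier_free_module_iff a_ac
    intro: free_module_add_closed[unfolded carrier_free_module_iff, THEN conjunct2, THEN conjunct2])
qed (auto simp: carrier_free_module_iff l_distr r_distr m_assoc
    intro: free_module_smult_closed[unfolded carrier_free_module_iff, THEN conjunct2, THEN conjunct2])

text \<open>Values are removed one at a time: \<open>f\<close> is \<open>f(a := \<zero>)\<close>
  plus a multiple of a basis vector. The induction runs over the finite support, so \<open>X\<close>
  itself may be infinite, as the set of walks between two vertices is.\<close>

lemma free_module_induct [consumes 1, case_names zero add smult basis]:
  assumes f: "f \<in> carrier (free_module R X)"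
    and zero: "P (\<lambda>x. \<zero>)"
    and add: "\<And>f g. f \<in> carrier (free_module R X) \<Longrightarrow> g \<in> carrier (free_module R X) \<Longrightarrow>
        P f \<Longrightarrow> P g \<Longrightarrow> P (\<lambda>x. f x \<oplus> g x)"
    and smult: "\<And>c f. c \<in> carrier R \<Longrightarrow> f \<in> carrier (free_module R X) \<Longrightarrow> P f \<Longrightarrow> P (\<lambda>x. c \<otimes> f x)"
    and basis: "\<And>x. x \<in> X \<Longrightarrow> P (basis_vector R x)"
  shows "P f"
proof -
  have "finite {x. f x \<noteq> \<zero>}" using f by (simp add: carrier_free_module_iff)
  then show ?thesis using f
  proof (induction "{x. f x \<noteq> \<zero>}" arbitrary: f rule: finite_induct)
    case empty
    then have "f = (\<lambda>x. \<zero>)" by auto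
    then show ?case using zero by simp
  next
    case (insert a A)
    have a: "a \<in> X" using insert by (auto simp: carrier_free_module_iff)
    let ?g = "f(a := \<zero>)" and ?b = "\<lambda>x. f a \<otimes> basis_vector R a x"
    have A: "A = {x. ?g x \<noteq> \<zero>}" using insert.hyps by auto
    have g: "?g \<in> carrier (free_module R X)"
      using insert.prems \<open>finite A\<close> A by (auto simp: carrier_free_module_iff)
    have fa: "f a \<in> carrier R" using insert.prems by (simp add: carrier_free_module_iff)
    have b: "?b \<in> carrier (free_module R X)"
      by (intro free_module_smult_closed fa basis_vector_in_free_module a)
    have "P (\<lambda>x. ?g x \<oplus> ?b x)"
      by (intro add g b insert.hyps(3)[OF A] smult[OF fa] basis_vector_in_free_module a basis)
    moreover have "(\<lambda>x. ?g x \<oplus> ?b x) = f"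
      using fa insert.prems by (auto simp: basis_vector_def carrier_free_module_iff)
    ultimately show ?case by simp
  qed
qed

text \<open>The main device for identities between multilinear expressions: with all arguments but
  one fixed, they reduce to basis vectors, one argument after the other.\<close>

lemma free_module_linear_ext:
  assumes "f \<in> carrier (free_module R X)"
    and N: "module R N" and F: "linear_map R (free_module R X) N F" and G: "linear_map R (free_module R X) N G"
    and eq: "\<And>x. x \<in> X \<Longrightarrow> F (basis_vector R x) = G (basis_vector R x)"
  shows "F f = G f"
  using assms(1)
proof (induction rule: free_module_induct)
  case zero
  then show ?case
    using linear_map_zero[OF module_free_module N F] linear_map_zero[OF module_free_module N G] by simp
next
  case (add f g)
  then show ?case using linear_map_add[OF F, of f g] linear_map_add[OF G, of f g] by simp
next
  case (smult c f)
  then show ?case using linear_map_smult[OF F, of c f] linear_map_smult[OF G, of c f] by simp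
qed (rule eq)

text \<open>Nontriviality of the ring enters here: with \<open>\<one> = \<zero>\<close> all basis
  vectors would coincide, and their number need not be \<open>card X\<close>.\<close>

lemma free_of_rank_free_module:
  assumes "\<one> \<noteq> \<zero>" and X: "finite X"
  shows "free_of_rank R (free_module R X) (card X)"
proof -
  interpret F: Module.module R "free_module R X" by (rule module_free_module)
  let ?e = "basis_vector R"
  have inj: "inj_on ?e X"
    using assms(1) by (auto simp: inj_on_def basis_vector_def fun_eq_iff split: if_splits)
  have inv: "the_inv_into X ?e (?e x) = x" if "x \<in> X" for x
    using that by (rule the_inv_into_f_f[OF inj])
  have sum_apply: "(\<Oplus>\<^bsub>free_module R X\<^esub>y\<in>A. g y) x = (\<Oplus>y\<in>A. g y x)"
    if "finite A" "g \<in> A \<rightarrow> carrier (free_module R X)" for A and g :: "_ \<Rightarrow> _ \<Rightarrow> _" and x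
    using that
  proof (induction A rule: finite_induct)
    case (insert a A)
    then have "(\<lambda>y. g y x) \<in> A \<rightarrow> carrier R" "g a x \<in> carrier R"
      by (auto simp: Pi_iff free_module_apply_closed)
    with insert show ?case by simp
  qed simp
  have coord: "(\<Oplus>\<^bsub>free_module R X\<^esub>b\<in>?e ` X. c b \<odot>\<^bsub>free_module R X\<^esub> b) x = c (?e x)"
    if c: "c \<in> ?e ` X \<rightarrow> carrier R" and x: "x \<in> X" for c x
  proof -
    have cR: "c (?e y) \<in> carrier R" if "y \<in> X" for y using c that by auto
    have e: "?e y x = (if x = y then \<one> else \<zero>)" for y by (simp add: basis_vector_def)
    have mem: "c b \<odot>\<^bsub>free_module R X\<^esub> b \<in> carrier (free_module R X)" if "b \<in> ?e ` X" for b
      using c that basis_vector_in_free_module by (intro F.smult_closed) auto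
    have "(\<Oplus>\<^bsub>free_module R X\<^esub>b\<in>?e ` X. c b \<odot>\<^bsub>free_module R X\<^esub> b) x = (\<Oplus>b\<in>?e ` X. c b \<otimes> b x)"
      using mem X by (subst sum_apply) auto
    also have "\<dots> = (\<Oplus>y\<in>X. c (?e y) \<otimes> ?e y x)"
      using c by (intro add.finprod_reindex inj) (auto simp: Pi_iff)
    also have "\<dots> = (\<Oplus>y\<in>X. if x = y then c (?e y) else \<zero>)"
      using cR by (intro finsum_cong' refl) (auto simp: e)
    also have "\<dots> = c (?e x)"
      using cR x X by (intro add.finprod_singleton) auto
    finally show ?thesis .
  qed
  let ?k = "\<lambda>f b. f (the_inv_into X ?e b)"
  show ?thesis
  proof (rule free_of_rankI[OF module_free_module, where B = "?e ` X" and k = ?k])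
    show "card (?e ` X) = card X" using inj by (rule card_image)
  next
    fix f assume f: "f \<in> carrier (free_module R X)"
    show k: "?k f \<in> ?e ` X \<rightarrow> carrier R" using f by (auto simp: carrier_free_module_iff)
    show "f = (\<Oplus>\<^bsub>free_module R X\<^esub>b\<in>?e ` X. ?k f b \<odot>\<^bsub>free_module R X\<^esub> b)" (is "_ = ?s")
    proof
      fix x
      have "?s \<in> carrier (free_module R X)"
        using k basis_vector_in_free_module
        by (intro F.finsum_closed) (auto intro!: F.smult_closed simp del: free_module_simps)
      then show "f x = ?s x"
        using coord[OF k, of x] inv f
        by (cases "x \<in> X") (simp_all add: carrier_free_module_iff del: free_module_simps)
    qed
  next
    fix c b assume c: "c \<in> ?e ` X \<rightarrow> carrier R" and b: "b \<in> ?e ` X"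
    then show "?k (\<Oplus>\<^bsub>free_module R X\<^esub>b\<in>?e ` X. c b \<odot>\<^bsub>free_module R X\<^esub> b) b = c b"
      using coord[OF c] inv by (auto simp del: free_module_simps)
  qed (use X basis_vector_in_free_module in auto)
qed

end

section \<open>Truncated convolution\<close>

definition sign :: "('k, 'z) ring_scheme \<Rightarrow> nat \<Rightarrow> 'k" where
  "sign R k = (\<ominus>\<^bsub>R\<^esub> \<one>\<^bsub>R\<^esub>) [^]\<^bsub>R\<^esub> k"

context cring
begin

lemma sign_closed [simp, intro]: "sign R k \<in> carrier R"
  by (simp add: sign_def)

lemma sign_0 [simp]: "sign R 0 = \<one>"
  by (simp add: sign_def)

lemma sign_Suc: "sign R (Suc k) = \<ominus> sign R k"
  by (simp add: sign_def r_minus)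

lemma sign_add: "sign R (k + l) = sign R k \<otimes> sign R l"
  by (simp add: sign_def nat_pow_mult)

lemma sign_eq: "sign R k = (if even k then \<one> else \<ominus> \<one>)"
  by (induction k) (auto simp: sign_Suc)

lemma sign_cong: "even k = even l \<Longrightarrow> sign R k = sign R l"
  by (simp add: sign_eq)

lemma sign_sign [simp]: "sign R k \<otimes> sign R k = \<one>"
  by (simp add: sign_eq l_minus)

lemma sign_sign_left [simp]: "x \<in> carrier R \<Longrightarrow> sign R k \<otimes> (sign R k \<otimes> x) = x"
  by (simp add: m_assoc[symmetric])

lemma module_ring_module: "module R (ring_module R)"
proof (rule moduleI[OF is_cring])
  show "abelian_group (ring_module R)"
    by (rule abelian_groupI) (auto simp: ring_module_def a_ac intro: bexI[of _ "\<ominus> _"] l_neg)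
qed (auto simp: ring_module_def l_distr r_distr m_assoc)

end

text \<open>
  A walk from \<open>p\<close> to \<open>q\<close> with \<open>s\<close> downward arrows has \<open>q + s - p\<close> upward ones. It can be nonzero in
  the mesh category only if both of its rearrangements \<open>all down, then up\<close> and
  \<open>all up, then down\<close> stay inside \<open>{1..n}\<close>.
\<close>

definition steps :: "nat \<Rightarrow> nat \<Rightarrow> nat \<Rightarrow> nat set" where
  "steps n p q = {s. p \<le> q + s \<and> s < p \<and> s + q \<le> n}"

lemma finite_steps [simp, intro]: "finite (steps n p q)"
  by (rule finite_subset[of _ "{..<p}"]) (auto simp: steps_def)

text \<open>The admissible \<open>s\<close> form an interval that starts at the truncated difference
  \<open>p - q\<close>. For \<open>p \<le> q\<close> it starts at 0 and its length is the minimum of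
  \<open>p\<close> and \<open>n + 1 - q\<close>; otherwise the shift by \<open>p - q\<close> turns
  these two numbers into \<open>q\<close> and \<open>n + 1 - p\<close>. In either case the two
  numbers left out are no smaller than the minimum.\<close>

lemma card_steps:
  assumes "p \<in> {1..n}" "q \<in> {1..n}"
  shows "card (steps n p q) = Min {p, q, n + 1 - p, n + 1 - q}"
proof -
  have "steps n p q = {p - q..<min p (n + 1 - q)}"
    using assms by (auto simp: steps_def)
  then show ?thesis using assms by (auto simp: min_def)
qed

text \<open>Multiplication of polynomials whose exponent counts downward arrows, cut off to the
  window of admissible exponents. Inside the sum \<open>i \<le> s\<close>, so the natural
  subtraction \<open>s - i\<close> is exact.\<close>

definition truncated_category :: "('k, 'z) ring_scheme \<Rightarrow> nat \<Rightarrow> (nat, 'k, nat \<Rightarrow> 'k) linear_cat" where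
  "truncated_category R n =
     \<lparr>Obj = {1..n},
      Hom = (\<lambda>p q. free_module R (steps n p q)),
      Comp = (\<lambda>p q r g f s. if s \<in> steps n p r then finsum R (\<lambda>i. g (s - i) \<otimes>\<^bsub>R\<^esub> f i) {..s} else \<zero>\<^bsub>R\<^esub>),
      Ident = (\<lambda>q. basis_vector R 0)\<rparr>"

lemma truncated_category_simps [simp]:
  "Obj (truncated_category R n) = {1..n}"
  "Hom (truncated_category R n) p q = free_module R (steps n p q)"
  "Ident (truncated_category R n) q = basis_vector R 0"
  by (simp_all add: truncated_category_def)

text \<open>Read backwards: if the index \<open>s\<close> of the result is the number
  \<open>q + s' - p\<close> of upward arrows of a walk from \<open>p\<close> to \<open>q\<close>,
  then \<open>s' = p + s - q\<close>. Admissibility of \<open>s\<close> between the reflected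
  vertices keeps this subtraction from truncating.\<close>

definition truncated_serre :: "('k, 'z) ring_scheme \<Rightarrow> nat \<Rightarrow> nat \<Rightarrow> nat \<Rightarrow> (nat \<Rightarrow> 'k) \<Rightarrow> nat \<Rightarrow> 'k" where
  "truncated_serre R n p q f =
     (\<lambda>s. if s \<in> steps n (n + 1 - p) (n + 1 - q) then sign R (n * (p + q)) \<otimes>\<^bsub>R\<^esub> f (p + s - q) else \<zero>\<^bsub>R\<^esub>)"

text \<open>The exponent \<open>p - 1\<close> is the largest one admissible from \<open>p\<close> to
  \<open>n + 1 - p\<close>; it belongs to walks of length \<open>n - 1\<close>, the maximal length
  of a nonzero path.\<close>

definition truncated_trace :: "('k, 'z) ring_scheme \<Rightarrow> nat \<Rightarrow> nat \<Rightarrow> (nat \<Rightarrow> 'k) \<Rightarrow> 'k" where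
  "truncated_trace R n p f = sign R (n * p) \<otimes>\<^bsub>R\<^esub> f (p - 1)"

text \<open>A walk from \<open>p\<close> to \<open>q\<close> with \<open>s\<close> downward arrows
  has length \<open>q + 2 * s - p\<close>, so the condition selects lengths of at least
  \<open>m\<close>, written without subtraction.\<close>

definition truncated_filtration :: "('k, 'z) ring_scheme \<Rightarrow> nat \<Rightarrow> nat \<Rightarrow> nat \<Rightarrow> nat \<Rightarrow> (nat \<Rightarrow> 'k) set" where
  "truncated_filtration R n m p q = carrier (free_module R {s \<in> steps n p q. p + m \<le> q + 2 * s})"

section \<open>The model category and its truncated convolution\<close>

locale truncated = cring R for R :: "('k, 'z) ring_scheme" (structure) and n :: nat
begin

abbreviation T where "T \<equiv> truncated_category R n"
abbreviation H where "H p q \<equiv> carrier (free_module R (steps n p q))"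

lemma H_iff: "f \<in> H p q \<longleftrightarrow> (\<forall>s. f s \<in> carrier R) \<and> (\<forall>s. s \<notin> steps n p q \<longrightarrow> f s = \<zero>)"
  by (simp add: carrier_free_module_finite_iff)

lemma H_apply [simp]: "f \<in> H p q \<Longrightarrow> f s \<in> carrier R"
  by (simp add: H_iff)

lemma basis_H [simp]: "s \<in> steps n p q \<Longrightarrow> basis_vector R s \<in> H p q"
  by (rule basis_vector_in_free_module)

lemma module_H: "module R (free_module R (steps n p q))"
  by (rule module_free_module)

lemma zero_H [simp]: "(\<lambda>s. \<zero>) \<in> H p q"
  by (simp add: H_iff)

lemma comp_apply:
  "Comp T p q r g f s = (if s \<in> steps n p r then \<Oplus>i\<in>{..s}. g (s - i) \<otimes> f i else \<zero>)"
  by (simp add: truncated_category_def)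

lemma comp_closed [simp]:
  assumes "f \<in> H p q" "g \<in> H q r" shows "Comp T p q r g f \<in> H p r"
  using assms by (auto simp: H_iff comp_apply intro!: finsum_closed)

lemma comp_linear_left:
  assumes "f \<in> H p q"
  shows "linear_map R (free_module R (steps n q r)) (free_module R (steps n p r)) (\<lambda>g. Comp T p q r g f)"
proof (rule linear_mapI)
  fix g h assume gh: "g \<in> H q r" "h \<in> H q r"
  show "Comp T p q r (g \<oplus>\<^bsub>free_module R (steps n q r)\<^esub> h) f
      = Comp T p q r g f \<oplus>\<^bsub>free_module R (steps n p r)\<^esub> Comp T p q r h f"
  proof
    fix s
    have "(\<Oplus>i\<in>{..s}. (g (s - i) \<oplus> h (s - i)) \<otimes> f i) = (\<Oplus>i\<in>{..s}. g (s - i) \<otimes> f i \<oplus> h (s - i) \<otimes> f i)"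
      using assms gh by (intro finsum_cong' refl) (auto intro: l_distr)
    also have "\<dots> = (\<Oplus>i\<in>{..s}. g (s - i) \<otimes> f i) \<oplus> (\<Oplus>i\<in>{..s}. h (s - i) \<otimes> f i)"
      using assms gh by (intro finsum_addf) auto
    finally show "Comp T p q r (g \<oplus>\<^bsub>free_module R (steps n q r)\<^esub> h) f s
      = (Comp T p q r g f \<oplus>\<^bsub>free_module R (steps n p r)\<^esub> Comp T p q r h f) s"
      by (simp add: comp_apply)
  qed
next
  fix c g assume cg: "c \<in> carrier R" "g \<in> H q r"
  show "Comp T p q r (c \<odot>\<^bsub>free_module R (steps n q r)\<^esub> g) f
      = c \<odot>\<^bsub>free_module R (steps n p r)\<^esub> Comp T p q r g f"
  proof
    fix s
    have "(\<Oplus>i\<in>{..s}. (c \<otimes> g (s - i)) \<otimes> f i) = (\<Oplus>i\<in>{..s}. c \<otimes> (g (s - i) \<otimes> f i))"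
      using assms cg by (intro finsum_cong' refl) (auto intro: m_assoc)
    also have "\<dots> = c \<otimes> (\<Oplus>i\<in>{..s}. g (s - i) \<otimes> f i)"
      using assms cg by (intro finsum_rdistr[symmetric]) auto
    finally show "Comp T p q r (c \<odot>\<^bsub>free_module R (steps n q r)\<^esub> g) f s
      = (c \<odot>\<^bsub>free_module R (steps n p r)\<^esub> Comp T p q r g f) s"
      using cg by (simp add: comp_apply)
  qed
qed (use assms in simp)

lemma comp_linear_right:
  assumes "g \<in> H q r"
  shows "linear_map R (free_module R (steps n p q)) (free_module R (steps n p r)) (\<lambda>f. Comp T p q r g f)"
proof (rule linear_mapI)
  fix f h assume fh: "f \<in> H p q" "h \<in> H p q"
  show "Comp T p q r g (f \<oplus>\<^bsub>free_module R (steps n p q)\<^esub> h)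
      = Comp T p q r g f \<oplus>\<^bsub>free_module R (steps n p r)\<^esub> Comp T p q r g h"
  proof
    fix s
    have "(\<Oplus>i\<in>{..s}. g (s - i) \<otimes> (f i \<oplus> h i)) = (\<Oplus>i\<in>{..s}. g (s - i) \<otimes> f i \<oplus> g (s - i) \<otimes> h i)"
      using assms fh by (intro finsum_cong' refl) (auto intro: r_distr)
    also have "\<dots> = (\<Oplus>i\<in>{..s}. g (s - i) \<otimes> f i) \<oplus> (\<Oplus>i\<in>{..s}. g (s - i) \<otimes> h i)"
      using assms fh by (intro finsum_addf) auto
    finally show "Comp T p q r g (f \<oplus>\<^bsub>free_module R (steps n p q)\<^esub> h) s
      = (Comp T p q r g f \<oplus>\<^bsub>free_module R (steps n p r)\<^esub> Comp T p q r g h) s"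
      by (simp add: comp_apply)
  qed
next
  fix c f assume cf: "c \<in> carrier R" "f \<in> H p q"
  show "Comp T p q r g (c \<odot>\<^bsub>free_module R (steps n p q)\<^esub> f)
      = c \<odot>\<^bsub>free_module R (steps n p r)\<^esub> Comp T p q r g f"
  proof
    fix s
    have "(\<Oplus>i\<in>{..s}. g (s - i) \<otimes> (c \<otimes> f i)) = (\<Oplus>i\<in>{..s}. c \<otimes> (g (s - i) \<otimes> f i))"
      using assms cf by (intro finsum_cong' refl) (auto intro: m_lcomm)
    also have "\<dots> = c \<otimes> (\<Oplus>i\<in>{..s}. g (s - i) \<otimes> f i)"
      using assms cf by (intro finsum_rdistr[symmetric]) auto
    finally show "Comp T p q r g (c \<odot>\<^bsub>free_module R (steps n p q)\<^esub> f) s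
      = (c \<odot>\<^bsub>free_module R (steps n p r)\<^esub> Comp T p q r g f) s"
      using cf by (simp add: comp_apply)
  qed
qed (use assms in simp)

lemma comp_smult_left:
  assumes "c \<in> carrier R" "f \<in> H p q" "g \<in> H q r"
  shows "Comp T p q r (\<lambda>i. c \<otimes> g i) f = (\<lambda>i. c \<otimes> Comp T p q r g f i)"
  using linear_map_smult[OF comp_linear_left[OF assms(2)] assms(1,3)] by simp

lemma comp_smult_right:
  assumes "c \<in> carrier R" "f \<in> H p q" "g \<in> H q r"
  shows "Comp T p q r g (\<lambda>i. c \<otimes> f i) = (\<lambda>i. c \<otimes> Comp T p q r g f i)"
  using linear_map_smult[OF comp_linear_right[OF assms(3)] assms(1,2)] by simp

lemma comp_zero_left: "f \<in> H p q \<Longrightarrow> Comp T p q r (\<lambda>s. \<zero>) f = (\<lambda>s. \<zero>)"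
  using linear_map_zero[OF module_H module_H comp_linear_left, of f p q r] by simp

lemma comp_zero_right: "g \<in> H q r \<Longrightarrow> Comp T p q r g (\<lambda>s. \<zero>) = (\<lambda>s. \<zero>)"
  using linear_map_zero[OF module_H module_H comp_linear_right, of g q r p] by simp

lemma finsum_conv_basis:
  fixes s k :: nat
  assumes f: "\<And>i. f i \<in> carrier R" and "s \<le> k"
  shows "(\<Oplus>i\<in>{..k}. f (k - i) \<otimes> basis_vector R s i) = f (k - s)"
    and "(\<Oplus>i\<in>{..k}. basis_vector R s (k - i) \<otimes> f i) = f (k - s)"
proof -
  have "(\<Oplus>i\<in>{..k}. f (k - i) \<otimes> basis_vector R s i) = (\<Oplus>i\<in>{..k}. if s = i then f (k - i) else \<zero>)"
    using f by (intro finsum_cong' refl) (auto simp: basis_vector_def)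
  also have "\<dots> = f (k - s)"
    using f assms(2) by (intro add.finprod_singleton) auto
  finally show "(\<Oplus>i\<in>{..k}. f (k - i) \<otimes> basis_vector R s i) = f (k - s)" .
  have "(\<Oplus>i\<in>{..k}. basis_vector R s (k - i) \<otimes> f i) = (\<Oplus>i\<in>{..k}. if k - s = i then f i else \<zero>)"
    using f assms(2) by (intro finsum_cong' refl) (auto simp: basis_vector_def)
  also have "\<dots> = f (k - s)"
    using f by (intro add.finprod_singleton) auto
  finally show "(\<Oplus>i\<in>{..k}. basis_vector R s (k - i) \<otimes> f i) = f (k - s)" .
qed

lemma comp_basis:
  assumes "s \<in> steps n p q" "t \<in> steps n q r"
  shows "Comp T p q r (basis_vector R t) (basis_vector R s) =
    (if s + t \<in> steps n p r then basis_vector R (s + t) else (\<lambda>i. \<zero>))"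
proof
  fix k
  show "Comp T p q r (basis_vector R t) (basis_vector R s) k =
    (if s + t \<in> steps n p r then basis_vector R (s + t) else (\<lambda>i. \<zero>)) k"
  \<comment> \<open>Without \<open>s \<le> k\<close> the difference \<open>k - s\<close> would be
    truncated to 0, and comparing it with \<open>t\<close> would say nothing about
    \<open>s + t\<close>.\<close>
  proof (cases "k \<in> steps n p r \<and> s \<le> k")
    case True
    then have "Comp T p q r (basis_vector R t) (basis_vector R s) k = basis_vector R t (k - s)"
      by (simp add: comp_apply finsum_conv_basis)
    then show ?thesis using True by (auto simp: basis_vector_def)
  next
    case False
    have "Comp T p q r (basis_vector R t) (basis_vector R s) k = \<zero>"
    proof (cases "s \<le> k")
      case True then show ?thesis using False by (simp add: comp_apply)
    next
      case nle: False
      have "(\<Oplus>i\<in>{..k}. basis_vector R t (k - i) \<otimes> basis_vector R s i) = (\<Oplus>i\<in>{..k}. \<zero>)"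
        using nle by (intro finsum_cong' refl) (auto simp: basis_vector_def)
      then show ?thesis by (simp add: comp_apply)
    qed
    then show ?thesis using False by (auto simp: basis_vector_def)
  qed
qed

lemma comp_ident_left:
  assumes "q \<in> {1..n}" "f \<in> H p q"
  shows "Comp T p q q (basis_vector R 0) f = f"
  using assms finsum_conv_basis(2)[of f 0] by (auto simp: fun_eq_iff comp_apply H_iff)

lemma comp_ident_right:
  assumes "p \<in> {1..n}" "f \<in> H p q"
  shows "Comp T p p q f (basis_vector R 0) = f"
  using assms finsum_conv_basis(1)[of f 0] by (auto simp: fun_eq_iff comp_apply H_iff)

text \<open>Cutting off between two multiplications loses nothing, because an inadmissible partial
  product stays inadmissible after any further admissible factor. By \<open>r \<le> v + u\<close> an
  excess \<open>s + t + r > n\<close> carries over to \<open>s + t + u + v > n\<close>, and by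
  \<open>p \<le> q + s\<close> an excess \<open>t + u \<ge> q\<close> carries over to
  \<open>s + t + u \<ge> p\<close>; the other two excesses carry over directly.\<close>

lemma comp_assoc_basis:
  assumes "s \<in> steps n p q" "t \<in> steps n q r" "u \<in> steps n r v"
  shows "Comp T p q v (Comp T q r v (basis_vector R u) (basis_vector R t)) (basis_vector R s) =
    Comp T p r v (basis_vector R u) (Comp T p q r (basis_vector R t) (basis_vector R s))"
proof -
  have "s + t + u \<notin> steps n p v" if "s + t \<notin> steps n p r"
    using that assms by (auto simp: steps_def)
  moreover have "s + t + u \<notin> steps n p v" if "t + u \<notin> steps n q v"
    using that assms by (auto simp: steps_def)
  ultimately show ?thesis
    using assms by (auto simp: comp_basis comp_zero_left comp_zero_right add.assoc)
qed

text \<open>Trilinear extension of the basis case: first in \<open>h\<close>, then in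
  \<open>g\<close>, then in \<open>f\<close>.\<close>

lemma comp_assoc:
  assumes f: "f \<in> H p q" and g: "g \<in> H q r" and h: "h \<in> H r v"
  shows "Comp T p q v (Comp T q r v h g) f = Comp T p r v h (Comp T p q r g f)"
proof -
  have 1: "Comp T p q v (Comp T q r v h (basis_vector R t)) (basis_vector R s) =
    Comp T p r v h (Comp T p q r (basis_vector R t) (basis_vector R s))"
    if s: "s \<in> steps n p q" and t: "t \<in> steps n q r" for s t
    by (rule free_module_linear_ext[OF h module_H
          linear_map_compose[OF comp_linear_left[of "basis_vector R t"] comp_linear_left[of "basis_vector R s"]]
          comp_linear_left])
       (simp_all add: s t comp_assoc_basis)
  have 2: "Comp T p q v (Comp T q r v h g) (basis_vector R s) = Comp T p r v h (Comp T p q r g (basis_vector R s))"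
    if s: "s \<in> steps n p q" for s
    by (rule free_module_linear_ext[OF g module_H
          linear_map_compose[OF comp_linear_right[OF h] comp_linear_left[of "basis_vector R s"]]
          linear_map_compose[OF comp_linear_left[of "basis_vector R s"] comp_linear_right[OF h]]])
       (simp_all add: s 1)
  show ?thesis
    by (rule free_module_linear_ext[OF f module_H comp_linear_right
          linear_map_compose[OF comp_linear_right[OF g] comp_linear_right[OF h]]])
       (simp_all add: g h 2)
qed

lemma linear_category_truncated: "linear_category R T"
proof (intro linear_category.intro linear_category_axioms.intro is_cring)
  fix q assume "q \<in> Obj T"
  then have "0 \<in> steps n q q" by (auto simp: steps_def)
  then show "Ident T q \<in> carrier (Hom T q q)" by (simp add: basis_vector_in_free_module)
qed (simp_all add: module_H comp_linear_left comp_linear_right comp_ident_left comp_ident_right comp_assoc)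

section \<open>The Serre twist: exchanging upward and downward arrows\<close>

lemma serre_basis:
  assumes "p \<in> {1..n}" "q \<in> {1..n}" "s \<in> steps n p q"
  shows "truncated_serre R n p q (basis_vector R s) =
    (\<lambda>i. sign R (n * (p + q)) \<otimes> basis_vector R (q + s - p) i)"
  using assms by (auto simp: truncated_serre_def basis_vector_def steps_def fun_eq_iff)

lemma serre_linear:
  assumes "p \<in> {1..n}" "q \<in> {1..n}"
  shows "linear_map R (free_module R (steps n p q)) (free_module R (steps n (n + 1 - p) (n + 1 - q)))
    (truncated_serre R n p q)"
  by (rule linear_mapI)
     (auto simp: H_iff truncated_serre_def fun_eq_iff r_distr m_lcomm)

lemma serre_closed [simp]:
  assumes "p \<in> {1..n}" "q \<in> {1..n}" "f \<in> H p q"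
  shows "truncated_serre R n p q f \<in> H (n + 1 - p) (n + 1 - q)"
  using linear_map_closed[OF serre_linear] assms by blast

lemma serre_serre:
  assumes "p \<in> {1..n}" "q \<in> {1..n}" "f \<in> H p q"
  shows "truncated_serre R n (n + 1 - p) (n + 1 - q) (truncated_serre R n p q f) = f"
proof
  fix s
  \<comment> \<open>Reflecting both vertices changes \<open>p + q\<close> by an even amount, so the
    two applications carry equal signs, which cancel.\<close>
  have "even (n * (p + q)) = even (n * ((n + 1 - p) + (n + 1 - q)))"
    using assms(1,2) by auto
  then have sg: "sign R (n * (p + q)) = sign R (n * ((n + 1 - p) + (n + 1 - q)))" by (rule sign_cong)
  show "truncated_serre R n (n + 1 - p) (n + 1 - q) (truncated_serre R n p q f) s = f s"
  proof (cases "s \<in> steps n p q")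
    case True
    then have "n + 1 - p + s - (n + 1 - q) \<in> steps n (n + 1 - p) (n + 1 - q)"
      and "p + (n + 1 - p + s - (n + 1 - q)) - q = s"
      using assms(1,2) by (auto simp: steps_def)
    then show ?thesis using True assms sg by (simp add: truncated_serre_def)
  next
    case False
    then show ?thesis using assms by (auto simp: truncated_serre_def H_iff)
  qed
qed

text \<open>Upward arrows are counted additively just like downward ones, and reflecting the
  vertices exchanges the two bounds: \<open>s < p\<close> becomes
  \<open>?s + (n + 1 - q) \<le> n\<close>, and \<open>s + q \<le> n\<close> becomes
  \<open>?s < n + 1 - p\<close>. Hence a product is cut off on one side exactly when it is on the
  other. The signs multiply because \<open>(p + q) + (q + r)\<close> and \<open>p + r\<close> have
  the same parity.\<close>

lemma serre_comp_basis:
  assumes p: "p \<in> {1..n}" and q: "q \<in> {1..n}" and r: "r \<in> {1..n}"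
    and s: "s \<in> steps n p q" and t: "t \<in> steps n q r"
  shows "truncated_serre R n p r (Comp T p q r (basis_vector R t) (basis_vector R s)) =
    Comp T (n + 1 - p) (n + 1 - q) (n + 1 - r)
      (truncated_serre R n q r (basis_vector R t)) (truncated_serre R n p q (basis_vector R s))"
proof -
  let ?p = "n + 1 - p" and ?q = "n + 1 - q" and ?r = "n + 1 - r"
  let ?s = "q + s - p" and ?t = "r + t - q"
  have s': "?s \<in> steps n ?p ?q" and t': "?t \<in> steps n ?q ?r"
    using p q r s t by (auto simp: steps_def)
  have st: "?s + ?t = r + (s + t) - p" and iff: "?s + ?t \<in> steps n ?p ?r \<longleftrightarrow> s + t \<in> steps n p r"
    using p q r s t by (auto simp: steps_def)
  have "even (n * (p + r)) = even (n * (p + q) + n * (q + r))" by auto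
  then have sg: "sign R (n * (p + r)) = sign R (n * (p + q)) \<otimes> sign R (n * (q + r))"
    by (simp add: sign_add[symmetric] sign_cong)
  have "Comp T ?p ?q ?r (truncated_serre R n q r (basis_vector R t)) (truncated_serre R n p q (basis_vector R s)) =
    (\<lambda>i. sign R (n * (p + r)) \<otimes> Comp T ?p ?q ?r (basis_vector R ?t) (basis_vector R ?s) i)"
    unfolding serre_basis[OF p q s] serre_basis[OF q r t] sg
    using s' t' free_module_apply_closed[OF comp_closed[OF basis_H[OF s'] basis_H[OF t']]]
    by (simp only: comp_smult_left[OF sign_closed free_module_smult_closed] comp_smult_right[OF sign_closed]
        basis_H sign_closed)
       (simp add: fun_eq_iff m_assoc[symmetric] m_comm)
  also have "\<dots> = truncated_serre R n p r (Comp T p q r (basis_vector R t) (basis_vector R s))"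
  proof (cases "s + t \<in> steps n p r")
    case True
    then show ?thesis using iff unfolding comp_basis[OF s t] comp_basis[OF s' t'] st by (simp add: serre_basis[OF p r])
  next
    case False
    then have "truncated_serre R n p r (\<lambda>i. \<zero>) = (\<lambda>i. \<zero>)" by (auto simp: truncated_serre_def)
    then show ?thesis using iff False unfolding comp_basis[OF s t] comp_basis[OF s' t'] by simp
  qed
  finally show ?thesis by simp
qed

lemma serre_comp:
  assumes p: "p \<in> {1..n}" and q: "q \<in> {1..n}" and r: "r \<in> {1..n}" and f: "f \<in> H p q" and g: "g \<in> H q r"
  shows "truncated_serre R n p r (Comp T p q r g f) =
    Comp T (n + 1 - p) (n + 1 - q) (n + 1 - r) (truncated_serre R n q r g) (truncated_serre R n p q f)"
proof -
  note S = serre_linear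
  have 1: "truncated_serre R n p r (Comp T p q r g (basis_vector R s)) =
    Comp T (n + 1 - p) (n + 1 - q) (n + 1 - r) (truncated_serre R n q r g)
      (truncated_serre R n p q (basis_vector R s))" if s: "s \<in> steps n p q" for s
    by (rule free_module_linear_ext[OF g module_H linear_map_compose[OF comp_linear_left[of "basis_vector R s"] S[OF p r]]
          linear_map_compose[OF S[OF q r] comp_linear_left[of "truncated_serre R n p q (basis_vector R s)"]]])
       (simp add: s, rule serre_closed[OF p q basis_H[OF s]], rule serre_comp_basis[OF p q r s])
  show ?thesis
    by (rule free_module_linear_ext[OF f module_H linear_map_compose[OF comp_linear_right[OF g] S[OF p r]]
          linear_map_compose[OF S[OF p q] comp_linear_right[of "truncated_serre R n q r g"]]])
       (rule serre_closed[OF q r g], rule 1)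
qed

section \<open>The trace form: duality and twisted symmetry\<close>

lemma trace_linear: "linear_map R (free_module R (steps n p q)) (ring_module R) (truncated_trace R n p)"
  by (rule linear_mapI) (auto simp: truncated_trace_def ring_module_def r_distr m_lcomm)

lemma trace_closed [simp]: "f \<in> H p q \<Longrightarrow> truncated_trace R n p f \<in> carrier R"
  by (simp add: truncated_trace_def)

text \<open>Composing with a basis vector shifts exponents, so multiplying \<open>h\<close> by
  exponent \<open>p - 1 - s\<close> moves its coefficient at \<open>s\<close> to the place
  \<open>p - 1\<close> that the trace reads. Up to sign, the two bases are therefore dual to each
  other.\<close>

lemma trace_pairing:
  assumes "p \<in> {1..n}" "s \<in> steps n p q" "h \<in> H p q"
  shows "truncated_trace R n p (Comp T p q (n + 1 - p) (basis_vector R (p - 1 - s)) h) = sign R (n * p) \<otimes> h s"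
proof -
  have "p - 1 \<in> steps n p (n + 1 - p)" and "p - 1 - (p - 1 - s) = s"
    using assms(1,2) by (auto simp: steps_def)
  then show ?thesis
    using assms(3) finsum_conv_basis(2)[of h "p - 1 - s" "p - 1"] by (simp add: truncated_trace_def comp_apply)
qed

text \<open>Both traces test the same condition: the twisted factor has exponent
  \<open>p + s - p'\<close>, and adding \<open>t\<close> gives \<open>p - 1\<close> precisely when
  \<open>s + t = p' - 1\<close>.\<close>

lemma trace_comm_basis:
  assumes p: "p \<in> {1..n}" and p': "p' \<in> {1..n}"
    and s: "s \<in> steps n p' p" and t: "t \<in> steps n p (n + 1 - p')"
  shows "truncated_trace R n p' (Comp T p' p (n + 1 - p') (basis_vector R t) (basis_vector R s)) =
    truncated_trace R n p (Comp T p (n + 1 - p') (n + 1 - p) (truncated_serre R n p' p (basis_vector R s)) (basis_vector R t))"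
proof -
  let ?s = "p + s - p'"
  have s': "?s \<in> steps n (n + 1 - p') (n + 1 - p)" using p p' s by (auto simp: steps_def)
  \<comment> \<open>Here the sign in the trace does its work: passing from \<open>p'\<close> to
    \<open>p\<close> it absorbs the sign of the twist.\<close>
  have "even (n * p') = even (n * p + n * (p' + p))" by auto
  then have sg: "sign R (n * p') = sign R (n * p) \<otimes> sign R (n * (p' + p))"
    by (simp add: sign_add[symmetric] sign_cong)
  have iff: "s + t = p' - 1 \<longleftrightarrow> ?s + t = p - 1"
    using p p' s by (auto simp: steps_def)
  have in1: "s + t \<in> steps n p' (n + 1 - p')" if "s + t = p' - 1" using that p' by (auto simp: steps_def)
  have in2: "t + ?s \<in> steps n p (n + 1 - p)" if "?s + t = p - 1" using that p by (auto simp: steps_def)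
  have "Comp T p (n + 1 - p') (n + 1 - p) (truncated_serre R n p' p (basis_vector R s)) (basis_vector R t) =
    (\<lambda>i. sign R (n * (p' + p)) \<otimes> Comp T p (n + 1 - p') (n + 1 - p) (basis_vector R ?s) (basis_vector R t) i)"
    unfolding serre_basis[OF p' p s] by (rule comp_smult_left[OF sign_closed basis_H[OF t] basis_H[OF s']])
  moreover have "Comp T p' p (n + 1 - p') (basis_vector R t) (basis_vector R s) (p' - 1) =
      (if s + t = p' - 1 then \<one> else \<zero>)"
    unfolding comp_basis[OF s t] using in1 by (cases "s + t = p' - 1") (simp_all add: basis_vector_def)
  moreover have "Comp T p (n + 1 - p') (n + 1 - p) (basis_vector R ?s) (basis_vector R t) (p - 1) =
      (if s + t = p' - 1 then \<one> else \<zero>)"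
    unfolding comp_basis[OF t s'] using in2 iff
    by (cases "s + t = p' - 1") (simp_all add: basis_vector_def add.commute[of t])
  ultimately show ?thesis
    by (simp add: truncated_trace_def sg)
qed

lemma trace_comm:
  assumes p: "p \<in> {1..n}" and p': "p' \<in> {1..n}" and f: "f \<in> H p' p" and v: "v \<in> H p (n + 1 - p')"
  shows "truncated_trace R n p' (Comp T p' p (n + 1 - p') v f) =
    truncated_trace R n p (Comp T p (n + 1 - p') (n + 1 - p) (truncated_serre R n p' p f) v)"
proof -
  have 1: "truncated_trace R n p' (Comp T p' p (n + 1 - p') v (basis_vector R s)) =
    truncated_trace R n p (Comp T p (n + 1 - p') (n + 1 - p) (truncated_serre R n p' p (basis_vector R s)) v)"
    if s: "s \<in> steps n p' p" for s
    by (rule free_module_linear_ext[OF v module_ring_module linear_map_compose[OF comp_linear_left trace_linear]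
          linear_map_compose[OF comp_linear_right trace_linear]])
       (simp add: s, rule serre_closed[OF p' p basis_H[OF s]], rule trace_comm_basis[OF p p' s])
  show ?thesis
    by (rule free_module_linear_ext[OF f module_ring_module linear_map_compose[OF comp_linear_right[OF v] trace_linear]
          linear_map_compose[OF linear_map_compose[OF serre_linear[OF p' p] comp_linear_left[OF v]] trace_linear]])
       (rule 1)
qed

section \<open>The filtration by path length\<close>

lemma filtration_iff:
  "f \<in> truncated_filtration R n m p q \<longleftrightarrow>
    f \<in> H p q \<and> (\<forall>s. f s \<noteq> \<zero> \<longrightarrow> p + m \<le> q + 2 * s)"
  by (auto simp: truncated_filtration_def carrier_free_module_finite_iff)

text \<open>Lengths add: a nonzero coefficient of the product at \<open>s\<close> requires some
  \<open>i\<close> with \<open>f i\<close> and \<open>g (s - i)\<close> both nonzero, and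
  \<open>q\<close> cancels when the two length bounds are added.\<close>

lemma filtration_comp:
  assumes f: "f \<in> truncated_filtration R n m p q" and g: "g \<in> truncated_filtration R n k q r"
  shows "Comp T p q r g f \<in> truncated_filtration R n (m + k) p r"
proof -
  have fg: "f \<in> H p q" "g \<in> H q r" using assms by (simp_all add: filtration_iff)
  have "p + (m + k) \<le> r + 2 * s" if "Comp T p q r g f s \<noteq> \<zero>" for s
  proof (rule ccontr)
    assume lt: "\<not> p + (m + k) \<le> r + 2 * s"
    have "g (s - i) \<otimes> f i = \<zero>" if "i \<le> s" for i
    proof (cases "f i = \<zero>")
      case False
      then have "p + m \<le> q + 2 * i" using f by (simp add: filtration_iff)
      then have "\<not> q + k \<le> r + 2 * (s - i)" using lt that by linarith
      then have "g (s - i) = \<zero>" using g by (auto simp: filtration_iff)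
      then show ?thesis using fg by simp
    qed (use fg in simp)
    then have "(\<Oplus>i\<in>{..s}. g (s - i) \<otimes> f i) = (\<Oplus>i\<in>{..s}. \<zero>)"
      by (intro finsum_cong' refl) auto
    then show False using that by (simp add: comp_apply split: if_splits)
  qed
  then show ?thesis using fg by (simp add: filtration_iff)
qed

lemma H_support: "f \<in> H p q \<Longrightarrow> f s \<noteq> \<zero> \<Longrightarrow> p \<le> q + s \<and> s < p \<and> s + q \<le> n"
proof -
  assume "f \<in> H p q" "f s \<noteq> \<zero>"
  then have "s \<in> steps n p q" unfolding H_iff by blast
  then show ?thesis by (simp add: steps_def)
qed

lemma filtration_0: "truncated_filtration R n 0 p q = H p q"
  unfolding set_eq_iff filtration_iff by (auto dest: H_support)

lemma filtration_mono: "m \<le> k \<Longrightarrow> truncated_filtration R n k p q \<subseteq> truncated_filtration R n m p q"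
  by (force simp: filtration_iff)

text \<open>Paths of length 0 are trivial, hence between distinct vertices every path has length at
  least 1.\<close>

lemma filtration_1_off_diagonal: "p \<noteq> q \<Longrightarrow> truncated_filtration R n 1 p q = H p q"
  unfolding set_eq_iff filtration_iff by (auto dest: H_support)

lemma filtration_1_diagonal: "truncated_filtration R n 1 q q = {f \<in> H q q. f 0 = \<zero>}"
proof -
  have "1 \<le> s" if "f 0 = \<zero>" "f s \<noteq> \<zero>" for f :: "nat \<Rightarrow> 'k" and s
    using that by (cases s) auto
  then show ?thesis unfolding set_eq_iff filtration_iff by auto
qed

text \<open>Adding \<open>s < p\<close> and \<open>s + q \<le> n\<close> gives
  \<open>q + 2 * s < p + n\<close>, so no admissible walk reaches length \<open>n\<close>.\<close>

lemma filtration_n: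
  assumes "p \<in> {1..n}" shows "truncated_filtration R n n p q = {\<lambda>s. \<zero>}"
proof -
  have "f s = \<zero>" if "f \<in> truncated_filtration R n n p q" for f s
  proof (rule ccontr)
    assume "f s \<noteq> \<zero>"
    with that have "p + n \<le> q + 2 * s" and "s < p \<and> s + q \<le> n"
      by (auto simp: filtration_iff dest: H_support)
    then show False using assms by simp
  qed
  then have "truncated_filtration R n n p q \<subseteq> {\<lambda>s. \<zero>}"
    unfolding subset_iff singleton_iff by (blast intro: ext)
  moreover have "(\<lambda>s. \<zero>) \<in> truncated_filtration R n n p q" by (simp add: filtration_iff)
  ultimately show ?thesis by blast
qed

end

section \<open>Ideals, Serre functors and quotients of linear categories\<close>

lemma generated_ideal_least:
  assumes "two_sided_ideal R C J" and "\<And>p q. p \<in> Obj C \<Longrightarrow> q \<in> Obj C \<Longrightarrow> S p q \<subseteq> J p q"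
  shows "generated_ideal R C S p q \<subseteq> J p q"
  using assms unfolding generated_ideal_def by blast

lemma in_generated_idealI:
  assumes "\<And>J. two_sided_ideal R C J \<Longrightarrow> (\<And>p q. p \<in> Obj C \<Longrightarrow> q \<in> Obj C \<Longrightarrow> S p q \<subseteq> J p q) \<Longrightarrow> x \<in> J p q"
  shows "x \<in> generated_ideal R C S p q"
  using assms unfolding generated_ideal_def by blast

lemma two_sided_idealD:
  assumes "two_sided_ideal R C J"
  shows two_sided_ideal_submodule: "p \<in> Obj C \<Longrightarrow> q \<in> Obj C \<Longrightarrow> submodule (J p q) R (Hom C p q)"
    and two_sided_ideal_comp_left:
      "p \<in> Obj C \<Longrightarrow> q \<in> Obj C \<Longrightarrow> r \<in> Obj C \<Longrightarrow> f \<in> J p q \<Longrightarrow> g \<in> carrier (Hom C q r) \<Longrightarrow> Comp C p q r g f \<in> J p r"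
    and two_sided_ideal_comp_right:
      "p \<in> Obj C \<Longrightarrow> q \<in> Obj C \<Longrightarrow> r \<in> Obj C \<Longrightarrow> f \<in> carrier (Hom C p q) \<Longrightarrow> g \<in> J q r \<Longrightarrow> Comp C p q r g f \<in> J p r"
  using assms by (auto simp: two_sided_ideal_def)

lemma submoduleD:
  assumes "submodule N R M"
  shows submodule_sub: "x \<in> N \<Longrightarrow> x \<in> carrier M"
    and submodule_zero: "\<zero>\<^bsub>M\<^esub> \<in> N"
    and submodule_add: "x \<in> N \<Longrightarrow> y \<in> N \<Longrightarrow> x \<oplus>\<^bsub>M\<^esub> y \<in> N"
    and submodule_smult: "c \<in> carrier R \<Longrightarrow> x \<in> N \<Longrightarrow> c \<odot>\<^bsub>M\<^esub> x \<in> N"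
proof -
  interpret submodule N R M by fact
  show "x \<in> N \<Longrightarrow> x \<in> carrier M" using subset by auto
  show "\<zero>\<^bsub>M\<^esub> \<in> N" using one_closed by simp
  show "x \<in> N \<Longrightarrow> y \<in> N \<Longrightarrow> x \<oplus>\<^bsub>M\<^esub> y \<in> N" using m_closed by simp
  show "c \<in> carrier R \<Longrightarrow> x \<in> N \<Longrightarrow> c \<odot>\<^bsub>M\<^esub> x \<in> N" by (rule smult_closed)
qed

lemma submoduleI':
  assumes "module R M" and "N \<subseteq> carrier M" and "\<zero>\<^bsub>M\<^esub> \<in> N"
    and add: "\<And>x y. x \<in> N \<Longrightarrow> y \<in> N \<Longrightarrow> x \<oplus>\<^bsub>M\<^esub> y \<in> N"
    and smult: "\<And>c x. c \<in> carrier R \<Longrightarrow> x \<in> N \<Longrightarrow> c \<odot>\<^bsub>M\<^esub> x \<in> N"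
  shows "submodule N R M"
proof -
  interpret Module.module R M by fact
  have "\<ominus>\<^bsub>M\<^esub> x \<in> N" if "x \<in> N" for x
  proof -
    have "x \<in> carrier M" using that assms(2) by blast
    then have "\<ominus>\<^bsub>M\<^esub> x = (\<ominus>\<^bsub>R\<^esub> \<one>\<^bsub>R\<^esub>) \<odot>\<^bsub>M\<^esub> x" by (simp add: smult_l_minus)
    then show ?thesis using smult[OF _ that] by simp
  qed
  then show ?thesis using assms by (intro submoduleI) auto
qed

lemma submodule_image:
  assumes "module R M" "module R N" "linear_map R M N f" and "submodule K R M"
  shows "submodule (f ` K) R N"
proof (rule submoduleI')
  note K = submoduleD[OF assms(4)]
  show "f ` K \<subseteq> carrier N" using K(1) linear_map_closed[OF assms(3)] by auto
  show "\<zero>\<^bsub>N\<^esub> \<in> f ` K" using K(2) linear_map_zero[OF assms(1-3)] by (metis imageI)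
  show "x \<oplus>\<^bsub>N\<^esub> y \<in> f ` K" if "x \<in> f ` K" "y \<in> f ` K" for x y
    using that K(1,3) linear_map_add[OF assms(3), symmetric] by auto
  show "c \<odot>\<^bsub>N\<^esub> x \<in> f ` K" if "c \<in> carrier R" "x \<in> f ` K" for c x
    using that K(1,4) linear_map_smult[OF assms(3), symmetric] by auto
qed (rule assms)

lemma submodule_kernel:
  assumes "module R M" "module R N" "linear_map R M N f"
  shows "submodule {x \<in> carrier M. f x = \<zero>\<^bsub>N\<^esub>} R M"
proof -
  interpret M: Module.module R M by fact
  interpret N: Module.module R N by fact
  show ?thesis
    by (rule submoduleI'[OF assms(1)])
       (auto simp: linear_map_zero[OF assms] linear_map_add[OF assms(3)] linear_map_smult[OF assms(3)])
qed

lemma (in cring) submodule_free_module_mono: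
  assumes "X \<subseteq> Y"
  shows "submodule (carrier (free_module R X)) R (free_module R Y)"
proof (rule submoduleI'[OF module_free_module])
  show "carrier (free_module R X) \<subseteq> carrier (free_module R Y)"
  proof
    fix f assume f: "f \<in> carrier (free_module R X)"
    have "f x = \<zero>" if "x \<notin> Y" for x
      using free_module_apply_outside[OF f, of x] that assms by blast
    then show "f \<in> carrier (free_module R Y)" using f by (simp add: carrier_free_module_iff)
  qed
qed (auto simp: free_module_add_closed free_module_smult_closed, simp add: carrier_free_module_iff)

section \<open>Serre functors from involutions with a trace\<close>

context linear_category
begin

lemma comp_closed:
  assumes "p \<in> Obj C" "q \<in> Obj C" "r \<in> Obj C" "f \<in> carrier (Hom C p q)" "g \<in> carrier (Hom C q r)"
  shows "Comp C p q r g f \<in> carrier (Hom C p r)"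
  using linear_map_closed[OF comp_linear_left] assms by metis

text \<open>A successor power is a generated ideal and therefore contains zero, which leaves the
  upper bound to be checked.\<close>

lemma zero_ideal_power_Suc_subset:
  assumes "\<And>p q. p \<in> Obj C \<Longrightarrow> q \<in> Obj C \<Longrightarrow> ideal_power R C I (Suc m) p q \<subseteq> {\<zero>\<^bsub>Hom C p q\<^esub>}"
  shows "zero_ideal C (ideal_power R C I (Suc m))"
proof -
  have "\<zero>\<^bsub>Hom C p q\<^esub> \<in> ideal_power R C I (Suc m) p q" if "p \<in> Obj C" "q \<in> Obj C" for p q
    unfolding ideal_power.simps ideal_product_def
    by (intro in_generated_idealI submodule_zero[of _ R] two_sided_ideal_submodule that)
  then show ?thesis using assms unfolding zero_ideal_def by blast
qed

text \<open>The functor is its own inverse on the nose, so the identities serve as both natural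
  isomorphisms.\<close>

lemma involutive_imp_autoequivalence:
  assumes S: "linear_functor R C C S0 S1"
    and inv0: "\<And>p. p \<in> Obj C \<Longrightarrow> S0 (S0 p) = p"
    and inv1: "\<And>p q f. p \<in> Obj C \<Longrightarrow> q \<in> Obj C \<Longrightarrow> f \<in> carrier (Hom C p q) \<Longrightarrow> S1 (S0 p) (S0 q) (S1 p q f) = f"
  shows "linear_autoequivalence R C S0 S1"
proof -
  have "naturally_isomorphic C C (\<lambda>p. S0 (S0 p)) (\<lambda>p q f. S1 (S0 p) (S0 q) (S1 p q f)) (\<lambda>p. p) (\<lambda>p q f. f)"
    unfolding naturally_isomorphic_def
    by (intro exI[of _ "Ident C"])
       (auto simp: inv0 inv1 is_isomorphism_def ident_closed ident_left ident_right
         intro!: bexI[of _ "Ident C _"])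
  then show ?thesis unfolding linear_autoequivalence_def using S by blast
qed

text \<open>
  The trace \<open>t\<close> is a Frobenius form: \<open>(u, h) \<mapsto> t (u \<circ> h)\<close> is a perfect pairing, and the functor is
  its Nakayama twist, which is what makes the pairing natural.
\<close>

lemma serre_functor_of_trace:
  assumes S: "linear_functor R C C S0 S1"
    and inv0: "\<And>p. p \<in> Obj C \<Longrightarrow> S0 (S0 p) = p"
    and inv1: "\<And>p q f. p \<in> Obj C \<Longrightarrow> q \<in> Obj C \<Longrightarrow> f \<in> carrier (Hom C p q) \<Longrightarrow> S1 (S0 p) (S0 q) (S1 p q f) = f"
    and t: "\<And>p. p \<in> Obj C \<Longrightarrow> linear_map R (Hom C p (S0 p)) (ring_module R) (t p)"
    and comm: "\<And>p p' f v. p \<in> Obj C \<Longrightarrow> p' \<in> Obj C \<Longrightarrow> f \<in> carrier (Hom C p' p) \<Longrightarrow>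
      v \<in> carrier (Hom C p (S0 p')) \<Longrightarrow>
      t p' (Comp C p' p (S0 p') v f) = t p (Comp C p (S0 p') (S0 p) (S1 p' p f) v)"
    and nondeg: "\<And>p q h. p \<in> Obj C \<Longrightarrow> q \<in> Obj C \<Longrightarrow> h \<in> carrier (Hom C p q) \<Longrightarrow>
      (\<And>u. u \<in> carrier (Hom C q (S0 p)) \<Longrightarrow> t p (Comp C p q (S0 p) u h) = \<zero>\<^bsub>R\<^esub>) \<Longrightarrow> h = \<zero>\<^bsub>Hom C p q\<^esub>"
    and repr: "\<And>p q \<phi>. p \<in> Obj C \<Longrightarrow> q \<in> Obj C \<Longrightarrow> linear_map R (Hom C q (S0 p)) (ring_module R) \<phi> \<Longrightarrow>
      \<exists>h\<in>carrier (Hom C p q). \<forall>u\<in>carrier (Hom C q (S0 p)). t p (Comp C p q (S0 p) u h) = \<phi> u"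
  shows "serre_functor R C S0 S1"
proof -
  have S0: "S0 p \<in> Obj C" if "p \<in> Obj C" for p
    using S that by (simp add: linear_functor_def)
  have S1: "S1 p q f \<in> carrier (Hom C (S0 p) (S0 q))"
    if "p \<in> Obj C" "q \<in> Obj C" "f \<in> carrier (Hom C p q)" for p q f
    using S that by (auto simp: linear_functor_def dest: linear_map_closed)
  \<comment> \<open>The linear form \<open>u \<mapsto> t (u \<circ> h)\<close>, restricted to the
    hom module because elements of the dual are extensional.\<close>
  define \<eta> where "\<eta> = (\<lambda>p q h. \<lambda>u\<in>carrier (Hom C q (S0 p)). t p (Comp C p q (S0 p) u h))"
  have eta_mem: "\<eta> p q h \<in> carrier (dual_module R (Hom C q (S0 p)))"
    if pq: "p \<in> Obj C" "q \<in> Obj C" and h: "h \<in> carrier (Hom C p q)" for p q h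
  proof -
    have lin: "linear_map R (Hom C q (S0 p)) (ring_module R) (\<lambda>u. t p (Comp C p q (S0 p) u h))"
      by (rule linear_map_compose[OF comp_linear_left t]) (use pq h S0 in auto)
    interpret H: Module.module R "Hom C q (S0 p)" by (intro hom_module S0 pq)
    have "linear_map R (Hom C q (S0 p)) (ring_module R) (\<eta> p q h)"
      using linear_mapD[OF lin] by (intro linear_mapI) (simp_all add: \<eta>_def)
    then show ?thesis by (simp add: dual_module_def \<eta>_def)
  qed
  have eta_linear: "linear_map R (Hom C p q) (dual_module R (Hom C q (S0 p))) (\<eta> p q)"
    if pq: "p \<in> Obj C" "q \<in> Obj C" for p q
  proof (rule linear_mapI)
    have lin: "linear_map R (Hom C p q) (ring_module R) (\<lambda>h. t p (Comp C p q (S0 p) u h))"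
      if "u \<in> carrier (Hom C q (S0 p))" for u
      by (rule linear_map_compose[OF comp_linear_right t]) (use pq that S0 in auto)
    show "\<eta> p q (x \<oplus>\<^bsub>Hom C p q\<^esub> y) = \<eta> p q x \<oplus>\<^bsub>dual_module R (Hom C q (S0 p))\<^esub> \<eta> p q y"
      if "x \<in> carrier (Hom C p q)" "y \<in> carrier (Hom C p q)" for x y
      using linear_map_add[OF lin] that by (auto simp: dual_module_def \<eta>_def ring_module_def)
    show "\<eta> p q (c \<odot>\<^bsub>Hom C p q\<^esub> x) = c \<odot>\<^bsub>dual_module R (Hom C q (S0 p))\<^esub> \<eta> p q x"
      if "c \<in> carrier R" "x \<in> carrier (Hom C p q)" for c x
      using linear_map_smult[OF lin] that by (auto simp: dual_module_def \<eta>_def ring_module_def)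
  qed (rule eta_mem[OF pq])
  have eta_bij: "bij_betw (\<eta> p q) (carrier (Hom C p q)) (carrier (dual_module R (Hom C q (S0 p))))"
    if pq: "p \<in> Obj C" "q \<in> Obj C" for p q
    unfolding bij_betw_def
  proof
    interpret H: Module.module R "Hom C p q" by (intro hom_module pq)
    show "inj_on (\<eta> p q) (carrier (Hom C p q))"
    proof (rule inj_onI)
      fix h k assume hk: "h \<in> carrier (Hom C p q)" "k \<in> carrier (Hom C p q)" and eq: "\<eta> p q h = \<eta> p q k"
      \<comment> \<open>\<open>nondeg\<close> speaks of a single morphism that is orthogonal to
        everything, so it is applied to the difference.\<close>
      have "h \<ominus>\<^bsub>Hom C p q\<^esub> k = \<zero>\<^bsub>Hom C p q\<^esub>"
      proof (rule nondeg[OF pq])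
        fix u assume u: "u \<in> carrier (Hom C q (S0 p))"
        have lin: "linear_map R (Hom C p q) (ring_module R) (\<lambda>h. t p (Comp C p q (S0 p) u h))"
          by (rule linear_map_compose[OF comp_linear_right t]) (use pq u S0 in auto)
        interpret N: Module.module R "ring_module R" by (rule module_ring_module)
        have "t p (Comp C p q (S0 p) u (h \<ominus>\<^bsub>Hom C p q\<^esub> k)) =
            t p (Comp C p q (S0 p) u h) \<ominus>\<^bsub>ring_module R\<^esub> t p (Comp C p q (S0 p) u k)"
          by (rule linear_map_minus[OF H.module_axioms module_ring_module lin hk])
        also have "t p (Comp C p q (S0 p) u h) = t p (Comp C p q (S0 p) u k)"
          using fun_cong[OF eq, of u] u by (simp add: \<eta>_def)
        also have "\<dots> \<ominus>\<^bsub>ring_module R\<^esub> \<dots> = \<zero>\<^bsub>R\<^esub>"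
          using linear_map_closed[OF lin hk(2)] N.r_neg by (simp add: N.minus_eq) (simp add: ring_module_def)
        finally show "t p (Comp C p q (S0 p) u (h \<ominus>\<^bsub>Hom C p q\<^esub> k)) = \<zero>\<^bsub>R\<^esub>" .
      qed (use hk in simp)
      moreover have "h = (h \<ominus>\<^bsub>Hom C p q\<^esub> k) \<oplus>\<^bsub>Hom C p q\<^esub> k"
        using hk by (simp add: H.minus_eq H.a_assoc H.l_neg)
      ultimately show "h = k" using hk by simp
    qed
    show "\<eta> p q ` carrier (Hom C p q) = carrier (dual_module R (Hom C q (S0 p)))"
    proof (intro equalityI subsetI)
      fix \<phi> assume \<phi>: "\<phi> \<in> carrier (dual_module R (Hom C q (S0 p)))"
      then obtain h where h: "h \<in> carrier (Hom C p q)"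
        "\<forall>u\<in>carrier (Hom C q (S0 p)). t p (Comp C p q (S0 p) u h) = \<phi> u"
        using repr[OF pq, of \<phi>] by (auto simp: dual_module_def)
      have "\<eta> p q h = \<phi>"
        using h(2) \<phi> by (auto simp: \<eta>_def dual_module_def extensional_def fun_eq_iff)
      then show "\<phi> \<in> \<eta> p q ` carrier (Hom C p q)" using h(1) by blast
    qed (use eta_mem[OF pq] in auto)
  qed
  have natural: "\<eta> p' q' (Comp C p' p q' (Comp C p q q' g h) f) u =
      \<eta> p q h (Comp C q (S0 p') (S0 p) (S1 p' p f) (Comp C q q' (S0 p') u g))"
    if obj: "p \<in> Obj C" "p' \<in> Obj C" "q \<in> Obj C" "q' \<in> Obj C"
      and f: "f \<in> carrier (Hom C p' p)" and h: "h \<in> carrier (Hom C p q)"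
      and g: "g \<in> carrier (Hom C q q')" and u: "u \<in> carrier (Hom C q' (S0 p'))" for p p' q q' f g h u
  proof -
    let ?v = "Comp C p q' (S0 p') u (Comp C p q q' g h)"
    note s = S0[OF obj(1)] S0[OF obj(2)]
    have gh: "Comp C p q q' g h \<in> carrier (Hom C p q')" by (intro comp_closed obj h g)
    have v: "?v \<in> carrier (Hom C p (S0 p'))" by (intro comp_closed obj s u gh)
    have Sf: "S1 p' p f \<in> carrier (Hom C (S0 p') (S0 p))" by (intro S1 obj f)
    have ug: "Comp C q q' (S0 p') u g \<in> carrier (Hom C q (S0 p'))" by (intro comp_closed obj s u g)
    have "\<eta> p' q' (Comp C p' p q' (Comp C p q q' g h) f) u = t p' (Comp C p' p (S0 p') ?v f)"
      using u comp_assoc[OF obj(2,1,4) s(2) f gh u] by (simp add: \<eta>_def)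
    \<comment> \<open>The one step beyond associativity: \<open>f\<close> travels around the trace
      from the right end to the left and is twisted on the way.\<close>
    also have "\<dots> = t p (Comp C p (S0 p') (S0 p) (S1 p' p f) ?v)"
      by (rule comm[OF obj(1,2) f v])
    also have "Comp C p (S0 p') (S0 p) (S1 p' p f) ?v =
        Comp C p q (S0 p) (Comp C q (S0 p') (S0 p) (S1 p' p f) (Comp C q q' (S0 p') u g)) h"
      using comp_assoc[OF obj(1,3,4) s(2) h g u] comp_assoc[OF obj(1,3) s(2,1) h ug Sf] by simp
    also have "t p \<dots> = \<eta> p q h (Comp C q (S0 p') (S0 p) (S1 p' p f) (Comp C q q' (S0 p') u g))"
      using comp_closed[OF obj(3) s(2,1) ug Sf] by (simp add: \<eta>_def)
    finally show ?thesis .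
  qed
  have "linear_autoequivalence R C S0 S1"
    by (rule involutive_imp_autoequivalence[OF S inv0 inv1])
  then show ?thesis
    unfolding serre_functor_def
    by (intro conjI exI[of _ \<eta>] ballI) (use eta_linear eta_bij natural in auto)
qed

end

section \<open>Transport of structure along linear bijections\<close>

locale linear_cat_isomorphism = linear_category R C
  for R :: "('k, 'z) ring_scheme" (structure) and C :: "('o, 'k, 'm) linear_cat" +
  fixes D :: "('o, 'k, 'l) linear_cat" and \<theta> :: "'o \<Rightarrow> 'o \<Rightarrow> 'm \<Rightarrow> 'l"
  assumes Obj_eq: "Obj D = Obj C"
    and bij: "\<lbrakk>p \<in> Obj C; q \<in> Obj C\<rbrakk> \<Longrightarrow> bij_betw (\<theta> p q) (carrier (Hom C p q)) (carrier (Hom D p q))"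
    and linear: "\<lbrakk>p \<in> Obj C; q \<in> Obj C\<rbrakk> \<Longrightarrow> linear_map R (Hom C p q) (Hom D p q) (\<theta> p q)"
    and zero: "\<lbrakk>p \<in> Obj C; q \<in> Obj C\<rbrakk> \<Longrightarrow> \<theta> p q \<zero>\<^bsub>Hom C p q\<^esub> = \<zero>\<^bsub>Hom D p q\<^esub>"
    and ident: "q \<in> Obj C \<Longrightarrow> \<theta> q q (Ident C q) = Ident D q"
    and comp: "\<lbrakk>p \<in> Obj C; q \<in> Obj C; r \<in> Obj C; f \<in> carrier (Hom C p q); g \<in> carrier (Hom C q r)\<rbrakk>
      \<Longrightarrow> \<theta> p r (Comp C p q r g f) = Comp D p q r (\<theta> q r g) (\<theta> p q f)"
begin

lemma iso_closed: "\<lbrakk>p \<in> Obj C; q \<in> Obj C; f \<in> carrier (Hom C p q)\<rbrakk> \<Longrightarrow> \<theta> p q f \<in> carrier (Hom D p q)"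
  using linear_map_closed[OF linear] .

lemma iso_surj:
  assumes "p \<in> Obj C" "q \<in> Obj C" "x \<in> carrier (Hom D p q)"
  obtains f where "f \<in> carrier (Hom C p q)" "x = \<theta> p q f"
  using bij[OF assms(1,2)] assms(3) by (auto simp: bij_betw_def)

lemma module_image: "\<lbrakk>p \<in> Obj C; q \<in> Obj C\<rbrakk> \<Longrightarrow> module R (Hom D p q)"
  by (rule module_transport[OF hom_module bij zero linear])

lemmas iso_add = linear_map_add[OF linear]
lemmas iso_smult = linear_map_smult[OF linear]

text \<open>About \<open>D\<close> only the operations are known, so every law is pulled back:
  morphisms of \<open>D\<close> are written as images, and the law of \<open>C\<close> is applied to
  their preimages.\<close>

lemma linear_category_image: "linear_category R D"
proof (intro linear_category.intro linear_category_axioms.intro is_cring, unfold Obj_eq)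
  fix q assume "q \<in> Obj C"
  then show "Ident D q \<in> carrier (Hom D q q)"
    using iso_closed[OF _ _ ident_closed] by (simp add: ident[symmetric])
next
  fix p q r f assume obj: "p \<in> Obj C" "q \<in> Obj C" "r \<in> Obj C" and "f \<in> carrier (Hom D p q)"
  then obtain a where a: "a \<in> carrier (Hom C p q)" "f = \<theta> p q a" by (elim iso_surj[OF obj(1,2)])
  note L = comp_linear_left[OF obj a(1)]
  show "linear_map R (Hom D q r) (Hom D p r) (\<lambda>g. Comp D p q r g f)"
  proof (rule linear_mapI)
    fix g assume "g \<in> carrier (Hom D q r)"
    then obtain b where b: "b \<in> carrier (Hom C q r)" "g = \<theta> q r b" by (elim iso_surj[OF obj(2,3)])
    then show "Comp D p q r g f \<in> carrier (Hom D p r)"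
      using a obj by (simp add: comp[symmetric] iso_closed comp_closed)
  next
    fix g h assume "g \<in> carrier (Hom D q r)" "h \<in> carrier (Hom D q r)"
    then obtain b c where b: "b \<in> carrier (Hom C q r)" "g = \<theta> q r b"
      and c: "c \<in> carrier (Hom C q r)" "h = \<theta> q r c" by (elim iso_surj[OF obj(2,3)])
    interpret M: Module.module R "Hom C q r" by (intro hom_module obj)
    show "Comp D p q r (g \<oplus>\<^bsub>Hom D q r\<^esub> h) f = Comp D p q r g f \<oplus>\<^bsub>Hom D p r\<^esub> Comp D p q r h f"
      using a b c obj by (simp add: comp[symmetric] iso_add[symmetric] comp_closed linear_map_add[OF L])
  next
    fix k g assume k: "k \<in> carrier R" and "g \<in> carrier (Hom D q r)"
    then obtain b where b: "b \<in> carrier (Hom C q r)" "g = \<theta> q r b" by (elim iso_surj[OF obj(2,3)])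
    interpret M: Module.module R "Hom C q r" by (intro hom_module obj)
    show "Comp D p q r (k \<odot>\<^bsub>Hom D q r\<^esub> g) f = k \<odot>\<^bsub>Hom D p r\<^esub> Comp D p q r g f"
      using a b k obj by (simp add: comp[symmetric] iso_smult[symmetric] comp_closed linear_map_smult[OF L])
  qed
next
  fix p q r g assume obj: "p \<in> Obj C" "q \<in> Obj C" "r \<in> Obj C" and "g \<in> carrier (Hom D q r)"
  then obtain a where a: "a \<in> carrier (Hom C q r)" "g = \<theta> q r a" by (elim iso_surj[OF obj(2,3)])
  note L = comp_linear_right[OF obj a(1)]
  show "linear_map R (Hom D p q) (Hom D p r) (\<lambda>f. Comp D p q r g f)"
  proof (rule linear_mapI)
    fix f assume "f \<in> carrier (Hom D p q)"
    then obtain b where b: "b \<in> carrier (Hom C p q)" "f = \<theta> p q b" by (elim iso_surj[OF obj(1,2)])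
    then show "Comp D p q r g f \<in> carrier (Hom D p r)"
      using a obj by (simp add: comp[symmetric] iso_closed comp_closed)
  next
    fix f h assume "f \<in> carrier (Hom D p q)" "h \<in> carrier (Hom D p q)"
    then obtain b c where b: "b \<in> carrier (Hom C p q)" "f = \<theta> p q b"
      and c: "c \<in> carrier (Hom C p q)" "h = \<theta> p q c" by (elim iso_surj[OF obj(1,2)])
    interpret M: Module.module R "Hom C p q" by (intro hom_module obj)
    show "Comp D p q r g (f \<oplus>\<^bsub>Hom D p q\<^esub> h) = Comp D p q r g f \<oplus>\<^bsub>Hom D p r\<^esub> Comp D p q r g h"
      using a b c obj by (simp add: comp[symmetric] iso_add[symmetric] comp_closed linear_map_add[OF L])
  next
    fix k f assume k: "k \<in> carrier R" and "f \<in> carrier (Hom D p q)"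
    then obtain b where b: "b \<in> carrier (Hom C p q)" "f = \<theta> p q b" by (elim iso_surj[OF obj(1,2)])
    interpret M: Module.module R "Hom C p q" by (intro hom_module obj)
    show "Comp D p q r g (k \<odot>\<^bsub>Hom D p q\<^esub> f) = k \<odot>\<^bsub>Hom D p r\<^esub> Comp D p q r g f"
      using a b k obj by (simp add: comp[symmetric] iso_smult[symmetric] comp_closed linear_map_smult[OF L])
  qed
next
  fix p q r s f g h
  assume obj: "p \<in> Obj C" "q \<in> Obj C" "r \<in> Obj C" "s \<in> Obj C"
    and "f \<in> carrier (Hom D p q)" "g \<in> carrier (Hom D q r)" "h \<in> carrier (Hom D r s)"
  then obtain a b c where "a \<in> carrier (Hom C p q)" "f = \<theta> p q a" "b \<in> carrier (Hom C q r)" "g = \<theta> q r b"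
      "c \<in> carrier (Hom C r s)" "h = \<theta> r s c" by (metis iso_surj)
  then show "Comp D p q s (Comp D q r s h g) f = Comp D p r s h (Comp D p q r g f)"
    using obj by (simp add: comp[symmetric] comp_closed comp_assoc)
next
  fix p q f assume obj: "p \<in> Obj C" "q \<in> Obj C" and "f \<in> carrier (Hom D p q)"
  then obtain a where "a \<in> carrier (Hom C p q)" "f = \<theta> p q a" by (elim iso_surj[OF obj])
  then show "Comp D p q q (Ident D q) f = f" and "Comp D p p q f (Ident D p) = f"
    using obj by (simp_all add: ident[symmetric] comp[symmetric] ident_closed ident_left ident_right)
qed (rule module_image)

lemma two_sided_ideal_image:
  assumes "two_sided_ideal R C J" shows "two_sided_ideal R D (\<lambda>p q. \<theta> p q ` J p q)"
  unfolding two_sided_ideal_def Obj_eq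
proof (intro conjI ballI)
  note J = two_sided_idealD[OF assms]
  fix p q assume obj: "p \<in> Obj C" "q \<in> Obj C"
  then show "submodule (\<theta> p q ` J p q) R (Hom D p q)"
    by (intro submodule_image[OF hom_module module_image linear] J)
  fix r assume r: "r \<in> Obj C"
  {
    fix f g assume "f \<in> \<theta> p q ` J p q" "g \<in> carrier (Hom D q r)"
    then obtain a b where "a \<in> J p q" "f = \<theta> p q a" "b \<in> carrier (Hom C q r)" "g = \<theta> q r b"
      by (metis imageE iso_surj obj(2) r)
    then show "Comp D p q r g f \<in> \<theta> p r ` J p r"
      using obj r J(2)[OF obj r] submodule_sub[OF J(1)[OF obj]] by (auto simp: comp[symmetric])
  next
    fix f g assume "f \<in> carrier (Hom D p q)" "g \<in> \<theta> q r ` J q r"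
    then obtain a b where "a \<in> carrier (Hom C p q)" "f = \<theta> p q a" "b \<in> J q r" "g = \<theta> q r b"
      by (metis imageE iso_surj obj)
    then show "Comp D p q r g f \<in> \<theta> p r ` J p r"
      using obj r J(3)[OF obj r] submodule_sub[OF J(1)[OF obj(2) r]] by (auto simp: comp[symmetric])
  }
qed

end

text \<open>The setting of the first isomorphism theorem: a full functor that fixes the objects
  identifies its target with the quotient by its kernel. Of \<open>C\<close> only closure and the
  module structure of the hom sets are asked; the category laws of the quotient are inherited from
  \<open>D\<close>.\<close>

locale full_functor = D: linear_category R D
  for R :: "('k, 'z) ring_scheme" (structure) and D :: "('o, 'k, 'l) linear_cat" +
  fixes C :: "('o, 'k, 'm) linear_cat" and F :: "'o \<Rightarrow> 'o \<Rightarrow> 'm \<Rightarrow> 'l" and I :: "'o \<Rightarrow> 'o \<Rightarrow> 'm set"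
  assumes Obj_eq: "Obj D = Obj C"
    and C_module: "\<lbrakk>p \<in> Obj C; q \<in> Obj C\<rbrakk> \<Longrightarrow> module R (Hom C p q)"
    and C_ident_closed: "q \<in> Obj C \<Longrightarrow> Ident C q \<in> carrier (Hom C q q)"
    and C_comp_closed: "\<lbrakk>p \<in> Obj C; q \<in> Obj C; r \<in> Obj C; f \<in> carrier (Hom C p q); g \<in> carrier (Hom C q r)\<rbrakk>
      \<Longrightarrow> Comp C p q r g f \<in> carrier (Hom C p r)"
    and F_linear: "\<lbrakk>p \<in> Obj C; q \<in> Obj C\<rbrakk> \<Longrightarrow> linear_map R (Hom C p q) (Hom D p q) (F p q)"
    and F_surj: "\<lbrakk>p \<in> Obj C; q \<in> Obj C; d \<in> carrier (Hom D p q)\<rbrakk> \<Longrightarrow> \<exists>f\<in>carrier (Hom C p q). F p q f = d"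
    and F_ident: "q \<in> Obj C \<Longrightarrow> F q q (Ident C q) = Ident D q"
    and F_comp: "\<lbrakk>p \<in> Obj C; q \<in> Obj C; r \<in> Obj C; f \<in> carrier (Hom C p q); g \<in> carrier (Hom C q r)\<rbrakk>
      \<Longrightarrow> F p r (Comp C p q r g f) = Comp D p q r (F q r g) (F p q f)"
    and kernel: "\<lbrakk>p \<in> Obj C; q \<in> Obj C\<rbrakk> \<Longrightarrow> I p q = {f \<in> carrier (Hom C p q). F p q f = \<zero>\<^bsub>Hom D p q\<^esub>}"
begin

text \<open>A coset of the kernel is the full preimage of a morphism of \<open>D\<close>. The
  isomorphism is therefore taken in the direction from \<open>D\<close> to the quotient, where
  representatives do not have to be chosen.\<close>

definition fibre :: "'o \<Rightarrow> 'o \<Rightarrow> 'l \<Rightarrow> 'm set" where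
  "fibre p q d = {f \<in> carrier (Hom C p q). F p q f = d}"

lemma ideal_class_eq_fibre:
  assumes pq: "p \<in> Obj C" "q \<in> Obj C" and f: "f \<in> carrier (Hom C p q)"
  shows "ideal_class C I p q f = fibre p q (F p q f)"
proof -
  interpret C: Module.module R "Hom C p q" by (rule C_module[OF pq])
  interpret N: Module.module R "Hom D p q" by (rule D.hom_module) (use pq Obj_eq in auto)
  note lin = F_linear[OF pq]
  have "\<exists>h\<in>I p q. g = h \<oplus>\<^bsub>Hom C p q\<^esub> f" if g: "g \<in> carrier (Hom C p q)" "F p q g = F p q f" for g
  proof
    have "F p q (g \<ominus>\<^bsub>Hom C p q\<^esub> f) = \<zero>\<^bsub>Hom D p q\<^esub>"
      using linear_map_minus[OF C_module[OF pq] N.module_axioms lin g(1) f] g(2) linear_map_closed[OF lin f]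
      by (simp add: N.minus_eq N.r_neg)
    then show "g \<ominus>\<^bsub>Hom C p q\<^esub> f \<in> I p q" using g f by (simp add: kernel pq)
    show "g = (g \<ominus>\<^bsub>Hom C p q\<^esub> f) \<oplus>\<^bsub>Hom C p q\<^esub> f"
      using g f by (simp add: C.minus_eq C.a_assoc C.l_neg)
  qed
  then show ?thesis
    using f linear_map_closed[OF lin f]
    by (auto simp: ideal_class_def a_r_coset_def r_coset_def fibre_def kernel pq linear_map_add[OF lin])
qed

lemma fibre_nonempty: "\<lbrakk>p \<in> Obj C; q \<in> Obj C; d \<in> carrier (Hom D p q)\<rbrakk> \<Longrightarrow> \<exists>f. f \<in> fibre p q d"
  using F_surj[of p q d] by (auto simp: fibre_def)

lemma isomorphism_quotient: "linear_cat_isomorphism R D (quotient_category C I) fibre"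
proof (intro linear_cat_isomorphism.intro linear_cat_isomorphism_axioms.intro D.linear_category_axioms, unfold Obj_eq)
  let ?Q = "quotient_category C I"
  show "Obj ?Q = Obj C" by (simp add: quotient_category_def)
  fix p q assume pq: "p \<in> Obj C" "q \<in> Obj C"
  interpret C: Module.module R "Hom C p q" by (rule C_module[OF pq])
  interpret N: Module.module R "Hom D p q" by (rule D.hom_module) (use pq Obj_eq in auto)
  note lin = F_linear[OF pq]
  have carrier: "carrier (Hom ?Q p q) = fibre p q ` carrier (Hom D p q)"
  proof -
    have "carrier (Hom ?Q p q) = (\<lambda>f. ideal_class C I p q f) ` carrier (Hom C p q)"
      by (auto simp: quotient_category_def quotient_module_def A_RCOSETS_def RCOSETS_def ideal_class_def
          a_r_coset_def)
    also have "\<dots> = (\<lambda>f. fibre p q (F p q f)) ` carrier (Hom C p q)"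
      by (simp add: ideal_class_eq_fibre pq)
    also have "\<dots> = fibre p q ` carrier (Hom D p q)"
      using F_surj[OF pq] linear_map_closed[OF lin] by (auto simp: image_iff)
    finally show ?thesis .
  qed
  have "inj_on (fibre p q) (carrier (Hom D p q))"
  proof (rule inj_onI)
    fix c d assume "c \<in> carrier (Hom D p q)" "fibre p q c = fibre p q d"
    then obtain f where "f \<in> fibre p q c" "f \<in> fibre p q d" using fibre_nonempty[OF pq] by blast
    then show "c = d" by (simp add: fibre_def)
  qed
  then show "bij_betw (fibre p q) (carrier (Hom D p q)) (carrier (Hom ?Q p q))"
    by (simp add: bij_betw_def carrier)
  show "linear_map R (Hom D p q) (Hom ?Q p q) (fibre p q)"
  proof (rule linear_mapI)
    fix c d assume c: "c \<in> carrier (Hom D p q)" and d: "d \<in> carrier (Hom D p q)"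
    \<comment> \<open>Any lift \<open>a\<close> of \<open>c\<close> will do: the remainder of
      \<open>f\<close> after subtracting \<open>a\<close> lies over \<open>d\<close>.\<close>
    have "\<exists>a\<in>fibre p q c. \<exists>b\<in>fibre p q d. f = a \<oplus>\<^bsub>Hom C p q\<^esub> b"
      if f: "f \<in> carrier (Hom C p q)" "F p q f = c \<oplus>\<^bsub>Hom D p q\<^esub> d" for f
    proof -
      obtain a where a: "a \<in> fibre p q c" using fibre_nonempty[OF pq c] by blast
      then have a': "a \<in> carrier (Hom C p q)" "F p q a = c" by (auto simp: fibre_def)
      have "F p q (f \<ominus>\<^bsub>Hom C p q\<^esub> a) = d"
        using linear_map_minus[OF C_module[OF pq] N.module_axioms lin f(1) a'(1)] f(2) a'(2) c d
        by (simp add: N.minus_eq N.a_comm[of c d] N.a_assoc N.r_neg)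
      then have "f \<ominus>\<^bsub>Hom C p q\<^esub> a \<in> fibre p q d" using f a' by (simp add: fibre_def)
      moreover have "f = a \<oplus>\<^bsub>Hom C p q\<^esub> (f \<ominus>\<^bsub>Hom C p q\<^esub> a)"
        using f a' by (simp add: C.minus_eq C.a_comm[of a] C.a_assoc C.l_neg)
      ultimately show ?thesis using a by blast
    qed
    then show "fibre p q (c \<oplus>\<^bsub>Hom D p q\<^esub> d) = fibre p q c \<oplus>\<^bsub>Hom ?Q p q\<^esub> fibre p q d"
      by (auto simp: quotient_category_def quotient_module_def set_add_def set_mult_def fibre_def
          linear_map_add[OF lin])
  next
    fix k d assume k: "k \<in> carrier R" and d: "d \<in> carrier (Hom D p q)"
    have "ideal_class C I p q (k \<odot>\<^bsub>Hom C p q\<^esub> f) = fibre p q (k \<odot>\<^bsub>Hom D p q\<^esub> d)" if "f \<in> fibre p q d" for f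
      using that k by (simp add: fibre_def[of p q d] ideal_class_eq_fibre pq) (simp add: linear_map_smult[OF lin] fibre_def)
    \<comment> \<open>A union over a constant family; fullness makes its index set nonempty.\<close>
    then have "(\<Union>f\<in>fibre p q d. ideal_class C I p q (k \<odot>\<^bsub>Hom C p q\<^esub> f)) = fibre p q (k \<odot>\<^bsub>Hom D p q\<^esub> d)"
      using fibre_nonempty[OF pq d] by auto
    then show "fibre p q (k \<odot>\<^bsub>Hom D p q\<^esub> d) = k \<odot>\<^bsub>Hom ?Q p q\<^esub> fibre p q d"
      by (simp add: quotient_category_def quotient_module_def ideal_class_def)
  qed (simp add: carrier)
  show "fibre p q \<zero>\<^bsub>Hom D p q\<^esub> = \<zero>\<^bsub>Hom ?Q p q\<^esub>"
    by (simp add: quotient_category_def quotient_module_def fibre_def kernel pq)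
next
  fix q assume "q \<in> Obj C"
  then show "fibre q q (Ident D q) = Ident (quotient_category C I) q"
    by (simp add: quotient_category_def ideal_class_eq_fibre C_ident_closed F_ident)
next
  fix p q r d e
  assume obj: "p \<in> Obj C" "q \<in> Obj C" "r \<in> Obj C"
    and d: "d \<in> carrier (Hom D p q)" and e: "e \<in> carrier (Hom D q r)"
  have "ideal_class C I p r (Comp C p q r g f) = fibre p r (Comp D p q r e d)"
    if "g \<in> fibre q r e" "f \<in> fibre p q d" for f g
    using that obj by (subst ideal_class_eq_fibre) (auto simp: fibre_def C_comp_closed F_comp)
  \<comment> \<open>As for scalar multiples, all representatives contribute the same coset, and
    there are some by fullness.\<close>
  then have "(\<Union>g\<in>fibre q r e. \<Union>f\<in>fibre p q d. ideal_class C I p r (Comp C p q r g f)) = fibre p r (Comp D p q r e d)"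
    using fibre_nonempty[OF obj(1,2) d] fibre_nonempty[OF obj(2,3) e] by auto
  then show "fibre p r (Comp D p q r e d) = Comp (quotient_category C I) p q r (fibre q r e) (fibre p q d)"
    by (simp add: quotient_category_def)
qed

end

section \<open>Rearranging walks by the mesh relations\<close>

primrec stars :: "double_arrow list \<Rightarrow> nat" where
  "stars [] = 0"
| "stars (e # w) = (case e of Arr _ \<Rightarrow> stars w | Star _ \<Rightarrow> Suc (stars w))"

text \<open>
  Rescaling \<open>a\<^sub>q\<^sup>*\<close> by \<open>(-1)\<^sup>q\<close> turns the mesh relations into commutativity relations; the sign of a
  path is therefore determined by the sum of the indices of its downward arrows.
\<close>

primrec weight :: "double_arrow list \<Rightarrow> nat" where
  "weight [] = 0"
| "weight (e # w) = (case e of Arr _ \<Rightarrow> weight w | Star q \<Rightarrow> q + weight w)"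

lemma stars_append [simp]: "stars (u @ v) = stars u + stars v"
  by (induction u) (auto split: double_arrow.splits)

lemma weight_append [simp]: "weight (u @ v) = weight u + weight v"
  by (induction u) (auto split: double_arrow.splits)

abbreviation walk :: "nat \<Rightarrow> nat \<Rightarrow> double_arrow list \<Rightarrow> nat \<Rightarrow> bool" where
  "walk n p w q \<equiv> pre_digraph.awalk (double_A n) p w q"

lemma walk_simps [simp]:
  "walk n p [] q \<longleftrightarrow> p = q \<and> p \<in> {1..n}"
  "walk n p (Arr i # w) q \<longleftrightarrow> i = p \<and> 1 \<le> p \<and> p < n \<and> walk n (Suc p) w q"
  "walk n p (Star i # w) q \<longleftrightarrow> p = Suc i \<and> 1 \<le> i \<and> i < n \<and> walk n i w q"
  by (auto simp: pre_digraph.awalk_def pre_digraph.cas.simps double_A_def)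

lemma walk_endpoints: "walk n p w q \<Longrightarrow> p \<in> {1..n} \<and> q \<in> {1..n}"
proof (induction w arbitrary: p)
  case (Cons e w)
  then show ?case by (cases e) auto
qed simp

lemma walk_append: "walk n p (u @ v) r \<longleftrightarrow> (\<exists>q. walk n p u q \<and> walk n q v r)"
proof (induction u arbitrary: p)
  case Nil
  then show ?case using walk_endpoints by auto
next
  case (Cons e u)
  then show ?case by (cases e) auto
qed

text \<open>Every upward arrow raises the vertex by one and every downward arrow lowers it by one.
  The equation is additive to avoid truncation; the inequality ensures that the number
  \<open>q + stars w - p\<close> of upward arrows is a genuine difference.\<close>

lemma walk_length: "walk n p w q \<Longrightarrow> length w + p = q + 2 * stars w \<and> p \<le> q + stars w"
proof (induction w arbitrary: p)
  case (Cons e w)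
  then show ?case by (cases e) force+
qed simp

lemma set_walk: "walk n p w q \<Longrightarrow> set w \<subseteq> Arr ` {1..<n} \<union> Star ` {1..<n}"
  by (simp add: pre_digraph.awalk_def double_A_def)

text \<open>\<open>walk_length\<close> provides \<open>p \<le> q + stars u\<close> and
  \<open>q \<le> r + stars v\<close>, which carry the bounds over to the parts. It serves in
  contrapositive form: an inadmissible factor makes the whole walk inadmissible.\<close>

lemma steps_append:
  assumes "walk n p u q" "walk n q v r" "stars (u @ v) \<in> steps n p r"
  shows "stars u \<in> steps n p q" and "stars v \<in> steps n q r"
  using assms walk_length[OF assms(1)] walk_length[OF assms(2)] by (auto simp: steps_def)

text \<open>The mesh relation at the inner vertex \<open>Suc q\<close> stripped of its coefficients:
  the detour below the vertex is exchanged with the one above. The index of the downward arrow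
  changes by one, so \<open>weight\<close> accounts for the minus sign. The words need not be walks,
  but the relation respects this property.\<close>

inductive mesh_equiv :: "nat \<Rightarrow> double_arrow list \<Rightarrow> double_arrow list \<Rightarrow> bool" for n where
  refl: "mesh_equiv n w w"
| sym: "mesh_equiv n w w' \<Longrightarrow> mesh_equiv n w' w"
| trans: "mesh_equiv n w w' \<Longrightarrow> mesh_equiv n w' w'' \<Longrightarrow> mesh_equiv n w w''"
| swap: "1 \<le> q \<Longrightarrow> Suc q < n \<Longrightarrow> mesh_equiv n (u @ [Star q, Arr q] @ v) (u @ [Arr (Suc q), Star (Suc q)] @ v)"

text \<open>The relations at the vertices \<open>1\<close> and \<open>n\<close>, where one of the
  two detours would leave the quiver and the other one must vanish.\<close>

inductive mesh_null :: "nat \<Rightarrow> double_arrow list \<Rightarrow> bool" for n where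
  bottom: "mesh_null n (u @ [Arr 1, Star 1] @ v)"
| top: "mesh_null n (u @ [Star (n - 1), Arr (n - 1)] @ v)"
| equiv: "mesh_equiv n w w' \<Longrightarrow> mesh_null n w' \<Longrightarrow> mesh_null n w"

lemma mesh_equiv_context: "mesh_equiv n w w' \<Longrightarrow> mesh_equiv n (u @ w @ v) (u @ w' @ v)"
proof (induction rule: mesh_equiv.induct)
  case (swap q u' v')
  then show ?case using mesh_equiv.swap[of q n "u @ u'" "v' @ v"] by simp
qed (auto intro: mesh_equiv.intros)

lemma mesh_null_context: "mesh_null n w \<Longrightarrow> mesh_null n (u @ w @ v)"
proof (induction rule: mesh_null.induct)
  case (bottom u' v')
  then show ?case using mesh_null.bottom[of n "u @ u'" "v' @ v"] by simp
next
  case (top u' v')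
  then show ?case using mesh_null.top[of n "u @ u'" "v' @ v"] by simp
next
  case (equiv w w')
  then show ?case using mesh_equiv_context mesh_null.equiv by blast
qed

section \<open>Normal forms: all down, then up\<close>

definition up :: "nat \<Rightarrow> nat \<Rightarrow> double_arrow list" where
  "up a b = map Arr [a..<b]"

text \<open>A downward arrow carries the index of its lower end, so a nonempty descent from
  \<open>p\<close> begins with \<open>Star (p - 1)\<close> and ends with
  \<open>Star (p - s)\<close>.\<close>

definition down :: "nat \<Rightarrow> nat \<Rightarrow> double_arrow list" where
  "down p s = map Star (rev [p - s..<p])"

definition normal_form :: "nat \<Rightarrow> nat \<Rightarrow> nat \<Rightarrow> double_arrow list" where
  "normal_form p s q = down p s @ up (p - s) q"

lemma up_Suc: "a \<le> b \<Longrightarrow> up a (Suc b) = up a b @ [Arr b]"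
  by (simp add: up_def)

lemma up_self [simp]: "up a a = []"
  by (simp add: up_def)

lemma down_Suc: "Suc s \<le> p \<Longrightarrow> down p (Suc s) = down p s @ [Star (p - Suc s)]"
proof -
  assume "Suc s \<le> p"
  then have "[p - Suc s..<p] = (p - Suc s) # [p - s..<p]"
    by (subst upt_conv_Cons) (auto simp: Suc_diff_Suc)
  then show ?thesis by (simp add: down_def)
qed

lemma down_0 [simp]: "down p 0 = []"
  by (simp add: down_def)

lemma stars_up [simp]: "stars (up a b) = 0"
  by (induction b) (auto simp: up_def)

lemma walk_up: "a \<le> b \<Longrightarrow> 1 \<le> a \<Longrightarrow> b \<le> n \<Longrightarrow> walk n a (up a b) b"
  by (induction b rule: dec_induct) (auto simp: up_Suc walk_append)

lemma stars_down: "s \<le> p \<Longrightarrow> stars (down p s) = s"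
  by (induction s) (auto simp: down_Suc)

lemma walk_down: "s < p \<Longrightarrow> p \<le> n \<Longrightarrow> walk n p (down p s) (p - s)"
proof (induction s)
  case (Suc s)
  then show ?case by (auto simp: down_Suc walk_append Suc_diff_Suc intro!: exI[of _ "p - s"])
qed simp

lemma stars_normal_form: "s < p \<Longrightarrow> stars (normal_form p s q) = s"
  by (simp add: normal_form_def stars_down)

lemma walk_normal_form: "p \<in> {1..n} \<Longrightarrow> q \<in> {1..n} \<Longrightarrow> s \<in> steps n p q \<Longrightarrow> walk n p (normal_form p s q) q"
  unfolding normal_form_def walk_append
  by (intro exI[of _ "p - s"] conjI walk_down walk_up) (auto simp: steps_def)

text \<open>The downward arrow passes the upward arrows one by one, each time by a
  \<open>swap\<close>. The bound \<open>b < n\<close> keeps all of these swaps at inner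
  vertices.\<close>

lemma star_past_up:
  assumes "1 \<le> a" "a \<le> b" "b < n"
  shows "mesh_equiv n (Star a # up a b) (up (Suc a) (Suc b) @ [Star b])"
  using assms(2,3)
proof (induction b rule: dec_induct)
  case base
  then show ?case by (auto intro: mesh_equiv.refl)
next
  case (step b)
  have "mesh_equiv n (Star a # up a (Suc b)) (up (Suc a) (Suc b) @ [Star b, Arr b])"
    using mesh_equiv_context[OF step.IH, of "[]" "[Arr b]"] step by (simp add: up_Suc)
  moreover have "mesh_equiv n (up (Suc a) (Suc b) @ [Star b, Arr b])
      (up (Suc a) (Suc b) @ [Arr (Suc b), Star (Suc b)])"
    using mesh_equiv.swap[of b n "up (Suc a) (Suc b)" "[]"] step assms(1) by simp
  ultimately show ?case using step by (auto simp: up_Suc[of "Suc a" "Suc b"] intro: mesh_equiv.trans)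
qed

text \<open>The end vertex lies one above the range \<open>s + q \<le> n\<close>. The last downward
  arrow is pushed to the right. For \<open>s = 1\<close> it arrives at the top and forms the null
  detour at \<open>n\<close>; otherwise it also passes the last upward arrow and leaves as a prefix
  the same situation with one downward arrow less.\<close>

lemma mesh_null_top:
  assumes "1 \<le> s" "s < p" "p \<le> n"
  shows "mesh_null n (normal_form p s (Suc n - s))"
  using assms(1,2)
proof (induction s rule: dec_induct)
  case base
  let ?a = "p - 1" and ?b = "n - 1"
  have ab: "1 \<le> ?a" "?a \<le> ?b" "?b < n" using base assms(3) by auto
  have "normal_form p 1 (Suc n - 1) = (Star ?a # up ?a ?b) @ [Arr ?b]"
    using base assms(3) down_Suc[of 0 p] up_Suc[of ?a ?b] by (simp add: normal_form_def)
  moreover have "mesh_equiv n ((Star ?a # up ?a ?b) @ [Arr ?b]) ((up (Suc ?a) (Suc ?b) @ [Star ?b]) @ [Arr ?b])"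
    using mesh_equiv_context[OF star_past_up[OF ab], of "[]" "[Arr ?b]"] by simp
  moreover have "mesh_null n ((up (Suc ?a) (Suc ?b) @ [Star ?b]) @ [Arr ?b])"
    using mesh_null.top[of n "up (Suc ?a) (Suc ?b)" "[]"] by simp
  ultimately show ?case by (metis mesh_null.equiv One_nat_def)
next
  case (step s)
  let ?a = "p - Suc s" and ?b = "n - Suc s"
  have ab: "1 \<le> ?a" "?a \<le> ?b" "?b < n" using step.prems assms(3) by auto
  have eqs: "Suc ?a = p - s" "Suc ?b = n - s" "Suc n - Suc s = Suc ?b" "Suc (Suc ?b) = Suc n - s"
    using step.prems assms(3) by auto
  have "normal_form p (Suc s) (Suc n - Suc s) = down p s @ (Star ?a # up ?a ?b) @ [Arr ?b]"
    unfolding eqs(3) normal_form_def using step.prems ab by (simp add: down_Suc up_Suc)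
  moreover have "mesh_equiv n (down p s @ (Star ?a # up ?a ?b) @ [Arr ?b])
      (down p s @ (up (Suc ?a) (Suc ?b) @ [Star ?b]) @ [Arr ?b])"
    by (intro mesh_equiv_context star_past_up ab)
  \<comment> \<open>This swap takes place at the vertex \<open>n - s\<close>, an inner one because
    \<open>s \<ge> 1\<close>; the corresponding vertex in the base case is \<open>n\<close>.\<close>
  moreover have "mesh_equiv n (down p s @ (up (Suc ?a) (Suc ?b) @ [Star ?b]) @ [Arr ?b])
      (down p s @ (up (Suc ?a) (Suc ?b) @ [Arr (Suc ?b)]) @ [Star (Suc ?b)])"
    using mesh_equiv.swap[of ?b n "down p s @ up (Suc ?a) (Suc ?b)" "[]"] step ab assms(3) by simp
  moreover have "down p s @ (up (Suc ?a) (Suc ?b) @ [Arr (Suc ?b)]) @ [Star (Suc ?b)] =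
      normal_form p s (Suc n - s) @ [Star (Suc ?b)]"
    unfolding normal_form_def eqs(4)[symmetric] using ab eqs(1) by (simp add: up_Suc)
  moreover have "mesh_null n (normal_form p s (Suc n - s) @ [Star (Suc ?b)])"
    using mesh_null_context[OF step.IH, of "[]" "[Star (Suc ?b)]"] step.prems by simp
  ultimately show ?case by (metis mesh_null.equiv)
qed

text \<open>Each swap carries the downward arrow one place back, until it follows
  \<open>Arr 1\<close> and forms the null detour at vertex 1.\<close>

lemma mesh_null_bottom:
  assumes "1 \<le> b" "b < n"
  shows "mesh_null n (up 1 (Suc b) @ [Star b])"
  using assms
proof (induction b rule: dec_induct)
  case base
  then show ?case using mesh_null.bottom[of n "[]" "[]"] by (simp add: up_Suc)
next
  case (step b)
  have "mesh_null n (up 1 (Suc b) @ [Star b, Arr b])"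
    using mesh_null_context[OF step.IH, of "[]" "[Arr b]"] step by simp
  moreover have "mesh_equiv n (up 1 (Suc b) @ [Star b, Arr b]) (up 1 (Suc b) @ [Arr (Suc b), Star (Suc b)])"
    using mesh_equiv.swap[of b n "up 1 (Suc b)" "[]"] step by simp
  moreover have "up 1 (Suc (Suc b)) @ [Star (Suc b)] = up 1 (Suc b) @ [Arr (Suc b), Star (Suc b)]"
    using up_Suc[of 1 "Suc b"] by simp
  ultimately show ?case by (metis mesh_null.equiv mesh_equiv.sym)
qed

text \<open>A normal form followed by one more arrow is normalised again. An upward arrow fits on
  directly unless it oversteps the top; a downward arrow is pushed left to the bottom of the valley
  unless the valley already lies at vertex 1. The two exceptions are null and match the failure of
  \<open>s + q \<le> n\<close> and of \<open>s < p\<close>.\<close>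

theorem walk_reduction:
  assumes "walk n p w q"
  shows "if stars w \<in> steps n p q then mesh_equiv n w (normal_form p (stars w) q) else mesh_null n w"
  using assms
proof (induction w arbitrary: q rule: rev_induct)
  case Nil
  then show ?case by (auto simp: normal_form_def steps_def mesh_equiv.refl)
next
  case (snoc e w)
  then obtain q' where w: "walk n p w q'" and e: "walk n q' [e] q" by (auto simp: walk_append)
  let ?s = "stars w"
  note ends = walk_endpoints[OF w] walk_endpoints[OF e]
  show ?case
  proof (cases "?s \<in> steps n p q'")
    case False
    then have "mesh_null n w" using snoc.IH[OF w] by simp
    then have "mesh_null n (w @ [e])" using mesh_null_context[of n w "[]" "[e]"] by simp
    moreover have "stars (w @ [e]) \<notin> steps n p q" using steps_append(1)[OF w e] False by blast
    ultimately show ?thesis by simp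
  next
    case True
    then have "mesh_equiv n w (normal_form p ?s q')" using snoc.IH[OF w] by simp
    then have eq: "mesh_equiv n (w @ [e]) (normal_form p ?s q' @ [e])"
      using mesh_equiv_context[of n w _ "[]" "[e]"] by simp
    have s: "p \<le> q' + ?s" "?s < p" "?s + q' \<le> n" using True by (auto simp: steps_def)
    show ?thesis
    proof (cases e)
      case (Arr i)
      with e have q: "i = q'" "q = Suc q'" "q' < n" by auto
      have nf: "normal_form p ?s q' @ [e] = normal_form p ?s q"
        using s Arr q by (simp add: normal_form_def up_Suc)
      show ?thesis
      proof (cases "?s + q \<le> n")
        case True
        then have "stars (w @ [e]) \<in> steps n p q" using s q Arr by (simp add: steps_def)
        then show ?thesis using eq nf Arr by simp
      next
        case False
        \<comment> \<open>The walk was admissible before its last arrow, so it oversteps by exactly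
          one; \<open>1 \<le> ?s\<close> follows from \<open>q \<le> n\<close>.\<close>
        then have "q = Suc n - ?s" "1 \<le> ?s" using s q by auto
        then have "mesh_null n (normal_form p ?s q)" using mesh_null_top[of ?s p n] s ends by simp
        moreover have "stars (w @ [e]) \<notin> steps n p q" using False Arr by (simp add: steps_def)
        ultimately show ?thesis using eq nf mesh_null.equiv by simp
      qed
    next
      case (Star i)
      with e have q: "i = q" "q' = Suc q" "1 \<le> q" "q < n" by auto
      show ?thesis
      proof (cases "Suc ?s < p")
        case True
        let ?a = "p - Suc ?s"
        have a: "1 \<le> ?a" "?a \<le> q" "Suc ?a = p - ?s" using True s q by auto
        \<comment> \<open>Used from right to left: the new downward arrow moves back to the bottom
          of the valley.\<close>
        have "mesh_equiv n (down p ?s @ (Star ?a # up ?a q) @ []) (down p ?s @ (up (Suc ?a) (Suc q) @ [Star q]) @ [])"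
          by (intro mesh_equiv_context star_past_up a q)
        moreover have "down p ?s @ (Star ?a # up ?a q) @ [] = normal_form p (Suc ?s) q"
          using True by (simp add: normal_form_def down_Suc)
        moreover have "down p ?s @ (up (Suc ?a) (Suc q) @ [Star q]) @ [] = normal_form p ?s q' @ [e]"
          unfolding normal_form_def a(3) using q Star by simp
        ultimately have "mesh_equiv n (w @ [e]) (normal_form p (Suc ?s) q)"
          using eq by (metis mesh_equiv.sym mesh_equiv.trans)
        moreover have "stars (w @ [e]) \<in> steps n p q" using True s q Star by (simp add: steps_def)
        ultimately show ?thesis using Star by simp
      next
        case False
        then have p: "p - ?s = 1" using s by simp
        have "mesh_null n (down p ?s @ (up 1 (Suc q) @ [Star q]) @ [])"
          by (intro mesh_null_context mesh_null_bottom q)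
        then have "mesh_null n (normal_form p ?s q' @ [e])" using q Star p by (simp add: normal_form_def)
        moreover have "stars (w @ [e]) \<notin> steps n p q" using False Star by (simp add: steps_def)
        ultimately show ?thesis using eq mesh_null.equiv by simp
      qed
    qed
  qed
qed

section \<open>The mesh ideal as a kernel\<close>

definition walks :: "nat \<Rightarrow> nat \<Rightarrow> nat \<Rightarrow> nat \<Rightarrow> double_arrow list set" where
  "walks n p q s = {w. walk n p w q \<and> stars w = s}"

text \<open>The number of downward arrows fixes the length, and the alphabet is finite.\<close>

lemma finite_walks [simp, intro]: "finite (walks n p q s)"
proof (rule finite_subset)
  show "walks n p q s \<subseteq> {w. set w \<subseteq> Arr ` {1..<n} \<union> Star ` {1..<n} \<and> length w = q + 2 * s - p}"
    using set_walk walk_length by (fastforce simp: walks_def)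
qed (rule finite_lists_length_eq, simp)

lemma finite_factorizations [simp, intro]: "finite {(u, v). u @ v = w}"
proof (rule finite_subset)
  show "{(u, v). u @ v = w} \<subseteq> (\<lambda>i. (take i w, drop i w)) ` {..length w}"
  proof clarify
    fix u v assume "w = u @ v"
    then show "(u, v) \<in> (\<lambda>i. (take i (u @ v), drop i (u @ v))) ` {..length (u @ v)}"
      by (intro image_eqI[of _ _ "length u"]) auto
  qed
qed simp

text \<open>Linear extension of the map sending a walk \<open>w\<close> to its sign times the basis
  vector at \<open>stars w\<close>. Sorting walks by \<open>stars\<close> makes every coordinate a
  finite sum over a set that does not depend on \<open>f\<close>.\<close>

definition path_image ::
  "('k, 'z) ring_scheme \<Rightarrow> nat \<Rightarrow> nat \<Rightarrow> nat \<Rightarrow> (double_arrow list \<Rightarrow> 'k) \<Rightarrow> nat \<Rightarrow> 'k" where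
  "path_image R n p q f =
     (\<lambda>s. if s \<in> steps n p q then finsum R (\<lambda>w. sign R (weight w) \<otimes>\<^bsub>R\<^esub> f w) (walks n p q s) else \<zero>\<^bsub>R\<^esub>)"

definition signed_path :: "('k, 'z) ring_scheme \<Rightarrow> double_arrow list \<Rightarrow> double_arrow list \<Rightarrow> 'k" where
  "signed_path R w = (\<lambda>x. sign R (weight w) \<otimes>\<^bsub>R\<^esub> basis_vector R w x)"

text \<open>Linear extension of sending the basis vector at \<open>s\<close> to the signed normal
  form with \<open>s\<close> downward arrows; it can be given pointwise because \<open>stars\<close>
  recovers \<open>s\<close> from the normal form.\<close>

definition path_section ::
  "('k, 'z) ring_scheme \<Rightarrow> nat \<Rightarrow> nat \<Rightarrow> nat \<Rightarrow> (nat \<Rightarrow> 'k) \<Rightarrow> double_arrow list \<Rightarrow> 'k" where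
  "path_section R n p q c =
     (\<lambda>w. if w \<in> (\<lambda>s. normal_form p s q) ` steps n p q then sign R (weight w) \<otimes>\<^bsub>R\<^esub> c (stars w) else \<zero>\<^bsub>R\<^esub>)"

section \<open>The path category and its functor to the model\<close>

locale mesh = truncated R n for R :: "('k, 'z) ring_scheme" (structure) and n :: nat +
  assumes n_ge_2: "2 \<le> n"
begin

abbreviation P where "P \<equiv> path_category R (double_A n)"
abbreviation PM where "PM p q \<equiv> free_module R {w. walk n p w q}"
abbreviation PH where "PH p q \<equiv> carrier (PM p q)"

lemma path_category_simps [simp]:
  "Obj P = {1..n}"
  "Hom P p q = PM p q"
  "Ident P q = basis_vector R []"
  by (simp_all add: path_category_def double_A_def)

lemma path_comp_apply:
  "Comp P p q r g f w = finsum R (\<lambda>(u, v). g v \<otimes> f u) {(u, v). u @ v = w}"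
  by (simp add: path_category_def)

lemma PH_apply [simp]: "f \<in> PH p q \<Longrightarrow> f w \<in> carrier R"
  by (rule free_module_apply_closed)

lemma path_basis [simp]: "walk n p w q \<Longrightarrow> basis_vector R w \<in> PH p q"
  by (simp add: basis_vector_in_free_module)

text \<open>A nonzero coefficient at \<open>w\<close> comes from a factorization of \<open>w\<close>
  into members of the two supports, so the support of the product lies among finitely many
  concatenations.\<close>

lemma path_comp_closed:
  assumes f: "f \<in> PH p q" and g: "g \<in> PH q r"
  shows "Comp P p q r g f \<in> PH p r"
  unfolding carrier_free_module_iff
proof (intro conjI allI impI)
  have zero: "Comp P p q r g f w = \<zero>" if "\<And>u v. u @ v = w \<Longrightarrow> g v \<otimes> f u = \<zero>" for w
  proof -
    have "finsum R (\<lambda>(u, v). g v \<otimes> f u) {(u, v). u @ v = w} = (\<Oplus>x\<in>{(u, v). u @ v = w}. \<zero>)"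
      using that by (intro finsum_cong' refl) auto
    then show ?thesis by (simp add: path_comp_apply)
  qed
  show "Comp P p q r g f w \<in> carrier R" for w
    using f g unfolding path_comp_apply by (intro finsum_closed) auto
  show "Comp P p q r g f w = \<zero>" if w: "w \<notin> {w. walk n p w r}" for w
  proof (rule zero)
    fix u v assume "u @ v = w"
    then have "\<not> walk n p u q \<or> \<not> walk n q v r" using w by (auto simp: walk_append)
    then have "f u = \<zero> \<or> g v = \<zero>"
      using free_module_apply_outside[OF f] free_module_apply_outside[OF g] by blast
    then show "g v \<otimes> f u = \<zero>" using f g by auto
  qed
  have "{w. Comp P p q r g f w \<noteq> \<zero>} \<subseteq> (\<lambda>(u, v). u @ v) ` ({u. f u \<noteq> \<zero>} \<times> {v. g v \<noteq> \<zero>})"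
  proof
    fix w assume "w \<in> {w. Comp P p q r g f w \<noteq> \<zero>}"
    then obtain u v where uv: "u @ v = w" "g v \<otimes> f u \<noteq> \<zero>" using zero by blast
    then have "f u \<noteq> \<zero>" "g v \<noteq> \<zero>" using f g by auto
    then show "w \<in> (\<lambda>(u, v). u @ v) ` ({u. f u \<noteq> \<zero>} \<times> {v. g v \<noteq> \<zero>})" using uv(1) by auto
  qed
  then show "finite {w. Comp P p q r g f w \<noteq> \<zero>}"
    by (rule finite_subset) (use f g in \<open>auto simp: carrier_free_module_iff\<close>)
qed

lemma path_comp_linear_left:
  assumes f: "f \<in> PH p q"
  shows "linear_map R (PM q r) (PM p r) (\<lambda>g. Comp P p q r g f)"
proof (rule linear_mapI)
  fix g h assume gh: "g \<in> PH q r" "h \<in> PH q r"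
  show "Comp P p q r (g \<oplus>\<^bsub>PM q r\<^esub> h) f = Comp P p q r g f \<oplus>\<^bsub>PM p r\<^esub> Comp P p q r h f"
  proof
    fix w
    have "finsum R (\<lambda>(u, v). (g v \<oplus> h v) \<otimes> f u) {(u, v). u @ v = w} =
        (\<Oplus>x\<in>{(u, v). u @ v = w}. (case x of (u, v) \<Rightarrow> g v \<otimes> f u) \<oplus> (case x of (u, v) \<Rightarrow> h v \<otimes> f u))"
      using f gh by (intro finsum_cong' refl) (auto intro: l_distr)
    also have "\<dots> = finsum R (\<lambda>(u, v). g v \<otimes> f u) {(u, v). u @ v = w} \<oplus> finsum R (\<lambda>(u, v). h v \<otimes> f u) {(u, v). u @ v = w}"
      using f gh by (intro finsum_addf) auto
    finally show "Comp P p q r (g \<oplus>\<^bsub>PM q r\<^esub> h) f w = (Comp P p q r g f \<oplus>\<^bsub>PM p r\<^esub> Comp P p q r h f) w"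
      by (simp add: path_comp_apply)
  qed
next
  fix c g assume cg: "c \<in> carrier R" "g \<in> PH q r"
  show "Comp P p q r (c \<odot>\<^bsub>PM q r\<^esub> g) f = c \<odot>\<^bsub>PM p r\<^esub> Comp P p q r g f"
  proof
    fix w
    have "finsum R (\<lambda>(u, v). (c \<otimes> g v) \<otimes> f u) {(u, v). u @ v = w} =
        (\<Oplus>x\<in>{(u, v). u @ v = w}. c \<otimes> (case x of (u, v) \<Rightarrow> g v \<otimes> f u))"
      using f cg by (intro finsum_cong' refl) (auto intro: m_assoc)
    also have "\<dots> = c \<otimes> finsum R (\<lambda>(u, v). g v \<otimes> f u) {(u, v). u @ v = w}"
      using f cg by (intro finsum_rdistr[symmetric]) auto
    finally show "Comp P p q r (c \<odot>\<^bsub>PM q r\<^esub> g) f w = (c \<odot>\<^bsub>PM p r\<^esub> Comp P p q r g f) w"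
      by (simp add: path_comp_apply)
  qed
qed (rule path_comp_closed[OF f])

lemma path_comp_linear_right:
  assumes g: "g \<in> PH q r"
  shows "linear_map R (PM p q) (PM p r) (\<lambda>f. Comp P p q r g f)"
proof (rule linear_mapI)
  fix f h assume fh: "f \<in> PH p q" "h \<in> PH p q"
  show "Comp P p q r g (f \<oplus>\<^bsub>PM p q\<^esub> h) = Comp P p q r g f \<oplus>\<^bsub>PM p r\<^esub> Comp P p q r g h"
  proof
    fix w
    have "finsum R (\<lambda>(u, v). g v \<otimes> (f u \<oplus> h u)) {(u, v). u @ v = w} =
        (\<Oplus>x\<in>{(u, v). u @ v = w}. (case x of (u, v) \<Rightarrow> g v \<otimes> f u) \<oplus> (case x of (u, v) \<Rightarrow> g v \<otimes> h u))"
      using g fh by (intro finsum_cong' refl) (auto intro: r_distr)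
    also have "\<dots> = finsum R (\<lambda>(u, v). g v \<otimes> f u) {(u, v). u @ v = w} \<oplus> finsum R (\<lambda>(u, v). g v \<otimes> h u) {(u, v). u @ v = w}"
      using g fh by (intro finsum_addf) auto
    finally show "Comp P p q r g (f \<oplus>\<^bsub>PM p q\<^esub> h) w = (Comp P p q r g f \<oplus>\<^bsub>PM p r\<^esub> Comp P p q r g h) w"
      by (simp add: path_comp_apply)
  qed
next
  fix c f assume cf: "c \<in> carrier R" "f \<in> PH p q"
  show "Comp P p q r g (c \<odot>\<^bsub>PM p q\<^esub> f) = c \<odot>\<^bsub>PM p r\<^esub> Comp P p q r g f"
  proof
    fix w
    have "finsum R (\<lambda>(u, v). g v \<otimes> (c \<otimes> f u)) {(u, v). u @ v = w} =
        (\<Oplus>x\<in>{(u, v). u @ v = w}. c \<otimes> (case x of (u, v) \<Rightarrow> g v \<otimes> f u))"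
      using g cf by (intro finsum_cong' refl) (auto intro: m_lcomm)
    also have "\<dots> = c \<otimes> finsum R (\<lambda>(u, v). g v \<otimes> f u) {(u, v). u @ v = w}"
      using g cf by (intro finsum_rdistr[symmetric]) auto
    finally show "Comp P p q r g (c \<odot>\<^bsub>PM p q\<^esub> f) w = (c \<odot>\<^bsub>PM p r\<^esub> Comp P p q r g f) w"
      by (simp add: path_comp_apply)
  qed
qed (rule path_comp_closed[OF _ g])

lemma path_comp_basis: "Comp P p q r (basis_vector R v) (basis_vector R u) = basis_vector R (u @ v)"
proof
  fix w
  have "finsum R (\<lambda>(x, y). basis_vector R v y \<otimes> basis_vector R u x) {(x, y). x @ y = w} =
      (\<Oplus>z\<in>{(x, y). x @ y = w}. if (u, v) = z then \<one> else \<zero>)"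
    by (intro finsum_cong' refl) (auto simp: basis_vector_def split: if_splits)
  also have "\<dots> = basis_vector R (u @ v) w"
  proof (cases "u @ v = w")
    case True
    then show ?thesis by (subst add.finprod_singleton) (auto simp: basis_vector_def)
  next
    case False
    then have "(\<Oplus>z\<in>{(x, y). x @ y = w}. if (u, v) = z then \<one> else \<zero>) = (\<Oplus>z\<in>{(x, y). x @ y = w}. \<zero>)"
      by (intro finsum_cong' refl) auto
    then show ?thesis using False by (simp add: basis_vector_def)
  qed
  finally show "Comp P p q r (basis_vector R v) (basis_vector R u) w = basis_vector R (u @ v) w"
    by (simp add: path_comp_apply)
qed

lemma path_image_linear: "linear_map R (PM p q) (free_module R (steps n p q)) (path_image R n p q)"
proof (rule linear_mapI)
  fix f assume "f \<in> PH p q"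
  then show "path_image R n p q f \<in> H p q"
    by (auto simp: H_iff path_image_def intro!: finsum_closed)
next
  fix f g assume fg: "f \<in> PH p q" "g \<in> PH p q"
  show "path_image R n p q (f \<oplus>\<^bsub>PM p q\<^esub> g) =
      path_image R n p q f \<oplus>\<^bsub>free_module R (steps n p q)\<^esub> path_image R n p q g"
  proof
    fix s
    have "(\<Oplus>w\<in>walks n p q s. sign R (weight w) \<otimes> (f w \<oplus> g w)) =
        (\<Oplus>w\<in>walks n p q s. sign R (weight w) \<otimes> f w \<oplus> sign R (weight w) \<otimes> g w)"
      using fg by (intro finsum_cong' refl) (auto intro: r_distr)
    also have "\<dots> = (\<Oplus>w\<in>walks n p q s. sign R (weight w) \<otimes> f w) \<oplus> (\<Oplus>w\<in>walks n p q s. sign R (weight w) \<otimes> g w)"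
      using fg by (intro finsum_addf) auto
    finally show "path_image R n p q (f \<oplus>\<^bsub>PM p q\<^esub> g) s =
        (path_image R n p q f \<oplus>\<^bsub>free_module R (steps n p q)\<^esub> path_image R n p q g) s"
      by (simp add: path_image_def)
  qed
next
  fix c f assume cf: "c \<in> carrier R" "f \<in> PH p q"
  show "path_image R n p q (c \<odot>\<^bsub>PM p q\<^esub> f) = c \<odot>\<^bsub>free_module R (steps n p q)\<^esub> path_image R n p q f"
  proof
    fix s
    have "(\<Oplus>w\<in>walks n p q s. sign R (weight w) \<otimes> (c \<otimes> f w)) =
        (\<Oplus>w\<in>walks n p q s. c \<otimes> (sign R (weight w) \<otimes> f w))"
      using cf by (intro finsum_cong' refl) (auto intro: m_lcomm)
    also have "\<dots> = c \<otimes> (\<Oplus>w\<in>walks n p q s. sign R (weight w) \<otimes> f w)"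
      using cf by (intro finsum_rdistr[symmetric]) auto
    finally show "path_image R n p q (c \<odot>\<^bsub>PM p q\<^esub> f) s =
        (c \<odot>\<^bsub>free_module R (steps n p q)\<^esub> path_image R n p q f) s"
      using cf by (simp add: path_image_def)
  qed
qed

lemma path_image_closed: "f \<in> PH p q \<Longrightarrow> path_image R n p q f \<in> H p q"
  by (rule linear_map_closed[OF path_image_linear])

lemma path_image_basis:
  assumes w: "walk n p w q"
  shows "path_image R n p q (basis_vector R w) =
    (\<lambda>s. sign R (weight w) \<otimes> (if stars w \<in> steps n p q then basis_vector R (stars w) s else \<zero>))"
proof
  fix s
  have "(\<Oplus>v\<in>walks n p q s. sign R (weight v) \<otimes> basis_vector R w v) =
      (\<Oplus>v\<in>walks n p q s. if w = v then sign R (weight v) else \<zero>)"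
    by (intro finsum_cong' refl) (auto simp: basis_vector_def)
  also have "\<dots> = (if stars w = s then sign R (weight w) else \<zero>)"
  proof (cases "stars w = s")
    case True
    then have "w \<in> walks n p q s" using w by (simp add: walks_def)
    then show ?thesis using True by (subst add.finprod_singleton) auto
  next
    case False
    then have "(\<Oplus>v\<in>walks n p q s. if w = v then sign R (weight v) else \<zero>) = (\<Oplus>v\<in>walks n p q s. \<zero>)"
      by (intro finsum_cong' refl) (auto simp: walks_def)
    then show ?thesis using False by simp
  qed
  finally show "path_image R n p q (basis_vector R w) s =
      sign R (weight w) \<otimes> (if stars w \<in> steps n p q then basis_vector R (stars w) s else \<zero>)"
    by (auto simp: path_image_def basis_vector_def)
qed

text \<open>\<open>weight\<close> and \<open>stars\<close> are additive under concatenation. If a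
  factor is inadmissible, so is the concatenation by \<open>steps_append\<close>, and both sides
  vanish.\<close>

lemma path_image_comp_basis:
  assumes u: "walk n p u q" and v: "walk n q v r"
  shows "path_image R n p r (Comp P p q r (basis_vector R v) (basis_vector R u)) =
    Comp T p q r (path_image R n q r (basis_vector R v)) (path_image R n p q (basis_vector R u))"
proof -
  have uv: "walk n p (u @ v) r" using u v by (auto simp: walk_append)
  show ?thesis
  proof (cases "stars u \<in> steps n p q \<and> stars v \<in> steps n q r")
    case True
    then have "Comp T p q r (\<lambda>s. sign R (weight v) \<otimes> basis_vector R (stars v) s)
        (\<lambda>s. sign R (weight u) \<otimes> basis_vector R (stars u) s) =
      (\<lambda>s. sign R (weight v) \<otimes> (sign R (weight u) \<otimes>
        Comp T p q r (basis_vector R (stars v)) (basis_vector R (stars u)) s))"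
      by (subst comp_smult_left) (auto simp: comp_smult_right intro!: free_module_smult_closed)
    then show ?thesis
      using True
      by (auto simp: path_comp_basis path_image_basis[OF uv] path_image_basis[OF u] path_image_basis[OF v]
          comp_basis sign_add m_lcomm m_assoc fun_eq_iff)
  next
    case False
    then have "stars (u @ v) \<notin> steps n p r" using steps_append[OF u v] by blast
    then have "path_image R n p r (Comp P p q r (basis_vector R v) (basis_vector R u)) = (\<lambda>s. \<zero>)"
      by (simp add: path_comp_basis path_image_basis[OF uv])
    moreover have "path_image R n p q (basis_vector R u) = (\<lambda>s. \<zero>) \<or> path_image R n q r (basis_vector R v) = (\<lambda>s. \<zero>)"
      using False by (auto simp: path_image_basis[OF u] path_image_basis[OF v])
    moreover have "path_image R n p q (basis_vector R u) \<in> H p q" "path_image R n q r (basis_vector R v) \<in> H q r"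
      using u v by (simp_all add: path_image_closed)
    ultimately show ?thesis
      by (elim disjE) (simp_all add: comp_zero_left comp_zero_right)
  qed
qed

lemma path_image_comp:
  assumes f: "f \<in> PH p q" and g: "g \<in> PH q r"
  shows "path_image R n p r (Comp P p q r g f) = Comp T p q r (path_image R n q r g) (path_image R n p q f)"
proof -
  note L = path_image_linear
  have 1: "path_image R n p r (Comp P p q r g (basis_vector R u)) =
      Comp T p q r (path_image R n q r g) (path_image R n p q (basis_vector R u))" if u: "walk n p u q" for u
    by (rule free_module_linear_ext[OF g module_H linear_map_compose[OF path_comp_linear_left L]
          linear_map_compose[OF L comp_linear_left]])
       (simp_all add: u path_image_closed path_image_comp_basis)
  show ?thesis
    by (rule free_module_linear_ext[OF f module_H linear_map_compose[OF path_comp_linear_right[OF g] L]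
          linear_map_compose[OF L comp_linear_right]])
       (simp_all add: 1 g path_image_closed)
qed

lemma path_section_linear:
  assumes "p \<in> {1..n}" "q \<in> {1..n}"
  shows "linear_map R (free_module R (steps n p q)) (PM p q) (path_section R n p q)"
proof (rule linear_mapI)
  fix c assume c: "c \<in> H p q"
  have "{w. path_section R n p q c w \<noteq> \<zero>} \<subseteq> (\<lambda>s. normal_form p s q) ` steps n p q"
    by (auto simp: path_section_def)
  then have "finite {w. path_section R n p q c w \<noteq> \<zero>}" by (rule finite_subset) simp
  then show "path_section R n p q c \<in> PH p q"
    using c walk_normal_form[OF assms] by (auto simp: carrier_free_module_iff path_section_def)
qed (auto simp: path_section_def r_distr m_lcomm)

lemma path_section_basis:
  assumes "p \<in> {1..n}" "q \<in> {1..n}" "s \<in> steps n p q"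
  shows "path_section R n p q (basis_vector R s) = signed_path R (normal_form p s q)"
proof -
  have "stars (normal_form p t q) = t" if "t \<in> steps n p q" for t
    using that by (intro stars_normal_form) (simp add: steps_def)
  then show ?thesis
    using assms(3) by (auto simp: path_section_def signed_path_def basis_vector_def fun_eq_iff)
qed

text \<open>The sign put in by the section is cancelled by the one that \<open>path_image\<close>
  attaches to the normal form.\<close>

lemma path_image_section:
  assumes "p \<in> {1..n}" "q \<in> {1..n}" "c \<in> H p q"
  shows "path_image R n p q (path_section R n p q c) = c"
proof (rule free_module_linear_ext[OF assms(3) module_H linear_map_compose[OF path_section_linear[OF assms(1,2)] path_image_linear] linear_map_id])
  fix s assume s: "s \<in> steps n p q"
  then have st: "stars (normal_form p s q) = s" by (intro stars_normal_form) (simp add: steps_def)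
  note w = walk_normal_form[OF assms(1,2) s]
  have "path_image R n p q (signed_path R (normal_form p s q)) =
      (\<lambda>i. sign R (weight (normal_form p s q)) \<otimes> path_image R n p q (basis_vector R (normal_form p s q)) i)"
    using linear_map_smult[OF path_image_linear sign_closed path_basis[OF w]] by (simp add: signed_path_def)
  also have "\<dots> = basis_vector R s"
    using s by (simp add: path_image_basis[OF w] st)
  finally show "path_image R n p q (path_section R n p q (basis_vector R s)) = basis_vector R s"
    by (simp add: path_section_basis[OF assms(1,2) s])
qed

lemma mesh_relation_eq:
  "mesh_relation R n q =
    (if q = 1 then basis_vector R [Arr q, Star q]
     else if q = n then basis_vector R [Star (q - 1), Arr (q - 1)]
     else (\<lambda>w. basis_vector R [Star (q - 1), Arr (q - 1)] w \<oplus> basis_vector R [Arr q, Star q] w))"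
  by (simp add: mesh_relation_def Let_def path_comp_basis)

lemma two_sided_ideal_kernel:
  "two_sided_ideal R P (\<lambda>p q. {f \<in> PH p q. path_image R n p q f = (\<lambda>s. \<zero>)})"
  unfolding two_sided_ideal_def
proof (intro conjI ballI)
  fix p q
  show "submodule {f \<in> PH p q. path_image R n p q f = (\<lambda>s. \<zero>)} R (Hom P p q)"
    using submodule_kernel[OF module_free_module module_H path_image_linear] by simp
qed (auto simp: path_comp_closed path_image_comp comp_zero_left comp_zero_right path_image_closed)

text \<open>Both detours contain one downward arrow. At vertex 1 this violates \<open>s < p\<close>,
  at vertex \<open>n\<close> it violates \<open>s + q \<le> n\<close>; at an inner vertex the
  weights \<open>q - 1\<close> and \<open>q\<close> give opposite signs, and the images
  cancel.\<close>

lemma mesh_relation_in_kernel: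
  assumes q: "q \<in> {1..n}"
  shows "mesh_relation R n q \<in> PH q q" and "path_image R n q q (mesh_relation R n q) = (\<lambda>s. \<zero>)"
proof -
  have low: "walk n q [Star (q - 1), Arr (q - 1)] q" if "q \<noteq> 1" using that q by auto
  have high: "walk n q [Arr q, Star q] q" if "q \<noteq> n" using that q by auto
  have 1: "path_image R n q q (basis_vector R [Arr q, Star q]) = (\<lambda>s. \<zero>)" if "q = 1"
    using that q n_ge_2 by (subst path_image_basis) (auto simp: steps_def)
  have n: "path_image R n q q (basis_vector R [Star (q - 1), Arr (q - 1)]) = (\<lambda>s. \<zero>)" if "q = n"
    using that n_ge_2 by (subst path_image_basis) (auto simp: steps_def)
  have mid: "path_image R n q q (\<lambda>w. basis_vector R [Star (q - 1), Arr (q - 1)] w \<oplus> basis_vector R [Arr q, Star q] w) =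
      (\<lambda>s. \<zero>)" if "q \<noteq> 1" "q \<noteq> n"
  proof -
    have "sign R q = \<ominus> sign R (q - 1)" using that q sign_Suc[of "q - 1"] by simp
    note l = low[OF that(1)] and h = high[OF that(2)]
    have "path_image R n q q (\<lambda>w. basis_vector R [Star (q - 1), Arr (q - 1)] w \<oplus> basis_vector R [Arr q, Star q] w) =
        (\<lambda>s. path_image R n q q (basis_vector R [Star (q - 1), Arr (q - 1)]) s \<oplus>
          path_image R n q q (basis_vector R [Arr q, Star q]) s)"
      using linear_map_add[OF path_image_linear path_basis[OF l] path_basis[OF h]] by simp
    also have "\<dots> = (\<lambda>s. \<zero>)"
      unfolding path_image_basis[OF l] path_image_basis[OF h]
      using \<open>sign R q = \<ominus> sign R (q - 1)\<close> by (auto simp: fun_eq_iff l_minus r_neg)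
    finally show ?thesis .
  qed
  show "path_image R n q q (mesh_relation R n q) = (\<lambda>s. \<zero>)"
    unfolding mesh_relation_eq using 1 n mid by (simp split: if_split)
  show "mesh_relation R n q \<in> PH q q"
    unfolding mesh_relation_eq using low high n_ge_2 free_module_add_closed[OF path_basis[OF low] path_basis[OF high]]
    by (cases "q = 1"; cases "q = n") (auto simp: path_basis simp del: walk_simps)
qed

lemma mesh_ideal_subset_kernel:
  "mesh_ideal R n p q \<subseteq> {f \<in> PH p q. path_image R n p q f = (\<lambda>s. \<zero>)}"
  unfolding mesh_ideal_def
  by (rule generated_ideal_least[OF two_sided_ideal_kernel]) (auto simp: mesh_relation_in_kernel)

end

text \<open>The mesh ideal is an intersection, so membership in it is membership in every ideal
  \<open>J\<close> that contains the relations; one such \<open>J\<close> is fixed here.\<close>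

locale mesh_ideal_above = mesh R n for R :: "('k, 'z) ring_scheme" (structure) and n :: nat +
  fixes J :: "nat \<Rightarrow> nat \<Rightarrow> (double_arrow list \<Rightarrow> 'k) set"
  assumes ideal: "two_sided_ideal R P J"
    and relation: "\<And>q. q \<in> {1..n} \<Longrightarrow> mesh_relation R n q \<in> J q q"
begin

lemma J_sub: "p \<in> {1..n} \<Longrightarrow> q \<in> {1..n} \<Longrightarrow> submodule (J p q) R (PM p q)"
  using two_sided_ideal_submodule[OF ideal] by simp

lemma J_zero: "p \<in> {1..n} \<Longrightarrow> q \<in> {1..n} \<Longrightarrow> (\<lambda>w. \<zero>) \<in> J p q"
  using submodule_zero[OF J_sub] by simp

lemma J_add:
  "p \<in> {1..n} \<Longrightarrow> q \<in> {1..n} \<Longrightarrow> f \<in> J p q \<Longrightarrow> g \<in> J p q \<Longrightarrow> (\<lambda>w. f w \<oplus> g w) \<in> J p q"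
  using submodule_add[OF J_sub] by simp

lemma J_smult:
  "p \<in> {1..n} \<Longrightarrow> q \<in> {1..n} \<Longrightarrow> c \<in> carrier R \<Longrightarrow> f \<in> J p q \<Longrightarrow> (\<lambda>w. c \<otimes> f w) \<in> J p q"
  using submodule_smult[OF J_sub] by simp

lemma J_conjugate:
  assumes "walk n p u q" "walk n q v r" "f \<in> J q q"
  shows "Comp P p q r (basis_vector R v) (Comp P p q q f (basis_vector R u)) \<in> J p r"
proof -
  note e = walk_endpoints[OF assms(1)] walk_endpoints[OF assms(2)]
  have "Comp P p q q f (basis_vector R u) \<in> J p q"
    by (rule two_sided_ideal_comp_right[OF ideal]) (use assms e in auto)
  then show ?thesis
    by (rule two_sided_ideal_comp_left[OF ideal, rotated 3]) (use assms e in auto)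
qed

lemma swap_in_J:
  assumes "1 \<le> q" "Suc q < n" and u: "walk n p u (Suc q)" and v: "walk n (Suc q) v r"
  shows "(\<lambda>x. basis_vector R (u @ [Star q, Arr q] @ v) x \<oplus>
    basis_vector R (u @ [Arr (Suc q), Star (Suc q)] @ v) x) \<in> J p r"
proof -
  let ?l = "[Star q, Arr q]" and ?h = "[Arr (Suc q), Star (Suc q)]"
  have l: "walk n (Suc q) ?l (Suc q)" and h: "walk n (Suc q) ?h (Suc q)" using assms(1,2) by auto
  have rel: "mesh_relation R n (Suc q) = basis_vector R ?l \<oplus>\<^bsub>PM (Suc q) (Suc q)\<^esub> basis_vector R ?h"
    using assms(1,2) by (simp add: mesh_relation_eq)
  have "Comp P p (Suc q) (Suc q) (mesh_relation R n (Suc q)) (basis_vector R u) =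
      basis_vector R (u @ ?l) \<oplus>\<^bsub>PM p (Suc q)\<^esub> basis_vector R (u @ ?h)"
    unfolding rel
    by (subst linear_map_add[OF path_comp_linear_left[OF path_basis[OF u]] path_basis[OF l] path_basis[OF h]])
       (simp only: path_comp_basis)
  moreover have ul: "walk n p (u @ ?l) (Suc q)" and uh: "walk n p (u @ ?h) (Suc q)"
    using u l h walk_append by blast+
  have "Comp P p (Suc q) r (basis_vector R v)
      (basis_vector R (u @ ?l) \<oplus>\<^bsub>PM p (Suc q)\<^esub> basis_vector R (u @ ?h)) =
      basis_vector R ((u @ ?l) @ v) \<oplus>\<^bsub>PM p r\<^esub> basis_vector R ((u @ ?h) @ v)"
    by (subst linear_map_add[OF path_comp_linear_right[OF path_basis[OF v]] path_basis[OF ul] path_basis[OF uh]])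
       (simp only: path_comp_basis)
  ultimately show ?thesis
    using J_conjugate[OF u v relation] assms(1,2) by simp
qed

text \<open>Invariance of being a walk has to be part of the induction: in the transitive case the
  middle word must be recognised as a walk before the second hypothesis applies.\<close>

lemma equiv_in_J:
  assumes "mesh_equiv n w w'"
  shows "(walk n p w q \<longleftrightarrow> walk n p w' q) \<and>
    (walk n p w q \<longrightarrow> (\<lambda>x. signed_path R w x \<ominus> signed_path R w' x) \<in> J p q)"
  using assms
proof (induction arbitrary: p q rule: mesh_equiv.induct)
  case (refl w)
  have "signed_path R w x \<ominus> signed_path R w x = \<zero>" for x
    by (simp add: signed_path_def minus_eq r_neg)
  then show ?case using J_zero walk_endpoints by auto
next
  case (sym w w')
  show ?case
  proof (intro conjI impI)
    assume w: "walk n p w' q"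
    then have "(\<lambda>x. signed_path R w x \<ominus> signed_path R w' x) \<in> J p q" using sym.IH by blast
    then have "(\<lambda>x. \<ominus> \<one> \<otimes> (signed_path R w x \<ominus> signed_path R w' x)) \<in> J p q"
      using walk_endpoints[OF w] by (intro J_smult) auto
    moreover have "\<ominus> \<one> \<otimes> (signed_path R w x \<ominus> signed_path R w' x) = signed_path R w' x \<ominus> signed_path R w x" for x
      by (simp add: signed_path_def minus_eq l_minus minus_add a_comm)
    ultimately show "(\<lambda>x. signed_path R w' x \<ominus> signed_path R w x) \<in> J p q" by simp
  qed (use sym.IH in blast)
next
  case (trans w w' w'')
  show ?case
  proof (intro conjI impI)
    assume w: "walk n p w q"
    have "(\<lambda>x. (signed_path R w x \<ominus> signed_path R w' x) \<oplus> (signed_path R w' x \<ominus> signed_path R w'' x)) \<in> J p q"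
      using trans.IH w walk_endpoints[OF w] by (intro J_add) auto
    moreover have "(signed_path R w x \<ominus> signed_path R w' x) \<oplus> (signed_path R w' x \<ominus> signed_path R w'' x) =
        signed_path R w x \<ominus> signed_path R w'' x" for x
    proof -
      have "a \<ominus> b \<oplus> (b \<ominus> c) = a \<ominus> c" if "a \<in> carrier R" "b \<in> carrier R" "c \<in> carrier R" for a b c
        using that by (simp add: minus_eq a_assoc r_neg1)
      then show ?thesis by (simp add: signed_path_def)
    qed
    ultimately show "(\<lambda>x. signed_path R w x \<ominus> signed_path R w'' x) \<in> J p q" by simp
  qed (use trans.IH in blast)
next
  case (swap i u v)
  let ?l = "u @ [Star i, Arr i] @ v" and ?h = "u @ [Arr (Suc i), Star (Suc i)] @ v"
  have iff: "walk n p ?l q \<longleftrightarrow> walk n p u (Suc i) \<and> walk n (Suc i) v q"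
    "walk n p ?h q \<longleftrightarrow> walk n p u (Suc i) \<and> walk n (Suc i) v q"
    using swap by (auto simp: walk_append)
  \<comment> \<open>A swap raises the weight by one, which turns the sum in the mesh relation into a
    difference of signed paths.\<close>
  have "sign R (weight ?h) = \<ominus> sign R (weight ?l)"
    using sign_Suc[of "weight ?l"] by simp
  then have eq: "signed_path R ?l x \<ominus> signed_path R ?h x =
      sign R (weight ?l) \<otimes> (basis_vector R ?l x \<oplus> basis_vector R ?h x)" for x
    by (simp add: signed_path_def minus_eq l_minus r_distr del: weight_append append.simps)
  have "(\<lambda>x. signed_path R ?l x \<ominus> signed_path R ?h x) \<in> J p q" if "walk n p ?l q"
    unfolding eq using that iff walk_endpoints[OF that] swap by (intro J_smult swap_in_J) auto
  then show ?case using iff by blast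
qed

text \<open>Signs are their own inverses, so a path lies in \<open>J\<close> together with its
  signed version; the equivalence case passes to signed paths and back.\<close>

lemma null_in_J:
  assumes "mesh_null n w" "walk n p w q"
  shows "basis_vector R w \<in> J p q"
  using assms
proof (induction arbitrary: p q rule: mesh_null.induct)
  case (bottom u v)
  then have u: "walk n p u 1" and v: "walk n 1 v q" by (auto simp: walk_append)
  have "mesh_relation R n 1 = basis_vector R [Arr 1, Star 1]" by (simp add: mesh_relation_eq)
  then show ?case using J_conjugate[OF u v relation] n_ge_2 by (simp add: path_comp_basis)
next
  case (top u v)
  then have u: "walk n p u n" and v: "walk n n v q" using n_ge_2 by (auto simp: walk_append)
  have "mesh_relation R n n = basis_vector R [Star (n - 1), Arr (n - 1)]"
    using n_ge_2 by (simp add: mesh_relation_eq)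
  then show ?case using J_conjugate[OF u v relation] n_ge_2 by (simp add: path_comp_basis)
next
  case (equiv w w')
  have pq: "p \<in> {1..n}" "q \<in> {1..n}" using walk_endpoints[OF equiv.prems] by auto
  have "walk n p w' q" using equiv_in_J[OF equiv.hyps(1)] equiv.prems by blast
  then have "signed_path R w' \<in> J p q"
    unfolding signed_path_def using pq by (intro J_smult equiv.IH) auto
  moreover have "(\<lambda>x. signed_path R w x \<ominus> signed_path R w' x) \<in> J p q"
    using equiv_in_J[OF equiv.hyps(1)] equiv.prems by blast
  ultimately have "(\<lambda>x. signed_path R w x \<ominus> signed_path R w' x \<oplus> signed_path R w' x) \<in> J p q"
    by (intro J_add pq)
  moreover have "signed_path R w x \<ominus> signed_path R w' x \<oplus> signed_path R w' x = signed_path R w x" for x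
    by (simp add: signed_path_def minus_eq a_assoc l_neg)
  ultimately have "(\<lambda>x. sign R (weight w) \<otimes> signed_path R w x) \<in> J p q"
    using pq by (intro J_smult) auto
  then show ?case by (simp add: signed_path_def)
qed

text \<open>Here the dimension count is replaced: modulo \<open>J\<close> every combination of paths
  equals the section of its image, over any ring. A combination with zero image therefore lies in
  \<open>J\<close> itself.\<close>

lemma section_image_in_J:
  assumes pq: "p \<in> {1..n}" "q \<in> {1..n}" and f: "f \<in> PH p q"
  shows "(\<lambda>w. f w \<ominus> path_section R n p q (path_image R n p q f) w) \<in> J p q"
proof -
  let ?E = "\<lambda>f. path_section R n p q (path_image R n p q f)"
  have E: "linear_map R (PM p q) (PM p q) ?E"
    by (rule linear_map_compose[OF path_image_linear path_section_linear[OF pq]])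
  have Ecl [simp]: "?E f w \<in> carrier R" if "f \<in> PH p q" for f w
    using linear_map_closed[OF E that] by simp
  show ?thesis using f
  proof (induction rule: free_module_induct)
    case zero
    have "?E (\<lambda>x. \<zero>) = (\<lambda>x. \<zero>)"
      using linear_map_zero[OF module_free_module module_free_module E] by simp
    then show ?case using J_zero[OF pq] by (simp add: minus_eq)
  next
    case (add f g)
    have "?E (\<lambda>x. f x \<oplus> g x) = (\<lambda>x. ?E f x \<oplus> ?E g x)"
      using linear_map_add[OF E add(1,2)] by simp
    moreover have "f w \<oplus> g w \<ominus> (?E f w \<oplus> ?E g w) = (f w \<ominus> ?E f w) \<oplus> (g w \<ominus> ?E g w)" for w
      using add(1,2) by (simp add: minus_eq minus_add a_ac)
    ultimately show ?case using J_add[OF pq add(3,4)] by simp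
  next
    case (smult c f)
    have "?E (\<lambda>x. c \<otimes> f x) = (\<lambda>x. c \<otimes> ?E f x)"
      using linear_map_smult[OF E smult(1,2)] by simp
    moreover have "c \<otimes> f w \<ominus> c \<otimes> ?E f w = c \<otimes> (f w \<ominus> ?E f w)" for w
      using smult(1,2) by (simp add: minus_eq r_distr r_minus)
    ultimately show ?case using J_smult[OF pq smult(1,3)] by simp
  next
    case (basis w)
    then have w: "walk n p w q" by simp
    note image = path_image_basis[OF w]
    show ?case
    proof (cases "stars w \<in> steps n p q")
      case True
      let ?w = "normal_form p (stars w) q"
      have "?E (basis_vector R w) = (\<lambda>x. sign R (weight w) \<otimes> signed_path R ?w x)"
        using linear_map_smult[OF path_section_linear[OF pq] sign_closed basis_H[OF True]] True
        by (simp add: image path_section_basis[OF pq True])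
      moreover have "basis_vector R w x \<ominus> sign R (weight w) \<otimes> signed_path R ?w x =
          sign R (weight w) \<otimes> (signed_path R w x \<ominus> signed_path R ?w x)" for x
        by (simp add: signed_path_def minus_eq r_distr r_minus)
      moreover have "(\<lambda>x. signed_path R w x \<ominus> signed_path R ?w x) \<in> J p q"
        using walk_reduction[OF w] True equiv_in_J w by simp
      ultimately show ?thesis using J_smult[OF pq sign_closed] by simp
    next
      case False
      then have "?E (basis_vector R w) = (\<lambda>x. \<zero>)"
        using linear_map_zero[OF module_H module_free_module path_section_linear[OF pq]] by (simp add: image)
      moreover have "basis_vector R w \<in> J p q" using walk_reduction[OF w] False null_in_J w by simp
      ultimately show ?thesis by (simp add: minus_eq)
    qed
  qed
qed

lemma kernel_in_J:
  assumes "p \<in> {1..n}" "q \<in> {1..n}" "f \<in> PH p q" "path_image R n p q f = (\<lambda>s. \<zero>)"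
  shows "f \<in> J p q"
proof -
  have "path_section R n p q (\<lambda>s. \<zero>) = (\<lambda>w. \<zero>)"
    using linear_map_zero[OF module_H module_free_module path_section_linear[OF assms(1,2)]] by simp
  then show ?thesis
    using section_image_in_J[OF assms(1-3)] assms(3,4) by (simp add: minus_eq)
qed

end

context mesh
begin

text \<open>One inclusion is functoriality of the map to the model, the other is the reduction of
  walks inside an arbitrary ideal above the relations.\<close>

theorem mesh_ideal_eq_kernel:
  assumes "p \<in> {1..n}" "q \<in> {1..n}"
  shows "mesh_ideal R n p q = {f \<in> PH p q. path_image R n p q f = (\<lambda>s. \<zero>)}"
proof
  show "{f \<in> PH p q. path_image R n p q f = (\<lambda>s. \<zero>)} \<subseteq> mesh_ideal R n p q"
  proof
    fix f assume f: "f \<in> {f \<in> PH p q. path_image R n p q f = (\<lambda>s. \<zero>)}"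
    show "f \<in> mesh_ideal R n p q"
      unfolding mesh_ideal_def
    proof (rule in_generated_idealI)
      fix J assume J: "two_sided_ideal R P J"
        and S: "\<And>p q. p \<in> Obj P \<Longrightarrow> q \<in> Obj P \<Longrightarrow> (if p = q then {mesh_relation R n q} else {}) \<subseteq> J p q"
      have "mesh_relation R n q \<in> J q q" if "q \<in> {1..n}" for q using S[of q q] that by simp
      then interpret mesh_ideal_above R n J by unfold_locales (rule J)
      show "f \<in> J p q" using kernel_in_J[OF assms] f by simp
    qed
  qed
qed (rule mesh_ideal_subset_kernel)

end

section \<open>The mesh category\<close>

context mesh
begin

abbreviation Q where "Q \<equiv> mesh_category R n"

lemma full_functor_path_image: "full_functor R T P (path_image R n) (mesh_ideal R n)"
proof (intro full_functor.intro full_functor_axioms.intro linear_category_truncated)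
  fix p q assume pq: "p \<in> Obj P" "q \<in> Obj P"
  then show "mesh_ideal R n p q = {f \<in> carrier (Hom P p q). path_image R n p q f = \<zero>\<^bsub>Hom T p q\<^esub>}"
    using mesh_ideal_eq_kernel by simp
  fix d assume "d \<in> carrier (Hom T p q)"
  then show "\<exists>f\<in>carrier (Hom P p q). path_image R n p q f = d"
    using pq path_image_section[of p q d] linear_map_closed[OF path_section_linear, of p q d]
    by (intro bexI[of _ "path_section R n p q d"]) auto
next
  fix q assume q: "q \<in> Obj P"
  then have w: "walk n q [] q" by simp
  then show "Ident P q \<in> carrier (Hom P q q)" by (simp only: path_category_simps path_basis)
  have "0 \<in> steps n q q" using q by (auto simp: steps_def)
  then show "path_image R n q q (Ident P q) = Ident T q"
    by (simp add: path_image_basis[OF w])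
qed (simp_all add: module_free_module path_comp_closed path_image_linear path_image_comp)

sublocale quotient: full_functor R T P "path_image R n" "mesh_ideal R n"
  by (rule full_functor_path_image)

abbreviation \<theta> where "\<theta> \<equiv> quotient.fibre"

text \<open>From here on morphisms of the mesh category are written as \<open>\<theta> p q c\<close>
  with \<open>c\<close> in the model, and computations take place on \<open>c\<close>.\<close>

sublocale iso: linear_cat_isomorphism R T Q \<theta>
  unfolding mesh_category_def by (rule quotient.isomorphism_quotient)

lemma linear_category_mesh: "linear_category R Q"
  by (rule iso.linear_category_image)

lemma Obj_mesh [simp]: "Obj Q = {1..n}"
  using iso.Obj_eq by simp

lemma module_mesh: "p \<in> {1..n} \<Longrightarrow> q \<in> {1..n} \<Longrightarrow> module R (Hom Q p q)"
  using iso.module_image by simp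

lemma theta_linear:
  "p \<in> {1..n} \<Longrightarrow> q \<in> {1..n} \<Longrightarrow> linear_map R (free_module R (steps n p q)) (Hom Q p q) (\<theta> p q)"
  using iso.linear by simp

lemma theta_bij: "p \<in> {1..n} \<Longrightarrow> q \<in> {1..n} \<Longrightarrow> bij_betw (\<theta> p q) (H p q) (carrier (Hom Q p q))"
  using iso.bij by simp

lemma theta_closed: "p \<in> {1..n} \<Longrightarrow> q \<in> {1..n} \<Longrightarrow> c \<in> H p q \<Longrightarrow> \<theta> p q c \<in> carrier (Hom Q p q)"
  by (rule linear_map_closed[OF theta_linear])

lemma theta_zero: "p \<in> {1..n} \<Longrightarrow> q \<in> {1..n} \<Longrightarrow> \<theta> p q (\<lambda>s. \<zero>) = \<zero>\<^bsub>Hom Q p q\<^esub>"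
  using iso.zero by simp

lemma theta_surj:
  assumes "p \<in> {1..n}" "q \<in> {1..n}" "x \<in> carrier (Hom Q p q)"
  obtains c where "c \<in> H p q" "x = \<theta> p q c"
  using theta_bij[OF assms(1,2)] assms(3) by (auto simp: bij_betw_def)

lemma theta_inj:
  "p \<in> {1..n} \<Longrightarrow> q \<in> {1..n} \<Longrightarrow> c \<in> H p q \<Longrightarrow> d \<in> H p q \<Longrightarrow> \<theta> p q c = \<theta> p q d \<longleftrightarrow> c = d"
  using theta_bij by (auto simp: bij_betw_def inj_on_def)

lemma theta_add:
  "p \<in> {1..n} \<Longrightarrow> q \<in> {1..n} \<Longrightarrow> c \<in> H p q \<Longrightarrow> d \<in> H p q \<Longrightarrow>
    \<theta> p q c \<oplus>\<^bsub>Hom Q p q\<^esub> \<theta> p q d = \<theta> p q (\<lambda>s. c s \<oplus> d s)"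
  using linear_map_add[OF theta_linear] by simp

lemma theta_smult:
  "p \<in> {1..n} \<Longrightarrow> q \<in> {1..n} \<Longrightarrow> k \<in> carrier R \<Longrightarrow> c \<in> H p q \<Longrightarrow>
    k \<odot>\<^bsub>Hom Q p q\<^esub> \<theta> p q c = \<theta> p q (\<lambda>s. k \<otimes> c s)"
  using linear_map_smult[OF theta_linear] by simp

lemma theta_comp:
  "p \<in> {1..n} \<Longrightarrow> q \<in> {1..n} \<Longrightarrow> r \<in> {1..n} \<Longrightarrow> c \<in> H p q \<Longrightarrow> d \<in> H q r \<Longrightarrow>
    Comp Q p q r (\<theta> q r d) (\<theta> p q c) = \<theta> p r (Comp T p q r d c)"
  using iso.comp by simp

lemma theta_ident: "q \<in> {1..n} \<Longrightarrow> Ident Q q = \<theta> q q (basis_vector R 0)"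
  using iso.ident by simp

lemma zero_in_steps: "q \<in> {1..n} \<Longrightarrow> 0 \<in> steps n q q"
  by (auto simp: steps_def)

definition coordinates where
  "coordinates p q = the_inv_into (H p q) (\<theta> p q)"

lemma coordinates_theta [simp]:
  "p \<in> {1..n} \<Longrightarrow> q \<in> {1..n} \<Longrightarrow> c \<in> H p q \<Longrightarrow> coordinates p q (\<theta> p q c) = c"
  unfolding coordinates_def by (rule the_inv_into_f_f[OF bij_betw_imp_inj_on[OF theta_bij]])

lemma coordinates_linear:
  "p \<in> {1..n} \<Longrightarrow> q \<in> {1..n} \<Longrightarrow> linear_map R (Hom Q p q) (free_module R (steps n p q)) (coordinates p q)"
  unfolding coordinates_def by (rule linear_map_inverse[OF theta_linear theta_bij module_H])

text \<open>The canonical projection from the path category, expressed through the model.\<close>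

definition path_class where
  "path_class p q f = \<theta> p q (path_image R n p q f)"

lemma path_class_linear:
  "p \<in> {1..n} \<Longrightarrow> q \<in> {1..n} \<Longrightarrow> linear_map R (PM p q) (Hom Q p q) (path_class p q)"
  unfolding path_class_def by (rule linear_map_compose[OF path_image_linear theta_linear])

lemma path_class_surj:
  assumes pq: "p \<in> {1..n}" "q \<in> {1..n}" and x: "x \<in> carrier (Hom Q p q)"
  obtains f where "f \<in> PH p q" "x = path_class p q f"
proof -
  obtain c where c: "c \<in> H p q" "x = \<theta> p q c" by (rule theta_surj[OF assms])
  show thesis
    by (rule that[of "path_section R n p q c"])
       (use c linear_map_closed[OF path_section_linear[OF pq]] in
        \<open>simp_all add: path_class_def path_image_section[OF pq]\<close>)
qed

lemma path_class_snoc: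
  assumes w: "walk n p w q" and e: "walk n q [e] r"
  shows "path_class p r (basis_vector R (w @ [e])) =
    Comp Q p q r (path_class q r (basis_vector R [e])) (path_class p q (basis_vector R w))"
proof -
  have "p \<in> {1..n}" "q \<in> {1..n}" "r \<in> {1..n}" using walk_endpoints[OF w] walk_endpoints[OF e] by auto
  then have "Comp Q p q r (path_class q r (basis_vector R [e])) (path_class p q (basis_vector R w)) =
      \<theta> p r (Comp T p q r (path_image R n q r (basis_vector R [e])) (path_image R n p q (basis_vector R w)))"
    unfolding path_class_def by (intro theta_comp path_image_closed path_basis w e)
  also have "\<dots> = \<theta> p r (path_image R n p r (Comp P p q r (basis_vector R [e]) (basis_vector R w)))"
    using path_image_comp[OF path_basis[OF w] path_basis[OF e]] by simp
  finally show ?thesis by (simp add: path_comp_basis path_class_def)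
qed

lemma arcs_double_A: "arcs (double_A n) = Arr ` {1..<n} \<union> Star ` {1..<n}"
  by (simp add: double_A_def)

lemma mesh_arrow_eq_path_class:
  assumes "e \<in> arcs (double_A n)"
  shows "walk n (arrow_source e) [e] (arrow_target e)"
    and "mesh_arrow R n e = path_class (arrow_source e) (arrow_target e) (basis_vector R [e])"
proof -
  show w: "walk n (arrow_source e) [e] (arrow_target e)"
    using assms by (auto simp: arcs_double_A)
  show "mesh_arrow R n e = path_class (arrow_source e) (arrow_target e) (basis_vector R [e])"
    unfolding mesh_arrow_def path_class_def
    using quotient.ideal_class_eq_fibre[of "arrow_source e" "arrow_target e" "basis_vector R [e]"]
      walk_endpoints[OF w] path_basis[OF w] by simp
qed

lemma walk_singleton:
  assumes "walk n p [e] q"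
  shows "e \<in> arcs (double_A n)" "arrow_source e = p" "arrow_target e = q"
proof -
  have "e \<in> arcs (double_A n) \<and> arrow_source e = p \<and> arrow_target e = q"
    using assms by (cases e) (auto simp: arcs_double_A)
  then show "e \<in> arcs (double_A n)" "arrow_source e = p" "arrow_target e = q" by blast+
qed

lemma mesh_arrow_Arr:
  assumes "q \<in> {1..<n}"
  shows "0 \<in> steps n q (q + 1)" and "mesh_arrow R n (Arr q) = \<theta> q (q + 1) (basis_vector R 0)"
proof -
  have w: "walk n q [Arr q] (q + 1)" using assms by auto
  show s: "0 \<in> steps n q (q + 1)" using assms by (auto simp: steps_def)
  show "mesh_arrow R n (Arr q) = \<theta> q (q + 1) (basis_vector R 0)"
    using s by (simp add: mesh_arrow_eq_path_class(2)[OF walk_singleton(1)[OF w]] path_class_def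
        path_image_basis[OF w, simplified])
qed

text \<open>The sign is that of the weight of the one-arrow path, which is the index of the
  arrow.\<close>

lemma mesh_arrow_Star:
  assumes "q \<in> {1..<n}"
  shows "1 \<in> steps n (q + 1) q"
    and "mesh_arrow R n (Star q) = \<theta> (q + 1) q (\<lambda>s. sign R q \<otimes> basis_vector R 1 s)"
proof -
  have w: "walk n (q + 1) [Star q] q" using assms by auto
  show s: "1 \<in> steps n (q + 1) q" using assms by (auto simp: steps_def)
  show "mesh_arrow R n (Star q) = \<theta> (q + 1) q (\<lambda>s. sign R q \<otimes> basis_vector R 1 s)"
    using s by (simp add: mesh_arrow_eq_path_class(2)[OF walk_singleton(1)[OF w]] path_class_def
        path_image_basis[OF w, simplified])
qed

text \<open>Paths span the hom modules, and every path arises from an identity by appending arrows.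
  Equality on objects comes first, so that both functors take values in the same hom
  modules.\<close>

lemma functor_determined_by_arrows:
  assumes F: "linear_functor R Q Q F0 F1" and G: "linear_functor R Q Q G0 G1"
    and obj: "\<And>p. p \<in> {1..n} \<Longrightarrow> F0 p = G0 p"
    and arrow: "\<And>e. e \<in> arcs (double_A n) \<Longrightarrow>
      F1 (arrow_source e) (arrow_target e) (mesh_arrow R n e) = G1 (arrow_source e) (arrow_target e) (mesh_arrow R n e)"
    and pq: "p \<in> {1..n}" "q \<in> {1..n}" and x: "x \<in> carrier (Hom Q p q)"
  shows "F1 p q x = G1 p q x"
proof -
  have lin: "linear_map R (Hom Q p q) (Hom Q (G0 p) (G0 q)) (F1 p q)"
    "linear_map R (Hom Q p q) (Hom Q (G0 p) (G0 q)) (G1 p q)"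
    using F G obj pq by (auto simp: linear_functor_def)
  have comp: "F1 p r (Comp Q p q r g f) = Comp Q (G0 p) (G0 q) (G0 r) (F1 q r g) (F1 p q f)"
    "G1 p r (Comp Q p q r g f) = Comp Q (G0 p) (G0 q) (G0 r) (G1 q r g) (G1 p q f)"
    if "p \<in> {1..n}" "q \<in> {1..n}" "r \<in> {1..n}" "f \<in> carrier (Hom Q p q)" "g \<in> carrier (Hom Q q r)" for p q r f g
    using F G obj that by (auto simp: linear_functor_def)
  have path: "F1 p q (path_class p q (basis_vector R w)) = G1 p q (path_class p q (basis_vector R w))"
    if "walk n p w q" for w
    using that
  proof (induction w arbitrary: q rule: rev_induct)
    case Nil
    then have p: "q = p" "p \<in> {1..n}" by auto
    then have "path_class p p (basis_vector R []) = Ident Q p"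
      using quotient.F_ident[of p] theta_ident by (simp add: path_class_def)
    then show ?case using F G obj p by (simp add: linear_functor_def)
  next
    case (snoc e w)
    then obtain r where w: "walk n p w r" and e: "walk n r [e] q" unfolding walk_append by blast
    have o: "p \<in> {1..n}" "r \<in> {1..n}" "q \<in> {1..n}" using walk_endpoints[OF w] walk_endpoints[OF e] by auto
    have cl: "path_class p r (basis_vector R w) \<in> carrier (Hom Q p r)"
      "path_class r q (basis_vector R [e]) \<in> carrier (Hom Q r q)"
      using linear_map_closed[OF path_class_linear] o path_basis w e by blast+
    have "F1 r q (path_class r q (basis_vector R [e])) = G1 r q (path_class r q (basis_vector R [e]))"
      using arrow[OF walk_singleton(1)[OF e]] mesh_arrow_eq_path_class(2)[OF walk_singleton(1)[OF e]]
        walk_singleton(2,3)[OF e] by simp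
    then show ?case
      unfolding path_class_snoc[OF w e] using comp[OF o cl] snoc.IH[OF w] by simp
  qed
  have tgt: "G0 p \<in> {1..n}" "G0 q \<in> {1..n}" using G pq by (auto simp: linear_functor_def)
  obtain f where f: "f \<in> PH p q" "x = path_class p q f" by (rule path_class_surj[OF pq x])
  have "F1 p q (path_class p q f) = G1 p q (path_class p q f)"
    by (rule free_module_linear_ext[OF f(1) module_mesh[OF tgt] linear_map_compose[OF path_class_linear[OF pq] lin(1)]
          linear_map_compose[OF path_class_linear[OF pq] lin(2)]])
       (simp add: path)
  then show ?thesis using f(2) by simp
qed

section \<open>Ranks and the Serre functor of the mesh category\<close>

lemma free_of_rank_mesh:
  assumes "\<one> \<noteq> \<zero>" "p \<in> {1..n}" "q \<in> {1..n}"
  shows "free_of_rank R (Hom Q p q) (Min {p, q, n + 1 - p, n + 1 - q})"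
  using free_of_rank_transport[OF module_H module_mesh theta_linear theta_bij] assms
    free_of_rank_free_module[OF assms(1) finite_steps[of n p q]]
  by (simp add: card_steps)

definition serre_map where
  "serre_map p q x = \<theta> (n + 1 - p) (n + 1 - q) (truncated_serre R n p q (coordinates p q x))"

lemma dual_obj: "p \<in> {1..n} \<Longrightarrow> n + 1 - p \<in> {1..n}"
  by auto

lemma serre_map_theta:
  "p \<in> {1..n} \<Longrightarrow> q \<in> {1..n} \<Longrightarrow> c \<in> H p q \<Longrightarrow>
    serre_map p q (\<theta> p q c) = \<theta> (n + 1 - p) (n + 1 - q) (truncated_serre R n p q c)"
  by (simp add: serre_map_def)

lemma serre_map_functor: "linear_functor R Q Q (\<lambda>p. n + 1 - p) serre_map"
  unfolding linear_functor_def Obj_mesh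
proof (intro conjI ballI)
  fix p q assume pq: "p \<in> {1..n}" "q \<in> {1..n}"
  show "linear_map R (Hom Q p q) (Hom Q (n + 1 - p) (n + 1 - q)) (serre_map p q)"
    unfolding serre_map_def
    by (intro linear_map_compose[OF linear_map_compose[OF coordinates_linear serre_linear] theta_linear] pq dual_obj)
  fix r f g assume r: "r \<in> {1..n}" and "f \<in> carrier (Hom Q p q)" "g \<in> carrier (Hom Q q r)"
  then obtain c d where c: "c \<in> H p q" "f = \<theta> p q c" and d: "d \<in> H q r" "g = \<theta> q r d"
    by (elim theta_surj[OF pq] theta_surj[OF pq(2) r])
  show "serre_map p r (Comp Q p q r g f) =
      Comp Q (n + 1 - p) (n + 1 - q) (n + 1 - r) (serre_map q r g) (serre_map p q f)"
    unfolding c(2) d(2) theta_comp[OF pq r c(1) d(1)] serre_map_theta[OF pq c(1)] serre_map_theta[OF pq(2) r d(1)]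
      serre_map_theta[OF pq(1) r comp_closed[OF c(1) d(1)]] serre_comp[OF pq r c(1) d(1)]
    by (intro theta_comp[symmetric] dual_obj pq r serre_closed c d)
next
  fix q assume q: "q \<in> {1..n}"
  note 0 = zero_in_steps[OF q]
  have "sign R (n * (q + q)) = \<one>" by (simp add: sign_eq)
  then have "truncated_serre R n q q (basis_vector R 0) = basis_vector R 0"
    using serre_basis[OF q q 0] by simp
  then show "serre_map q q (Ident Q q) = Ident Q (n + 1 - q)"
    using serre_map_theta[OF q q basis_H[OF 0]] theta_ident[OF q] theta_ident[OF dual_obj[OF q]] by simp
qed (rule dual_obj)

lemma serre_functor_mesh: "serre_functor R Q (\<lambda>p. n + 1 - p) serre_map"
proof (rule linear_category.serre_functor_of_trace[OF linear_category_mesh serre_map_functor,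
      where t = "\<lambda>p x. truncated_trace R n p (coordinates p (n + 1 - p) x)"], unfold Obj_mesh)
  fix p assume p: "p \<in> {1..n}"
  then show "n + 1 - (n + 1 - p) = p" by auto
  show "linear_map R (Hom Q p (n + 1 - p)) (ring_module R) (\<lambda>x. truncated_trace R n p (coordinates p (n + 1 - p) x))"
    by (intro linear_map_compose[OF coordinates_linear trace_linear] p dual_obj)
  fix q assume q: "q \<in> {1..n}"
  note p' = dual_obj[OF p] and q' = dual_obj[OF q]
  \<comment> \<open>Four of the conditions on the trace involve a second object; in its twisted
    symmetry \<open>q\<close> stands for the \<open>p'\<close> of that condition.\<close>
  {
    fix f assume "f \<in> carrier (Hom Q p q)"
    then obtain c where c: "c \<in> H p q" "f = \<theta> p q c" by (elim theta_surj[OF p q])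
    have "n + 1 - (n + 1 - p) = p" "n + 1 - (n + 1 - q) = q" using p q by auto
    then show "serre_map (n + 1 - p) (n + 1 - q) (serre_map p q f) = f"
      using serre_map_theta[OF p q c(1)] serre_map_theta[OF p' q' serre_closed[OF p q c(1)]]
        serre_serre[OF p q c(1)] c(2) by simp
  next
    fix f v assume "f \<in> carrier (Hom Q q p)" "v \<in> carrier (Hom Q p (n + 1 - q))"
    then obtain c d where c: "c \<in> H q p" "f = \<theta> q p c" and d: "d \<in> H p (n + 1 - q)" "v = \<theta> p (n + 1 - q) d"
      by (elim theta_surj[OF q p] theta_surj[OF p q'])
    note S = serre_closed[OF q p c(1)]
    show "truncated_trace R n q (coordinates q (n + 1 - q) (Comp Q q p (n + 1 - q) v f)) =
        truncated_trace R n p (coordinates p (n + 1 - p) (Comp Q p (n + 1 - q) (n + 1 - p) (serre_map q p f) v))"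
      unfolding c(2) d(2) serre_map_theta[OF q p c(1)] theta_comp[OF q p q' c(1) d(1)] theta_comp[OF p q' p' d(1) S]
        coordinates_theta[OF q q' comp_closed[OF c(1) d(1)]] coordinates_theta[OF p p' comp_closed[OF d(1) S]]
      by (rule trace_comm[OF p q c(1) d(1)])
  next
    fix h assume "h \<in> carrier (Hom Q p q)"
      and zero: "\<And>u. u \<in> carrier (Hom Q q (n + 1 - p)) \<Longrightarrow>
        truncated_trace R n p (coordinates p (n + 1 - p) (Comp Q p q (n + 1 - p) u h)) = \<zero>"
    then obtain c where c: "c \<in> H p q" "h = \<theta> p q c" by (elim theta_surj[OF p q])
    have "c s = \<zero>" for s
    proof (cases "s \<in> steps n p q")
      case True
      then have s': "p - 1 - s \<in> steps n q (n + 1 - p)" using p q by (auto simp: steps_def)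
      note b = basis_H[OF s']
      \<comment> \<open>Testing against the dual basis vector, of exponent \<open>p - 1 - s\<close>,
        isolates the coefficient at \<open>s\<close>.\<close>
      have "sign R (n * p) \<otimes> c s = \<zero>"
        using zero[OF theta_closed[OF q p' b]]
        unfolding c(2) theta_comp[OF p q p' c(1) b] coordinates_theta[OF p p' comp_closed[OF c(1) b]]
          trace_pairing[OF p True c(1)] .
      then have "sign R (n * p) \<otimes> (sign R (n * p) \<otimes> c s) = \<zero>" by simp
      then show ?thesis using c(1) by simp
    qed (use c(1) in \<open>simp add: H_iff\<close>)
    then have "c = (\<lambda>s. \<zero>)" by blast
    then show "h = \<zero>\<^bsub>Hom Q p q\<^esub>" using theta_zero[OF p q] c(2) by simp
  next
    fix \<phi> assume \<phi>: "linear_map R (Hom Q q (n + 1 - p)) (ring_module R) \<phi>"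
    have \<phi>_cl: "\<phi> u \<in> carrier R" if "u \<in> carrier (Hom Q q (n + 1 - p))" for u
      using linear_map_closed[OF \<phi> that] by (simp add: ring_module_def)
    have steps_dual: "p - 1 - s \<in> steps n q (n + 1 - p)" if "s \<in> steps n p q" for s
      using that p q by (auto simp: steps_def)
    \<comment> \<open>The coefficient at \<open>s\<close> of the representing element is the value
      of \<open>\<phi>\<close> on the dual basis vector; the sign in front cancels the one that the
      trace will add.\<close>
    define c where "c = (\<lambda>s. if s \<in> steps n p q
      then sign R (n * p) \<otimes> \<phi> (\<theta> q (n + 1 - p) (basis_vector R (p - 1 - s))) else \<zero>)"
    have c: "c \<in> H p q"
      unfolding H_iff c_def using \<phi>_cl[OF theta_closed[OF q p' basis_H[OF steps_dual]]] by auto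
    show "\<exists>h\<in>carrier (Hom Q p q). \<forall>u\<in>carrier (Hom Q q (n + 1 - p)).
        truncated_trace R n p (coordinates p (n + 1 - p) (Comp Q p q (n + 1 - p) u h)) = \<phi> u"
    proof (intro bexI[of _ "\<theta> p q c"] ballI theta_closed p q c)
      fix u assume "u \<in> carrier (Hom Q q (n + 1 - p))"
      then obtain d where d: "d \<in> H q (n + 1 - p)" "u = \<theta> q (n + 1 - p) d" by (elim theta_surj[OF q p'])
      have "truncated_trace R n p (Comp T p q (n + 1 - p) d c) = \<phi> (\<theta> q (n + 1 - p) d)"
      proof (rule free_module_linear_ext[OF d(1) module_ring_module
            linear_map_compose[OF comp_linear_left[OF c] trace_linear] linear_map_compose[OF theta_linear[OF q p'] \<phi>]])
        fix t assume t: "t \<in> steps n q (n + 1 - p)"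
        then have s: "p - 1 - t \<in> steps n p q" and st: "p - 1 - (p - 1 - t) = t" using p q by (auto simp: steps_def)
        have "truncated_trace R n p (Comp T p q (n + 1 - p) (basis_vector R t) c) =
            sign R (n * p) \<otimes> c (p - 1 - t)"
          using trace_pairing[OF p s c] unfolding st .
        also have "\<dots> = sign R (n * p) \<otimes> (sign R (n * p) \<otimes> \<phi> (\<theta> q (n + 1 - p) (basis_vector R t)))"
          unfolding c_def st using s by simp
        also have "\<dots> = \<phi> (\<theta> q (n + 1 - p) (basis_vector R t))"
          by (rule sign_sign_left[OF \<phi>_cl[OF theta_closed[OF q p' basis_H[OF t]]]])
        finally show "truncated_trace R n p (Comp T p q (n + 1 - p) (basis_vector R t) c) =
            \<phi> (\<theta> q (n + 1 - p) (basis_vector R t))" .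
      qed
      then show "truncated_trace R n p (coordinates p (n + 1 - p) (Comp Q p q (n + 1 - p) u (\<theta> p q c))) = \<phi> u"
        unfolding d(2) theta_comp[OF p q p' c d(1)] coordinates_theta[OF p p' comp_closed[OF c d(1)]] .
    qed
  }
qed

text \<open>The twist contributes the sign of \<open>n\<close> to each arrow, the weight of a
  downward arrow the sign of its index. In the first formula \<open>n\<close> splits as
  \<open>q + (n - q)\<close>, and the second summand is absorbed by \<open>Star (n - q)\<close>; in
  the second formula \<open>q + n\<close> has the parity of \<open>n - q\<close>.\<close>

lemma serre_formulae_mesh: "serre_formulae R n (\<lambda>p. n + 1 - p) serre_map"
  unfolding serre_formulae_def
proof (intro conjI ballI)
  fix q assume q: "q \<in> {1..<n}"
  then have o: "q \<in> {1..n}" "q + 1 \<in> {1..n}" "n - q \<in> {1..<n}" "n - q \<in> {1..n}" "n + 1 - q \<in> {1..n}"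
    and eq: "n + 1 - (q + 1) = n - q" "n - q + 1 = n + 1 - q" by auto
  note A = mesh_arrow_Arr[OF q] mesh_arrow_Arr[OF o(3), unfolded eq]
  note B = mesh_arrow_Star[OF q] mesh_arrow_Star[OF o(3), unfolded eq]
  have parity: "even (n * (q + (q + 1))) = even n" "even (n * ((q + 1) + q)) = even n" by auto
  have "sign R (n * (q + (q + 1))) = sign R (q + (n - q))"
    using q parity by (intro sign_cong) auto
  then have s1: "sign R (n * (q + (q + 1))) = sign R q \<otimes> sign R (n - q)" by (simp only: sign_add)
  have "sign R (n - q) = sign R (q + n * ((q + 1) + q))"
    using q parity by (intro sign_cong) auto
  then have s2: "sign R (n - q) = sign R q \<otimes> sign R (n * ((q + 1) + q))" by (simp only: sign_add)
  have "serre_map q (q + 1) (mesh_arrow R n (Arr q)) =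
      \<theta> (n + 1 - q) (n - q) (\<lambda>s. sign R (n * (q + (q + 1))) \<otimes> basis_vector R 1 s)"
    unfolding A(2) serre_map_theta[OF o(1,2) basis_H[OF A(1)]] serre_basis[OF o(1,2) A(1)] eq by simp
  also have "\<dots> = \<theta> (n + 1 - q) (n - q) (\<lambda>s. sign R q \<otimes> (sign R (n - q) \<otimes> basis_vector R 1 s))"
    unfolding s1 by (simp add: m_assoc)
  also have "\<dots> = sign R q \<odot>\<^bsub>Hom Q (n + 1 - q) (n - q)\<^esub> mesh_arrow R n (Star (n - q))"
    unfolding B(4)
    by (rule theta_smult[OF o(5,4) sign_closed free_module_smult_closed[OF sign_closed basis_H[OF B(3)]], symmetric])
  finally show "serre_map q (q + 1) (mesh_arrow R n (Arr q)) =
      (\<ominus> \<one>) [^] q \<odot>\<^bsub>Hom Q (n + 1 - q) (n - q)\<^esub> mesh_arrow R n (Star (n - q))"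
    by (simp only: sign_def)
  have "serre_map (q + 1) q (mesh_arrow R n (Star q)) =
      \<theta> (n - q) (n + 1 - q) (truncated_serre R n (q + 1) q (\<lambda>s. sign R q \<otimes> basis_vector R 1 s))"
    unfolding B(2) serre_map_theta[OF o(2,1) free_module_smult_closed[OF sign_closed basis_H[OF B(1)]]] eq ..
  also have "truncated_serre R n (q + 1) q (\<lambda>s. sign R q \<otimes> basis_vector R 1 s) =
      (\<lambda>s. sign R q \<otimes> (sign R (n * ((q + 1) + q)) \<otimes> basis_vector R 0 s))"
    using linear_map_smult[OF serre_linear[OF o(2,1)] sign_closed basis_H[OF B(1)], of q]
    unfolding serre_basis[OF o(2,1) B(1)] by simp
  also have "\<dots> = (\<lambda>s. sign R (n - q) \<otimes> basis_vector R 0 s)"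
    unfolding s2 by (simp add: m_assoc)
  also have "\<theta> (n - q) (n + 1 - q) \<dots> = sign R (n - q) \<odot>\<^bsub>Hom Q (n - q) (n + 1 - q)\<^esub> mesh_arrow R n (Arr (n - q))"
    unfolding A(4) by (rule theta_smult[OF o(4,5) sign_closed basis_H[OF A(3)], symmetric])
  finally show "serre_map (q + 1) q (mesh_arrow R n (Star q)) =
      (\<ominus> \<one>) [^] (n - q) \<odot>\<^bsub>Hom Q (n - q) (n + 1 - q)\<^esub> mesh_arrow R n (Arr (n - q))"
    by (simp only: sign_def)
qed simp

text \<open>This makes precise that the formulae determine the action on morphisms: the comparison
  is with an arbitrary linear functor satisfying them.\<close>

lemma serre_functor_unique:
  assumes F: "linear_functor R Q Q F0 F1" and formulae: "serre_formulae R n F0 F1"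
    and "p \<in> {1..n}" "q \<in> {1..n}" "x \<in> carrier (Hom Q p q)"
  shows "F1 p q x = serre_map p q x"
proof (rule functor_determined_by_arrows[OF F serre_map_functor _ _ assms(3-5)])
  show "F0 p = n + 1 - p" if "p \<in> {1..n}" for p
    using formulae that by (simp add: serre_formulae_def)
  show "F1 (arrow_source e) (arrow_target e) (mesh_arrow R n e) =
      serre_map (arrow_source e) (arrow_target e) (mesh_arrow R n e)" if "e \<in> arcs (double_A n)" for e
    using that formulae serre_formulae_mesh by (auto simp: double_A_def serre_formulae_def)
qed

section \<open>The arrow ideal, its powers and the retraction property\<close>

definition filtration where
  "filtration m p q = \<theta> p q ` truncated_filtration R n m p q"

lemma two_sided_ideal_filtration: "two_sided_ideal R Q (filtration m)"
proof -
  have "two_sided_ideal R T (truncated_filtration R n m)"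
    unfolding two_sided_ideal_def
  proof (intro conjI ballI)
    fix p q
    show "submodule (truncated_filtration R n m p q) R (Hom T p q)"
      unfolding truncated_filtration_def truncated_category_simps
      by (rule submodule_free_module_mono) auto
  next
    fix p q r f g assume "f \<in> truncated_filtration R n m p q" "g \<in> carrier (Hom T q r)"
    then show "Comp T p q r g f \<in> truncated_filtration R n m p r"
      using filtration_comp[of f m p q g 0 r] by (simp add: filtration_0)
  next
    fix p q r f g assume "f \<in> carrier (Hom T p q)" "g \<in> truncated_filtration R n m q r"
    then show "Comp T p q r g f \<in> truncated_filtration R n m p r"
      using filtration_comp[of f 0 p q g m r] by (simp add: filtration_0)
  qed
  then show ?thesis
    using iso.two_sided_ideal_image unfolding filtration_def by blast
qed

lemma filtration_comp_image:
  assumes "p \<in> {1..n}" "q \<in> {1..n}" "r \<in> {1..n}" "f \<in> filtration m p q" "g \<in> filtration k q r"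
  shows "Comp Q p q r g f \<in> filtration (m + k) p r"
proof -
  obtain c d where c: "c \<in> truncated_filtration R n m p q" "f = \<theta> p q c"
    and d: "d \<in> truncated_filtration R n k q r" "g = \<theta> q r d"
    using assms(4,5) unfolding filtration_def by blast
  then have "Comp Q p q r g f = \<theta> p r (Comp T p q r d c)"
    using theta_comp[OF assms(1-3)] by (simp add: filtration_iff)
  then show ?thesis unfolding filtration_def using filtration_comp[OF c(1) d(1)] by blast
qed

text \<open>The arrows have length 1. Conversely, a basis vector of positive length is up to sign
  the class of its normal form, from which a last arrow can be split off.\<close>

lemma arrow_ideal_eq:
  assumes pq: "p \<in> {1..n}" "q \<in> {1..n}"
  shows "arrow_ideal R n p q = filtration 1 p q"
proof
  show "arrow_ideal R n p q \<subseteq> filtration 1 p q"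
    unfolding arrow_ideal_def
  proof (rule generated_ideal_least[OF two_sided_ideal_filtration], clarify)
    fix e assume "e \<in> arcs (double_A n)"
    then consider i where "i \<in> {1..<n}" "e = Arr i" | i where "i \<in> {1..<n}" "e = Star i"
      by (auto simp: double_A_def)
    then show "mesh_arrow R n e \<in> filtration 1 (arrow_source e) (arrow_target e)"
    proof cases
      case (1 i)
      have "basis_vector R 0 \<in> truncated_filtration R n 1 i (i + 1)"
        unfolding filtration_iff using basis_H[OF mesh_arrow_Arr(1)[OF 1(1)]]
        by (simp add: basis_vector_def)
      then show ?thesis using mesh_arrow_Arr(2)[OF 1(1)] 1(2) by (auto simp: filtration_def)
    next
      case (2 i)
      have "(\<lambda>s. sign R i \<otimes> basis_vector R 1 s) \<in> truncated_filtration R n 1 (i + 1) i"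
        using mesh_arrow_Star(1)[OF 2(1)] free_module_smult_closed[OF sign_closed basis_H]
        by (auto simp: filtration_iff basis_vector_def)
      then show ?thesis using mesh_arrow_Star(2)[OF 2(1)] 2(2) by (auto simp: filtration_def)
    qed
  qed
  show "filtration 1 p q \<subseteq> arrow_ideal R n p q"
  proof
    fix x assume "x \<in> filtration 1 p q"
    then obtain c where c: "c \<in> truncated_filtration R n 1 p q" "x = \<theta> p q c" by (auto simp: filtration_def)
    show "x \<in> arrow_ideal R n p q"
      unfolding arrow_ideal_def
    proof (rule in_generated_idealI)
      fix J assume J: "two_sided_ideal R Q J"
        and S: "\<And>p q. p \<in> Obj Q \<Longrightarrow> q \<in> Obj Q \<Longrightarrow>
          {mesh_arrow R n e |e. e \<in> arcs (double_A n) \<and> arrow_source e = p \<and> arrow_target e = q} \<subseteq> J p q"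
      have sub: "submodule (J p q) R (Hom Q p q)" using two_sided_ideal_submodule[OF J] pq by simp
      have H: "f \<in> H p q" if "f \<in> carrier (free_module R {s \<in> steps n p q. p + 1 \<le> q + 2 * s})" for f
        using that filtration_iff[of f 1 p q] by (simp add: truncated_filtration_def)
      have "\<theta> p q c \<in> J p q"
        using c(1) unfolding truncated_filtration_def
      proof (induction rule: free_module_induct)
        case zero
        then show ?case using submodule_zero[OF sub] theta_zero[OF pq] by simp
      next
        case (add f g)
        then show ?case using submodule_add[OF sub add(3,4)] theta_add[OF pq] H by simp
      next
        case (smult k f)
        then show ?case using submodule_smult[OF sub smult(1,3)] theta_smult[OF pq] H by simp
      next
        case (basis s)
        let ?w = "normal_form p s q"
        have s: "s \<in> steps n p q" and pos: "p + 1 \<le> q + 2 * s" using basis by auto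
        have w: "walk n p ?w q" by (rule walk_normal_form[OF pq s])
        have st: "stars ?w = s" using s by (intro stars_normal_form) (simp add: steps_def)
        \<comment> \<open>By \<open>pos\<close> the length \<open>q + 2 * s - p\<close> of the
          normal form is positive.\<close>
        have "?w \<noteq> []" using walk_length[OF w] st pos by auto
        then obtain v e where ve: "?w = v @ [e]" using rev_exhaust by blast
        then obtain r where v: "walk n p v r" and e: "walk n r [e] q" using w unfolding ve walk_append by blast
        note a = walk_singleton[OF e]
        have r: "r \<in> {1..n}" using walk_endpoints[OF v] by blast
        have "mesh_arrow R n e \<in> J r q" using S[of r q] r pq a by auto
        then have "path_class r q (basis_vector R [e]) \<in> J r q"
          using mesh_arrow_eq_path_class(2)[OF a(1)] a(2,3) by simp
        then have "path_class p q (basis_vector R ?w) \<in> J p q"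
          unfolding ve path_class_snoc[OF v e]
          by (intro two_sided_ideal_comp_right[OF J])
             (use pq r linear_map_closed[OF path_class_linear[OF pq(1) r] path_basis[OF v]] in auto)
        then have "sign R (weight ?w) \<odot>\<^bsub>Hom Q p q\<^esub> path_class p q (basis_vector R ?w) \<in> J p q"
          by (rule submodule_smult[OF sub sign_closed])
        moreover have "sign R (weight ?w) \<odot>\<^bsub>Hom Q p q\<^esub> path_class p q (basis_vector R ?w) = \<theta> p q (basis_vector R s)"
          using theta_smult[OF pq sign_closed path_image_closed[OF path_basis[OF w]]] s
          by (simp add: path_class_def path_image_basis[OF w] st)
        ultimately show ?case by simp
      qed
      then show "x \<in> J p q" using c(2) by simp
    qed
  qed
qed

text \<open>Every further factor from the arrow ideal raises the length bound by one.\<close>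

lemma ideal_power_subset_filtration:
  "p \<in> {1..n} \<Longrightarrow> q \<in> {1..n} \<Longrightarrow> ideal_power R Q (arrow_ideal R n) m p q \<subseteq> filtration m p q"
proof (induction m arbitrary: p q)
  case 0
  then show ?case using theta_bij by (simp add: filtration_def filtration_0 bij_betw_def)
next
  case (Suc m)
  show ?case
    unfolding ideal_power.simps ideal_product_def
  proof (rule generated_ideal_least[OF two_sided_ideal_filtration], clarify)
    fix p r q f g
    assume o: "p \<in> Obj Q" "r \<in> Obj Q" "q \<in> Obj Q"
      and f: "f \<in> ideal_power R Q (arrow_ideal R n) m p q" and g: "g \<in> arrow_ideal R n q r"
    have "f \<in> filtration m p q" "g \<in> filtration 1 q r"
      using Suc.IH[of p q] f g o arrow_ideal_eq[of q r] by auto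
    then show "Comp Q p q r g f \<in> filtration (Suc m) p r"
      using filtration_comp_image[of p q r f m g 1] o by simp
  qed
qed

lemma zero_ideal_power: "zero_ideal Q (ideal_power R Q (arrow_ideal R n) n)"
proof -
  \<comment> \<open>The exponent is exposed as a successor, since successor powers are generated
    ideals and so contain zero.\<close>
  obtain m where m: "n = Suc m" using n_ge_2 by (cases n) auto
  have "ideal_power R Q (arrow_ideal R n) (Suc m) p q \<subseteq> {\<zero>\<^bsub>Hom Q p q\<^esub>}" if "p \<in> Obj Q" "q \<in> Obj Q" for p q
  proof -
    have "p \<in> {1..n}" "q \<in> {1..n}" using that by simp_all
    then show ?thesis
      using ideal_power_subset_filtration[of p q n] filtration_n[of p q] theta_zero[of p q]
      by (simp add: filtration_def m[symmetric])
  qed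
  then have "zero_ideal Q (ideal_power R Q (arrow_ideal R n) (Suc m))"
    by (rule linear_category.zero_ideal_power_Suc_subset[OF linear_category_mesh])
  then show ?thesis using m by simp
qed

lemma arrow_ideal_pseudo_radical:
  assumes "p \<in> {1..n}" "q \<in> {1..n}"
  shows "arrow_ideal R n p q = pseudo_radical Q (\<lambda>q. arrow_ideal R n q q) p q"
  using theta_bij[OF assms] arrow_ideal_eq[OF assms] filtration_1_off_diagonal[of p q]
  by (auto simp: pseudo_radical_def filtration_def bij_betw_def)

text \<open>At a vertex the arrow ideal consists of the elements with zero coefficient at 0, so the
  complement of the multiples of the identity is obtained by splitting off that coefficient.
  Products, also those through another vertex, stay in the ideal because two factors of length at
  least 1 have a product of length at least 2.\<close>

lemma retraction_family_mesh: "retraction_family R Q (\<lambda>q. arrow_ideal R n q q)"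
proof -
  have diag: "arrow_ideal R n q q = \<theta> q q ` {c \<in> H q q. c 0 = \<zero>}" if "q \<in> {1..n}" for q
    using arrow_ideal_eq[OF that that] by (simp add: filtration_def filtration_1_diagonal[simplified])
  have comp: "Comp Q p q p g f \<in> arrow_ideal R n p p"
    if "p \<in> {1..n}" "q \<in> {1..n}" "f \<in> filtration 1 p q" "g \<in> filtration 1 q p" for p q f g
  proof -
    have "Comp Q p q p g f \<in> filtration (1 + 1) p p" by (rule filtration_comp_image[OF that(1,2,1,3,4)])
    then have "Comp Q p q p g f \<in> filtration 1 p p"
      using image_mono[OF filtration_mono[of 1 "1 + 1" p p], of "\<theta> p p"] unfolding filtration_def by auto
    then show ?thesis using arrow_ideal_eq[OF that(1,1)] by simp
  qed
  have scalar: "x \<odot>\<^bsub>Hom Q q q\<^esub> Ident Q q = \<theta> q q (\<lambda>s. x \<otimes> basis_vector R 0 s)"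
    "(\<lambda>s. x \<otimes> basis_vector R 0 s) \<in> H q q" if "q \<in> {1..n}" "x \<in> carrier R" for q x
    using theta_smult[OF that(1,1,2) basis_H[OF zero_in_steps[OF that(1)]]] theta_ident[OF that(1)]
      free_module_smult_closed[OF that(2) basis_H[OF zero_in_steps[OF that(1)]]] by simp_all
  show ?thesis
    unfolding retraction_family_def Obj_mesh
  proof (intro conjI ballI impI)
    fix q assume q: "q \<in> {1..n}"
    let ?k = "{x \<odot>\<^bsub>Hom Q q q\<^esub> Ident Q q |x. x \<in> carrier R}"
    interpret M: Module.module R "Hom Q q q" by (rule module_mesh[OF q q])
    show "submodule (arrow_ideal R n q q) R (Hom Q q q)"
      using two_sided_ideal_submodule[OF two_sided_ideal_filtration, of q q 1] arrow_ideal_eq[OF q q] q by simp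
    show "?k <+>\<^bsub>Hom Q q q\<^esub> arrow_ideal R n q q = carrier (Hom Q q q)"
    proof (intro equalityI subsetI)
      fix x assume "x \<in> ?k <+>\<^bsub>Hom Q q q\<^esub> arrow_ideal R n q q"
      then obtain a c where "a \<in> carrier R" "c \<in> H q q"
        "x = (a \<odot>\<^bsub>Hom Q q q\<^esub> Ident Q q) \<oplus>\<^bsub>Hom Q q q\<^esub> \<theta> q q c"
        by (auto simp: set_add_def set_mult_def diag[OF q])
      then show "x \<in> carrier (Hom Q q q)"
        using scalar[OF q] theta_closed[OF q q] by simp
    next
      fix x assume "x \<in> carrier (Hom Q q q)"
      then obtain c where c: "c \<in> H q q" "x = \<theta> q q c" by (elim theta_surj[OF q q])
      let ?d = "c(0 := \<zero>)"
      have d: "?d \<in> H q q" using c(1) by (auto simp: H_iff)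
      have c0: "c 0 \<in> carrier R" using c(1) by simp
      have "c = (\<lambda>s. c 0 \<otimes> basis_vector R 0 s \<oplus> ?d s)"
        using c(1) by (auto simp: basis_vector_def fun_eq_iff)
      then have "x = (c 0 \<odot>\<^bsub>Hom Q q q\<^esub> Ident Q q) \<oplus>\<^bsub>Hom Q q q\<^esub> \<theta> q q ?d"
        unfolding c(2) scalar(1)[OF q c0] theta_add[OF q q scalar(2)[OF q c0] d] by simp
      moreover have "\<theta> q q ?d \<in> arrow_ideal R n q q" using d by (auto simp: diag[OF q])
      ultimately show "x \<in> ?k <+>\<^bsub>Hom Q q q\<^esub> arrow_ideal R n q q"
        using c0 by (auto simp: set_add_def set_mult_def)
    qed
    show "?k \<inter> arrow_ideal R n q q = {\<zero>\<^bsub>Hom Q q q\<^esub>}"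
    proof (intro equalityI subsetI)
      fix x assume "x \<in> ?k \<inter> arrow_ideal R n q q"
      then obtain a c where a: "a \<in> carrier R" "x = a \<odot>\<^bsub>Hom Q q q\<^esub> Ident Q q"
        and c: "c \<in> H q q" "c 0 = \<zero>" "x = \<theta> q q c"
        unfolding diag[OF q] by blast
      then have "(\<lambda>s. a \<otimes> basis_vector R 0 s) = c"
        using scalar[OF q a(1)] theta_inj[OF q q, of "\<lambda>s. a \<otimes> basis_vector R 0 s" c] by simp
      \<comment> \<open>Comparison of the coefficients at 0, where \<open>c\<close>
        vanishes.\<close>
      then have "a = \<zero>" using c(2) a(1) by (auto simp: basis_vector_def dest: fun_cong[of _ _ 0])
      then show "x \<in> {\<zero>\<^bsub>Hom Q q q\<^esub>}"
        using a(2) theta_ident[OF q] theta_closed[OF q q basis_H[OF zero_in_steps[OF q]]] by simp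
    next
      fix x assume "x \<in> {\<zero>\<^bsub>Hom Q q q\<^esub>}"
      then have x: "x = \<zero>\<^bsub>Hom Q q q\<^esub>" by simp
      have "Ident Q q \<in> carrier (Hom Q q q)"
        using theta_ident[OF q] theta_closed[OF q q basis_H[OF zero_in_steps[OF q]]] by simp
      then have "x = \<zero> \<odot>\<^bsub>Hom Q q q\<^esub> Ident Q q" using x by simp
      moreover have "x \<in> arrow_ideal R n q q"
        unfolding diag[OF q] x theta_zero[OF q q, symmetric] by (rule imageI) simp
      ultimately show "x \<in> ?k \<inter> arrow_ideal R n q q" by blast
    qed
    fix f g assume "g \<in> arrow_ideal R n q q" "f \<in> arrow_ideal R n q q"
    then show "Comp Q q q q g f \<in> arrow_ideal R n q q"
      using comp[OF q q] arrow_ideal_eq[OF q q] by simp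
  next
    fix p q f g
    assume pq: "p \<in> {1..n}" "q \<in> {1..n}" "p \<noteq> q"
      and f: "f \<in> carrier (Hom Q p q)" and g: "g \<in> carrier (Hom Q q p)"
    have "f \<in> filtration 1 p q" "g \<in> filtration 1 q p"
      using f g pq theta_bij[of p q] theta_bij[of q p] filtration_1_off_diagonal[of p q] filtration_1_off_diagonal[of q p]
      by (auto simp: filtration_def bij_betw_def)
    then show "Comp Q p q p g f \<in> arrow_ideal R n p p" by (rule comp[OF pq(1,2)])
  qed
qed

text \<open>The retraction reads the coefficient at 0, which is that of the identity.\<close>

lemma strong_retraction_property_mesh: "strong_retraction_property R Q"
  unfolding strong_retraction_property_def Obj_mesh
proof (intro conjI ballI exI)
  fix q assume q: "q \<in> {1..n}"
  note 0 = basis_H[OF zero_in_steps[OF q]]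
  show "linear_map R (Hom Q q q) (ring_module R) (\<lambda>x. coordinates q q x 0)"
    by (rule linear_map_compose[OF coordinates_linear[OF q q], of _ "\<lambda>c. c 0"], rule linear_mapI)
       (auto simp: ring_module_def)
  fix x assume x: "x \<in> carrier R"
  have "x \<odot>\<^bsub>Hom Q q q\<^esub> Ident Q q = \<theta> q q (\<lambda>s. x \<otimes> basis_vector R 0 s)"
    using theta_smult[OF q q x 0] theta_ident[OF q] by simp
  then show "coordinates q q (x \<odot>\<^bsub>Hom Q q q\<^esub> Ident Q q) 0 = x"
    using coordinates_theta[OF q q free_module_smult_closed[OF x 0]] x by (simp add: basis_vector_def)
qed (rule retraction_family_mesh)

end

theorem theorem8p8:
  fixes R :: "('k, 'z) ring_scheme" and n :: nat
  assumes "cring R" and "\<one>\<^bsub>R\<^esub> \<noteq> \<zero>\<^bsub>R\<^esub>" and "n \<ge> 2"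
  defines "Q \<equiv> mesh_category R n"
  shows
    "linear_category R Q \<and>
     hom_finite R Q \<and> locally_bounded Q \<and> has_serre_functor R Q \<and> strong_retraction_property R Q \<and>
     (\<forall>p\<in>{1..n}. \<forall>q\<in>{1..n}. free_of_rank R (Hom Q p q) (Min {p, q, n + 1 - p, n + 1 - q})) \<and>
     (\<exists>S0 S1. serre_functor R Q S0 S1 \<and> serre_formulae R n S0 S1 \<and>
        (\<forall>T0 T1. linear_functor R Q Q T0 T1 \<and> serre_formulae R n T0 T1 \<longrightarrow>
           (\<forall>p\<in>{1..n}. \<forall>q\<in>{1..n}. \<forall>f\<in>carrier (Hom Q p q). T1 p q f = S1 p q f))) \<and>
     retraction_family R Q (\<lambda>q. arrow_ideal R n q q) \<and>
     (\<forall>p\<in>{1..n}. \<forall>q\<in>{1..n}.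
        arrow_ideal R n p q = pseudo_radical Q (\<lambda>q. arrow_ideal R n q q) p q) \<and>
     nilpotent_ideal R Q (arrow_ideal R n) \<and>
     zero_ideal Q (ideal_power R Q (arrow_ideal R n) n)"
proof -
  interpret cring R by fact
  interpret mesh R n by unfold_locales (rule assms(3))
  have Q_eq: "Q = mesh_category R n" by (rule meta_eq_to_obj_eq[OF Q_def])
  have rank: "free_of_rank R (Hom Q p q) (Min {p, q, n + 1 - p, n + 1 - q})"
    if "p \<in> {1..n}" "q \<in> {1..n}" for p q
    unfolding Q_eq by (rule free_of_rank_mesh[OF assms(2) that])
  have "hom_finite R Q"
    unfolding hom_finite_def
  proof (intro ballI conjI)
    fix p q assume "p \<in> Obj Q" "q \<in> Obj Q"
    then have pq: "p \<in> {1..n}" "q \<in> {1..n}" by (simp_all add: Q_eq)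
    show "finitely_generated R (Hom Q p q)" "projective R (Hom Q p q)"
      using free_of_rank_imp_finitely_generated[OF _ rank[OF pq]] free_of_rank_imp_projective[OF _ rank[OF pq]]
        module_mesh[OF pq] by (simp_all add: Q_eq)
  qed
  \<comment> \<open>There are only finitely many objects.\<close>
  moreover have "locally_bounded Q" by (simp add: locally_bounded_def Q_eq)
  moreover have "has_serre_functor R Q"
    unfolding has_serre_functor_def Q_eq using serre_functor_mesh by blast
  moreover have "nilpotent_ideal R Q (arrow_ideal R n)"
    unfolding nilpotent_ideal_def Q_eq using zero_ideal_power by blast
  moreover have "\<exists>S0 S1. serre_functor R Q S0 S1 \<and> serre_formulae R n S0 S1 \<and>
        (\<forall>T0 T1. linear_functor R Q Q T0 T1 \<and> serre_formulae R n T0 T1 \<longrightarrow>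
           (\<forall>p\<in>{1..n}. \<forall>q\<in>{1..n}. \<forall>f\<in>carrier (Hom Q p q). T1 p q f = S1 p q f))"
    unfolding Q_eq
    by (rule exI[of _ "\<lambda>p. n + 1 - p"], rule exI[of _ serre_map],
        intro conjI allI impI ballI serre_functor_mesh serre_formulae_mesh)
       (elim conjE, rule serre_functor_unique)
  ultimately show ?thesis
    using rank linear_category_mesh strong_retraction_property_mesh retraction_family_mesh
      arrow_ideal_pseudo_radical zero_ideal_power
    unfolding Q_eq by (intro conjI ballI)
qed

end
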